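(* For every integer $n\geq 0$, the graphical indexed Jones polynomial $$\mathfrak{V}_K^n(t)=(-A^3)^{-w(K)}\sum_S A^{\#_0-\#_1}F(S)\Big|_{A=t^{-1/4}}$$ is a virtual knot invariant.
   Context: Virtual knot diagrams, real crossings with writhe $w(c)\in\{\pm1\}$, $w(K)=\sum_c w(c)$, generalized Reidemeister moves. Chord index: in the Gauss diagram (counterclockwise circle, one chord per real crossing directed from over- to under-preimage and signed by the writhe), for a chord $c$ let $r_\pm(c)$ (resp. $l_\pm(c)$) be the number of chords of sign $\pm$ whose endpoints interlace with those of $c$ and whose tail lies to the left (resp. right) of the arrow $c$ and head to the right (resp. left); $\mathrm{Ind}(c)=r_+(c)-r_-(c)-l_+(c)+l_-(c)$. $C_n(K)=\{c: \mathrm{Ind}(c)\in n\mathbb{Z}\}$. A state $S$ smooths each crossing of $C_n(K)$ by the $0$-smoothing ($A$-smoothing) or $1$-smoothing ($B$-smoothing), leaving the other crossings; $\#_0,\#_1$ count the two kinds of smoothings. For a virtual link diagram $S$, $F(S)$ is the flat virtual link obtained by replacing every remaining real crossing by a flat crossing (flat virtual links are taken up to flat generalized Reidemeister moves). The values lie in $M[t^{1/2},t^{-1/2}]$, where $M$ is the free abelian group (module over $\mathbb{Z}[A^{\pm1}]$) generated by flat virtual links, modulo the relation $F(L\sqcup O)=(-A^2-A^{-2})F(L)$ for $O$ a crossingless circle disjoint from the rest of the diagram. *)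

theory Defs
  imports Main
begin

(* Combinatorial model of virtual link diagrams: a finite set of nodes,
   each a real crossing, a flat crossing, or a 2-valent "bead" (a subdivision
   point on an edge).  Slots of a node are numbered counterclockwise
   (0..3 for crossings, 0..1 for beads); nb is the edge involution on darts.
   Virtual crossings are not recorded (virtual diagrams modulo detour moves
   = such abstract rotation systems).  At a real crossing the strand through
   slots 0,2 is the under strand and the strand through slots 1,3 the over strand. *)

datatype nkind = Real | Flat | Bead

type_synonym dart = "nat \<times> nat"

record pd =
  nodes :: "nat set"
  kind :: "nat \<Rightarrow> nkind"
  nb :: "dart \<Rightarrow> dart"

definition pdeg :: "pd \<Rightarrow> nat \<Rightarrow> nat" where
  "pdeg D v = (if kind D v = Bead then 2 else 4)"

definition darts :: "pd \<Rightarrow> dart set" where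
  "darts D = {(v,s). v \<in> nodes D \<and> s < pdeg D v}"

definition pd_wf :: "pd \<Rightarrow> bool" where
  "pd_wf D \<longleftrightarrow> finite (nodes D) \<and>
     (\<forall>d\<in>darts D. nb D d \<in> darts D \<and> nb D (nb D d) = d \<and> nb D d \<noteq> d)"

definition lnks :: "(dart \<times> dart) list \<Rightarrow> (dart \<Rightarrow> dart) \<Rightarrow> (dart \<Rightarrow> dart)" where
  "lnks ps f = fold (\<lambda>(d,e) g. g(d := e, e := d)) ps f"

(* isomorphism: renaming of nodes and rotation of slots (by an even amount at
   real crossings, so over/under is kept) *)
definition imap :: "(nat \<Rightarrow> nat) \<Rightarrow> (nat \<Rightarrow> nat) \<Rightarrow> pd \<Rightarrow> dart \<Rightarrow> dart" where
  "imap f r D = (\<lambda>(v,s). (f v, (s + r v) mod pdeg D v))"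

definition iso_by :: "(nat \<Rightarrow> nat) \<Rightarrow> (nat \<Rightarrow> nat) \<Rightarrow> pd \<Rightarrow> pd \<Rightarrow> bool" where
  "iso_by f r D D' \<longleftrightarrow> bij_betw f (nodes D) (nodes D') \<and>
     (\<forall>v\<in>nodes D. kind D' (f v) = kind D v \<and> r v < pdeg D v \<and> (kind D v = Real \<longrightarrow> even (r v))) \<and>
     (\<forall>d\<in>darts D. nb D' (imap f r D d) = imap f r D (nb D d))"

definition bead_ins :: "pd \<Rightarrow> pd \<Rightarrow> bool" where
  "bead_ins D D' \<longleftrightarrow> (\<exists>d v. d \<in> darts D \<and> v \<notin> nodes D \<and>
     D' = \<lparr>nodes = insert v (nodes D), kind = (kind D)(v := Bead),
           nb = lnks [(d,(v,0)), ((v,1), nb D d)] (nb D)\<rparr>)"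

(* Reidemeister I: replace a bead by a kink crossing of kind k *)
definition r1 :: "nkind \<Rightarrow> pd \<Rightarrow> pd \<Rightarrow> bool" where
  "r1 k D D' \<longleftrightarrow> (\<exists>b x i p q. b \<in> nodes D \<and> kind D b = Bead \<and> x \<notin> nodes D \<and> i < 4 \<and>
     ((p = nb D (b,0) \<and> q = nb D (b,1)) \<or> (p = nb D (b,1) \<and> q = nb D (b,0))) \<and>
     fst p \<noteq> b \<and> fst q \<noteq> b \<and>
     D' = \<lparr>nodes = insert x (nodes D - {b}), kind = (kind D)(x := k),
           nb = lnks [((x,i),(x,(i+1) mod 4)), ((x,(i+2) mod 4), p), ((x,(i+3) mod 4), q)] (nb D)\<rparr>)"

(* Reidemeister II: two beads (on strands A and B) replaced by a bigon *)
definition r2 :: "nkind \<Rightarrow> pd \<Rightarrow> pd \<Rightarrow> bool" where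
  "r2 k D D' \<longleftrightarrow> (\<exists>b c x y i j p1 q1 p2 q2.
     b \<in> nodes D \<and> c \<in> nodes D \<and> b \<noteq> c \<and> kind D b = Bead \<and> kind D c = Bead \<and>
     x \<notin> nodes D \<and> y \<notin> nodes D \<and> x \<noteq> y \<and> i < 4 \<and> j < 4 \<and>
     (k = Real \<longrightarrow> i mod 2 = (j+1) mod 2) \<and>
     ((p1 = nb D (b,0) \<and> q1 = nb D (b,1)) \<or> (p1 = nb D (b,1) \<and> q1 = nb D (b,0))) \<and>
     ((p2 = nb D (c,0) \<and> q2 = nb D (c,1)) \<or> (p2 = nb D (c,1) \<and> q2 = nb D (c,0))) \<and>
     fst p1 \<notin> {b,c} \<and> fst q1 \<notin> {b,c} \<and> fst p2 \<notin> {b,c} \<and> fst q2 \<notin> {b,c} \<and>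
     D' = \<lparr>nodes = insert x (insert y (nodes D - {b,c})), kind = (kind D)(x := k, y := k),
           nb = lnks [((x,i),(y,(j+1) mod 4)), ((x,(i+1) mod 4),(y,j)),
                      ((x,(i+2) mod 4), p1), ((y,(j+3) mod 4), q1),
                      ((x,(i+3) mod 4), p2), ((y,(j+2) mod 4), q2)] (nb D)\<rparr>)"

(* Reidemeister III: a triangular face x,y,z is replaced by the mirrored triangle *)
definition r3 :: "nkind \<Rightarrow> pd \<Rightarrow> pd \<Rightarrow> bool" where
  "r3 k D D' \<longleftrightarrow> (\<exists>x y z a b c x' y' z'.
     x \<in> nodes D \<and> y \<in> nodes D \<and> z \<in> nodes D \<and> distinct [x,y,z] \<and>
     kind D x = k \<and> kind D y = k \<and> kind D z = k \<and> a < 4 \<and> b < 4 \<and> c < 4 \<and>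
     nb D (x,(a+1) mod 4) = (y,b) \<and> nb D (y,(b+1) mod 4) = (z,c) \<and> nb D (z,(c+1) mod 4) = (x,a) \<and>
     (k = Real \<longrightarrow> ((odd (a+1) \<and> odd b) \<or> (odd (b+1) \<and> odd c) \<or> (odd (c+1) \<and> odd a))) \<and>
     distinct [x',y',z'] \<and> x' \<notin> nodes D \<and> y' \<notin> nodes D \<and> z' \<notin> nodes D \<and>
     (let P1 = nb D (z,(c+3) mod 4); P2 = nb D (y,(b+2) mod 4); P3 = nb D (y,(b+3) mod 4);
          P4 = nb D (x,(a+2) mod 4); P5 = nb D (x,(a+3) mod 4); P6 = nb D (z,(c+2) mod 4);
          AB = (\<lambda>i. (x', (i + a) mod 4)); AC = (\<lambda>i. (z', (i + c + 3) mod 4));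
          BC = (\<lambda>i. (y', (i + b + 2) mod 4))
      in fst ` {P1,P2,P3,P4,P5,P6} \<inter> {x,y,z} = {} \<and>
         D' = \<lparr>nodes = {x',y',z'} \<union> (nodes D - {x,y,z}), kind = (kind D)(x' := k, y' := k, z' := k),
               nb = lnks [(AB 0, P1), (AB 1, P2), (AB 2, AC 0), (AB 3, BC 0), (AC 1, P3),
                          (AC 2, P4), (AC 3, BC 1), (BC 2, P5), (BC 3, P6)] (nb D)\<rparr>))"

definition rmove :: "nkind \<Rightarrow> pd \<Rightarrow> pd \<Rightarrow> bool" where
  "rmove k D D' \<longleftrightarrow> bead_ins D D' \<or> r1 k D D' \<or> r2 k D D' \<or> r3 k D D'"

definition flatdiag :: "pd \<Rightarrow> bool" where
  "flatdiag D \<longleftrightarrow> pd_wf D \<and> (\<forall>v\<in>nodes D. kind D v \<noteq> Real)"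

definition flat_step :: "pd \<Rightarrow> pd \<Rightarrow> bool" where
  "flat_step D D' \<longleftrightarrow> flatdiag D \<and> flatdiag D' \<and> ((\<exists>f r. iso_by f r D D') \<or> rmove Flat D D')"

definition flat_equiv :: "pd \<Rightarrow> pd \<Rightarrow> bool" where
  "flat_equiv = equivclp flat_step"

(* oriented virtual knot diagrams; ori d = True iff dart d is outgoing *)
definition opp :: "pd \<Rightarrow> dart \<Rightarrow> dart" where
  "opp D = (\<lambda>(v,s). (v, (s + pdeg D v div 2) mod pdeg D v))"

definition orientation :: "pd \<Rightarrow> (dart \<Rightarrow> bool) \<Rightarrow> bool" where
  "orientation D ori \<longleftrightarrow> (\<forall>d\<in>darts D. ori (nb D d) \<noteq> ori d \<and> ori (opp D d) \<noteq> ori d)"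

(* from an incoming dart to the next incoming dart along the knot *)
definition kstep :: "pd \<Rightarrow> dart \<Rightarrow> dart" where
  "kstep D d = nb D (opp D d)"

definition oknot :: "pd \<Rightarrow> (dart \<Rightarrow> bool) \<Rightarrow> bool" where
  "oknot D ori \<longleftrightarrow> pd_wf D \<and> nodes D \<noteq> {} \<and> (\<forall>v\<in>nodes D. kind D v \<noteq> Flat) \<and>
     orientation D ori \<and>
     (\<forall>a\<in>darts D. \<forall>b\<in>darts D. \<not> ori a \<longrightarrow> \<not> ori b \<longrightarrow> (\<exists>m. (kstep D ^^ m) a = b))"

definition ostep :: "pd \<times> (dart \<Rightarrow> bool) \<Rightarrow> pd \<times> (dart \<Rightarrow> bool) \<Rightarrow> bool" where
  "ostep K K' \<longleftrightarrow> oknot (fst K) (snd K) \<and> oknot (fst K') (snd K') \<and>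
     ((\<exists>f r. iso_by f r (fst K) (fst K') \<and>
         (\<forall>d\<in>darts (fst K). snd K' (imap f r (fst K) d) = snd K d)) \<or>
      (rmove Real (fst K) (fst K') \<and> nodes (fst K) \<inter> nodes (fst K') \<noteq> {} \<and>
         (\<forall>v\<in>nodes (fst K) \<inter> nodes (fst K'). \<forall>s<pdeg (fst K) v. snd K' (v,s) = snd K (v,s))))"

definition vk_equiv :: "pd \<times> (dart \<Rightarrow> bool) \<Rightarrow> pd \<times> (dart \<Rightarrow> bool) \<Rightarrow> bool" where
  "vk_equiv = equivclp ostep"

definition gdist :: "pd \<Rightarrow> dart \<Rightarrow> dart \<Rightarrow> nat" where
  "gdist D a b = (LEAST m. (kstep D ^^ m) a = b)"

(* p lies strictly on the counterclockwise arc of the Gauss circle from a to b *)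
definition inarc :: "pd \<Rightarrow> dart \<Rightarrow> dart \<Rightarrow> dart \<Rightarrow> bool" where
  "inarc D p a b \<longleftrightarrow> 0 < gdist D a p \<and> gdist D a p < gdist D a b"

definition real_cr :: "pd \<Rightarrow> nat set" where
  "real_cr D = {v \<in> nodes D. kind D v = Real}"

(* under-preimage (head) and over-preimage (tail) of the chord of crossing v *)
definition under_in :: "(dart \<Rightarrow> bool) \<Rightarrow> nat \<Rightarrow> dart" where
  "under_in ori v = (if ori (v,0) then (v,2) else (v,0))"

definition over_in :: "(dart \<Rightarrow> bool) \<Rightarrow> nat \<Rightarrow> dart" where
  "over_in ori v = (if ori (v,1) then (v,3) else (v,1))"

definition csign :: "(dart \<Rightarrow> bool) \<Rightarrow> nat \<Rightarrow> int" where
  "csign ori v = (if snd (over_in ori v) = (snd (under_in ori v) + 3) mod 4 then 1 else -1)"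

definition writhe :: "pd \<Rightarrow> (dart \<Rightarrow> bool) \<Rightarrow> int" where
  "writhe D ori = (\<Sum>v\<in>real_cr D. csign ori v)"

(* chord d has tail left of arrow c and head right of arrow c *)
definition rgt :: "pd \<Rightarrow> (dart \<Rightarrow> bool) \<Rightarrow> nat \<Rightarrow> nat \<Rightarrow> bool" where
  "rgt D ori c d \<longleftrightarrow> inarc D (over_in ori d) (under_in ori c) (over_in ori c) \<and>
                     inarc D (under_in ori d) (over_in ori c) (under_in ori c)"

definition lft :: "pd \<Rightarrow> (dart \<Rightarrow> bool) \<Rightarrow> nat \<Rightarrow> nat \<Rightarrow> bool" where
  "lft D ori c d \<longleftrightarrow> inarc D (over_in ori d) (over_in ori c) (under_in ori c) \<and>
                     inarc D (under_in ori d) (under_in ori c) (over_in ori c)"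

definition chord_index :: "pd \<Rightarrow> (dart \<Rightarrow> bool) \<Rightarrow> nat \<Rightarrow> int" where
  "chord_index D ori c = (\<Sum>d\<in>{d\<in>real_cr D. rgt D ori c d}. csign ori d)
                       - (\<Sum>d\<in>{d\<in>real_cr D. lft D ori c d}. csign ori d)"

definition Cn :: "pd \<Rightarrow> (dart \<Rightarrow> bool) \<Rightarrow> nat \<Rightarrow> nat set" where
  "Cn D ori n = {c \<in> real_cr D. int n dvd chord_index D ori c}"

(* smoothing: crossings in C are smoothed (those in T by the 0/A-smoothing joining
   slots {0,1},{2,3}; those in C - T by the 1/B-smoothing joining {1,2},{3,0});
   node v becomes 2v, a smoothed crossing v becomes beads 2v, 2v+1;
   remaining real crossings become flat *)
definition smap :: "nat set \<Rightarrow> nat set \<Rightarrow> dart \<Rightarrow> dart" where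
  "smap C T = (\<lambda>(v,s). if v \<in> C then
       (if v \<in> T then (if s < 2 then (2*v, s) else (2*v+1, s - 2))
        else (if s = 1 \<or> s = 2 then (2*v, s - 1) else if s = 3 then (2*v+1, 0) else (2*v+1, 1)))
     else (2*v, s))"

definition sinv :: "nat set \<Rightarrow> nat set \<Rightarrow> dart \<Rightarrow> dart" where
  "sinv C T = (\<lambda>(w,s). let v = w div 2 in if v \<in> C then
       (if v \<in> T then (if even w then (v, s) else (v, s + 2))
        else (if even w then (v, s + 1) else (v, (s + 3) mod 4)))
     else (v, s))"

definition smooth :: "pd \<Rightarrow> nat set \<Rightarrow> nat set \<Rightarrow> pd" where
  "smooth D C T = \<lparr>nodes = (\<lambda>v. 2*v) ` nodes D \<union> (\<lambda>v. 2*v+1) ` C,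
     kind = (\<lambda>w. if w div 2 \<in> C then Bead
                 else if kind D (w div 2) = Real then Flat else kind D (w div 2)),
     nb = (\<lambda>d. smap C T (nb D (sinv C T d)))\<rparr>"

(* disjoint union with a crossingless circle *)
definition addO :: "pd \<Rightarrow> pd" where
  "addO D = (let x = (LEAST x. x \<notin> nodes D) in
     \<lparr>nodes = insert x (nodes D), kind = (kind D)(x := Bead),
      nb = lnks [((x,0),(x,1))] (nb D)\<rparr>)"

(* values: finite formal Z-combinations of t^(j/4) F, F a flat diagram, encoded as
   functions (F, j) \<mapsto> coefficient; equality is modulo flat equivalence and
   F(L \<sqcup> O) = (-A^2 - A^-2) F(L) with A = t^(-1/4), i.e. -(t^(1/2) + t^(-1/2)) F(L). *)
definition delta :: "pd \<Rightarrow> int \<Rightarrow> pd \<times> int \<Rightarrow> int" where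
  "delta F j = (\<lambda>x. if x = (F,j) then 1 else 0)"

definition relgen :: "(pd \<times> int \<Rightarrow> int) set" where
  "relgen = {(\<lambda>x. delta F j x - delta F' j x) | F F' j. flat_equiv F F'}
          \<union> {(\<lambda>x. delta (addO F) j x + delta F (j+2) x + delta F (j-2) x) | F j. flatdiag F}"

inductive_set relspan :: "(pd \<times> int \<Rightarrow> int) set" where
  zero: "(\<lambda>x. 0) \<in> relspan"
| add: "f \<in> relspan \<Longrightarrow> g \<in> relgen \<Longrightarrow> (\<lambda>x. f x + g x) \<in> relspan"
| sub: "f \<in> relspan \<Longrightarrow> g \<in> relgen \<Longrightarrow> (\<lambda>x. f x - g x) \<in> relspan"

definition veq :: "(pd \<times> int \<Rightarrow> int) \<Rightarrow> (pd \<times> int \<Rightarrow> int) \<Rightarrow> bool" where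
  "veq f g \<longleftrightarrow> (\<lambda>x. f x - g x) \<in> relspan"

(* graphical indexed Jones polynomial:
   (-A^3)^(-w) \<Sum>_S A^(#0 - #1) F(S) at A = t^(-1/4)
   = \<Sum>_S (-1)^w t^((3w - #0 + #1)/4) F(S) *)
definition graphical_jones :: "nat \<Rightarrow> pd \<Rightarrow> (dart \<Rightarrow> bool) \<Rightarrow> pd \<times> int \<Rightarrow> int" where
  "graphical_jones n D ori = (let C = Cn D ori n; w = writhe D ori in
     (\<lambda>x. \<Sum>T\<in>Pow C. (if even w then 1 else -1) *
            delta (smooth D C T) (3*w - int (card T) + int (card (C - T))) x))"

end

(* A diagram is recorded by its planar diagram code: the edges are labelled, and each node is the
   cyclic sequence of the labels around it.  Two flat diagrams with the same code are isomorphic,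
   every multiset of cyclic sequences in which each label occurs twice or not at all is the code of a
   diagram, and the moves and smoothings become local replacements of a few sequences, whatever the
   rest of the code is.  At this level the state sum obeys the skein relation, and Kauffman's proof
   of invariance applies to the smoothed crossings, with flat moves for the others.

   Which crossings are smoothed is read off from an integer height on the edges which changes by one
   at each passage through a crossing, with a sign given by the direction of the crossed strand: the
   index of a crossing is a height difference at it.  Heights extend across every move.  So the new
   crossing of a first move has index 0, those of a second move have the same index, and at a third
   move the indices are kept and a signed sum of the three of them is zero, so that exactly two of
   them are never divisible by n. *)

theory Submission
  imports Defs "HOL-Library.Multiset" "HOL-Library.Nat_Bijection"
begin

section \<open>Planar diagram codes\<close>

text \<open>Two obstacles shape the proof. Smoothing may join the outer edges of a move to each
  other or close them into circles, and then the side conditions of \<open>r2\<close> and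
  \<open>r3\<close>, that no outer dart lies at a replaced node, may fail. On codes such accidents
  are mere coincidences of labels: rules for chains of beads hold whatever the labels are, and the
  flat second and third move ask only for distinct outer labels. The second obstacle is that the
  index is read off from arcs of the whole Gauss circle, which every move renumbers; heights make
  the comparison local. A height exists because a crossing changes it by opposite amounts at its
  under and at its over passage, so nothing accumulates around the knot. Powers of A are kept as
  exponents of t^(1/4): A lowers the exponent by 1, and the loop value -A^2 - A^(-2) moves it by 2
  both ways. A kink yields the factor -A^3 or -A^(-3), that is a sign and a shift by 3, which (-1)^w
  and 3w undo. At a third move the over/under condition is used exactly when all three crossings are
  smoothed; it tells which of them to resolve.\<close>

lemma relspan_gen: "g \<in> relgen \<Longrightarrow> g \<in> relspan"
  using relspan.add[OF relspan.zero, of g] by simp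

text \<open>\<open>relspan\<close> grows by one relation at a time, so closure under sums takes an
  induction over the steps that build one of the summands.\<close>

lemma relspan_add: "g \<in> relspan \<Longrightarrow> f \<in> relspan \<Longrightarrow> (\<lambda>x. f x + g x) \<in> relspan"
proof (induction rule: relspan.induct)
  case zero then show ?case by simp
next
  case (add g k)
  have "(\<lambda>x. (f x + g x) + k x) \<in> relspan" using relspan.add[OF add.IH[OF add.prems] add.hyps(2)] .
  then show ?case by (simp add: add.assoc)
next
  case (sub g k)
  have "(\<lambda>x. (f x + g x) - k x) \<in> relspan" using relspan.sub[OF sub.IH[OF sub.prems] sub.hyps(2)] .
  then show ?case by (simp add: algebra_simps)
qed

lemma relspan_uminus: "f \<in> relspan \<Longrightarrow> (\<lambda>x. - f x) \<in> relspan"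
proof (induction rule: relspan.induct)
  case zero then show ?case using relspan.zero by simp
next
  case (add f g)
  then show ?case using relspan.sub[OF add.IH add.hyps(2)] by (simp add: algebra_simps)
next
  case (sub f g)
  then show ?case using relspan.add[OF sub.IH sub.hyps(2)] by (simp add: algebra_simps)
qed

lemma veq_refl [simp]: "veq f f" by (simp add: veq_def relspan.zero)

lemma veq_sym: "veq f g \<Longrightarrow> veq g f"
  unfolding veq_def using relspan_uminus[of "\<lambda>x. f x - g x"] by simp

lemma veq_add: "veq f g \<Longrightarrow> veq f' g' \<Longrightarrow> veq (\<lambda>x. f x + f' x) (\<lambda>x. g x + g' x)"
  unfolding veq_def using relspan_add[of "\<lambda>x. f' x - g' x" "\<lambda>x. f x - g x"]
  by (simp add: algebra_simps)

lemma veq_uminus: "veq f g \<Longrightarrow> veq (\<lambda>x. - f x) (\<lambda>x. - g x)"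
  unfolding veq_def using relspan_uminus[of "\<lambda>x. f x - g x"] by (simp add: algebra_simps)

lemma veq_trans [trans]: "veq f g \<Longrightarrow> veq g h \<Longrightarrow> veq f h"
  unfolding veq_def using relspan_add[of "\<lambda>x. g x - h x" "\<lambda>x. f x - g x"] by simp

lemma veq_sum:
  assumes "\<And>a. a \<in> A \<Longrightarrow> veq (f a) (g a)"
  shows "veq (\<lambda>x. \<Sum>a\<in>A. f a x) (\<lambda>x. \<Sum>a\<in>A. g a x)"
proof (cases "finite A")
  case True
  then show ?thesis using assms
  proof (induction A)
    case empty then show ?case by simp
  next
    case (insert a A)
    then have "veq (f a) (g a)" "veq (\<lambda>x. \<Sum>a\<in>A. f a x) (\<lambda>x. \<Sum>a\<in>A. g a x)" by auto
    from veq_add[OF this] insert.hyps show ?case by simp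
  qed
qed simp

lemma veq_sign: "veq f g \<Longrightarrow> veq (\<lambda>x. (if P then 1 else - 1) * f x) (\<lambda>x. (if P then 1 else - 1) * g x)"
  using veq_uminus by (cases P) auto

text \<open>A cyclic word is encoded by the set of its rotations: equality of these sets is equality
  up to the choice of the first slot, the freedom that \<open>iso_by\<close> grants at a flat node.
  Reflections are not identified, since slots are numbered counterclockwise.\<close>

definition vert :: "nat list \<Rightarrow> nat list set" where
  "vert l = range (\<lambda>k. rotate k l)"

abbreviation bd :: "nat \<Rightarrow> nat \<Rightarrow> nat list set" where
  "bd a b \<equiv> vert [a, b]"

abbreviation fl :: "nat \<Rightarrow> nat \<Rightarrow> nat \<Rightarrow> nat \<Rightarrow> nat list set" where
  "fl a b c d \<equiv> vert [a, b, c, d]"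

lemma vert_self: "l \<in> vert l"
  unfolding vert_def by (metis rangeI rotate0 id_apply)

lemma vert_eqD: "vert l = vert l' \<Longrightarrow> \<exists>k. l' = rotate k l"
  using vert_self[of l'] by (auto simp: vert_def)

lemma rotate_rotate1: "rotate k (rotate1 l) = rotate (Suc k) l"
  by (metis rotate1_rotate_swap rotate_Suc)

lemma vert_rotate1: "vert (rotate1 l) = vert l"
proof
  show "vert (rotate1 l) \<subseteq> vert l" unfolding vert_def by (auto simp only: rotate_rotate1)
  show "vert l \<subseteq> vert (rotate1 l)"
  proof
    fix m assume "m \<in> vert l"
    then obtain k where k: "m = rotate k l" by (auto simp: vert_def)
    show "m \<in> vert (rotate1 l)"
    proof (cases "l = []")
      case True with k show ?thesis using vert_self by simp
    next
      case False
      have "rotate (k + length l - 1) (rotate1 l) = rotate (Suc (k + length l - 1)) l"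
        by (simp only: rotate_rotate1)
      also have "Suc (k + length l - 1) = k + length l" using False by (cases l) auto
      also have "rotate (k + length l) l = m" using k by (metis rotate_conv_mod mod_add_self2)
      finally show ?thesis unfolding vert_def by (metis rangeI)
    qed
  qed
qed

lemma vert_rotate: "vert (rotate k l) = vert l"
  by (induction k) (auto simp: vert_rotate1)

lemma bd_commute: "bd a b = bd b a"
  using vert_rotate1[of "[a,b]"] by simp

lemma fl_rotate: "fl a b c d = fl b c d a"
  using vert_rotate1[of "[a,b,c,d]"] by simp

text \<open>Rotations have the same letters, so the chosen representative does not matter;
  \<open>lbv_vert\<close> removes the choice.\<close>

definition lbv :: "nat list set \<Rightarrow> nat multiset" where
  "lbv S = mset (SOME l. l \<in> S)"

lemma lbv_vert [simp]: "lbv (vert l) = mset l"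
proof -
  have "(SOME m. m \<in> vert l) \<in> vert l" using vert_self by (rule someI)
  then obtain k where "(SOME m. m \<in> vert l) = rotate k l" by (auto simp: vert_def)
  moreover have "mset (rotate1 m) = mset m" for m :: "nat list" by (cases m) auto
  then have "mset (rotate k l) = mset l" for k by (induction k) auto
  ultimately show ?thesis by (simp add: lbv_def)
qed

definition lb :: "nat list set multiset \<Rightarrow> nat multiset" where
  "lb M = \<Sum>\<^sub># (image_mset lbv M)"

lemma lb_simps [simp]: "lb {#} = {#}" "lb (add_mset X M) = lbv X + lb M" "lb (M + M') = lb M + lb M'"
  by (auto simp: lb_def)

definition node_shape :: "nat list set \<Rightarrow> bool" where
  "node_shape X \<longleftrightarrow> (\<exists>l. X = vert l \<and> (length l = 2 \<or> length l = 4))"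

lemma node_shape_simps [simp]: "node_shape (bd a b)" "node_shape (fl a b c d)"
  unfolding node_shape_def by (rule exI[of _ "[a, b]"], simp) (rule exI[of _ "[a, b, c, d]"], simp)

text \<open>Each edge has two ends, hence the count 2; lengths 2 and 4 are those of beads and
  crossings. These conditions suffice for a diagram with this code to exist, by
  \<open>wfc_realizable\<close>.\<close>

definition wfc :: "nat list set multiset \<Rightarrow> bool" where
  "wfc M \<longleftrightarrow> (\<forall>X\<in>#M. node_shape X) \<and> (\<forall>k. count (lb M) k = 0 \<or> count (lb M) k = 2)"

section \<open>Edge labellings of a diagram and the resulting code\<close>

definition vl :: "pd \<Rightarrow> (dart \<Rightarrow> nat) \<Rightarrow> nat \<Rightarrow> nat list" where
  "vl D e v = map (\<lambda>s. e (v, s)) [0..<pdeg D v]"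

definition lab :: "pd \<Rightarrow> (dart \<Rightarrow> nat) \<Rightarrow> bool" where
  "lab D e \<longleftrightarrow> pd_wf D \<and> (\<forall>d\<in>darts D. e (nb D d) = e d) \<and>
     (\<forall>d\<in>darts D. \<forall>d'\<in>darts D. e d = e d' \<longrightarrow> d' = d \<or> d' = nb D d)"

text \<open>The set \<open>A\<close> of nodes is a parameter so that a code can be split, above all
  into the smoothed crossings and the rest.\<close>

definition code :: "pd \<Rightarrow> (dart \<Rightarrow> nat) \<Rightarrow> nat set \<Rightarrow> nat list set multiset" where
  "code D e A = image_mset (\<lambda>v. vert (vl D e v)) (mset_set A)"

definition codes :: "pd \<Rightarrow> nat list set multiset \<Rightarrow> bool" where
  "codes D M \<longleftrightarrow> flatdiag D \<and> (\<exists>e. lab D e \<and> M = code D e (nodes D))"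

lemma finite_darts: "pd_wf D \<Longrightarrow> finite (darts D)"
proof -
  assume "pd_wf D"
  then have "finite (nodes D)" by (simp add: pd_wf_def)
  moreover have "darts D \<subseteq> nodes D \<times> {..<4}" by (auto simp: darts_def pdeg_def split: if_splits)
  ultimately show ?thesis by (meson finite_SigmaI finite_lessThan finite_subset)
qed

lemma length_vl [simp]: "length (vl D e v) = pdeg D v" by (simp add: vl_def)

lemma count_vl: "count (mset (vl D e v)) k = card {s. s < pdeg D v \<and> e (v, s) = k}"
proof -
  have "count (mset (vl D e v)) k = card {i. i < length (vl D e v) \<and> k = vl D e v ! i}"
    by (simp only: count_mset length_filter_conv_card count_list_eq_length_filter)
  also have "{i. i < length (vl D e v) \<and> k = vl D e v ! i} = {s. s < pdeg D v \<and> e (v, s) = k}"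
    by (auto simp: vl_def)
  finally show ?thesis .
qed

text \<open>Counts of letters become counts of darts; this is the bridge between well-formed codes
  and labellings that separate edges.\<close>

lemma count_lb_code:
  "finite A \<Longrightarrow> count (lb (code D e A)) k = card {d. fst d \<in> A \<and> snd d < pdeg D (fst d) \<and> e d = k}"
proof (induction A rule: finite_induct)
  case empty then show ?case by (simp add: code_def)
next
  case (insert v A)
  let ?S = "\<lambda>A. {d. fst d \<in> A \<and> snd d < pdeg D (fst d) \<and> e d = k}"
  have fin: "finite (?S B)" if "finite B" for B
  proof -
    have "?S B \<subseteq> B \<times> {..<4}" by (auto simp: pdeg_def split: if_splits)
    then show ?thesis using that by (meson finite_SigmaI finite_lessThan finite_subset)
  qed
  have "?S (insert v A) = ?S {v} \<union> ?S A" by auto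
  moreover have "?S {v} \<inter> ?S A = {}" using insert.hyps by auto
  ultimately have "card (?S (insert v A)) = card (?S {v}) + card (?S A)"
    using fin[of "{v}"] fin[OF insert.hyps(1)] by (simp add: card_Un_disjoint)
  moreover have "?S {v} = Pair v ` {s. s < pdeg D v \<and> e (v, s) = k}" by (auto simp: image_iff)
  then have "card (?S {v}) = card {s. s < pdeg D v \<and> e (v, s) = k}"
    by (simp add: card_image inj_on_def)
  ultimately show ?case using insert by (simp add: code_def count_vl)
qed

lemma darts_eq: "{d. fst d \<in> nodes D \<and> snd d < pdeg D (fst d) \<and> P d} = {d \<in> darts D. P d}"
  by (auto simp: darts_def)

lemma lab_wfc:
  assumes "lab D e"
  shows "wfc (code D e (nodes D))"
proof -
  have wf: "pd_wf D" using assms by (simp add: lab_def)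
  have fin: "finite (nodes D)" using wf by (simp add: pd_wf_def)
  have "card {d \<in> darts D. e d = k} = 0 \<or> card {d \<in> darts D. e d = k} = 2" for k
  proof (cases "\<exists>d\<in>darts D. e d = k")
    case True
    then obtain d where d: "d \<in> darts D" "e d = k" by auto
    have n: "nb D d \<in> darts D" "nb D d \<noteq> d" using wf d by (auto simp: pd_wf_def)
    have "{d \<in> darts D. e d = k} = {d, nb D d}"
      using assms d n unfolding lab_def by (auto) (metis surj_pair)+
    then show ?thesis using n by simp
  next
    case False
    then have "{d \<in> darts D. e d = k} = {}" by auto
    then show ?thesis by (metis card.empty)
  qed
  then have "count (lb (code D e (nodes D))) k = 0 \<or> count (lb (code D e (nodes D))) k = 2" for k
    by (simp add: count_lb_code[OF fin] darts_eq)
  moreover have "node_shape X" if X: "X \<in># code D e (nodes D)" for X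
  proof -
    obtain v where v: "X = vert (vl D e v)" using X by (auto simp: code_def)
    have "length (vl D e v) = 2 \<or> length (vl D e v) = 4" by (simp add: pdeg_def)
    then show ?thesis unfolding node_shape_def v by blast
  qed
  ultimately show ?thesis by (auto simp: wfc_def)
qed

text \<open>The two ends of an edge already use up two occurrences of its label, so a count of at
  most 2 leaves no room for a third dart. After a move it is thus enough to count letters in the new
  code.\<close>

lemma labI:
  assumes wf: "pd_wf D" and ec: "\<forall>d\<in>darts D. e (nb D d) = e d" and good: "\<forall>k. count (lb (code D e (nodes D))) k \<le> 2"
  shows "lab D e"
proof -
  have fin: "finite (nodes D)" using wf by (simp add: pd_wf_def)
  have "d' = d \<or> d' = nb D d" if d: "d \<in> darts D" "d' \<in> darts D" "e d = e d'" for d d'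
  proof -
    let ?S = "{x \<in> darts D. e x = e d}"
    have "card ?S \<le> 2" using good by (simp add: count_lb_code[OF fin] darts_eq)
    moreover have n: "nb D d \<in> ?S" "nb D d \<noteq> d" "d \<in> ?S" using wf d ec by (auto simp: pd_wf_def)
    moreover have "finite ?S" using finite_darts[OF wf] by simp
    ultimately have "?S = {d, nb D d}"
      by (metis (no_types, lifting) card_2_iff card_seteq empty_subsetI insert_subset)
    then show ?thesis using d by auto
  qed
  then show ?thesis using wf ec by (auto simp: lab_def)
qed

text \<open>Equal multisets of values admit a value-preserving matching of the index sets; it
  provides the renaming of nodes in \<open>codes_iso\<close>.\<close>

lemma image_mset_bij:
  assumes "finite A" "finite B" "image_mset f (mset_set A) = image_mset g (mset_set B)"
  shows "\<exists>h. bij_betw h A B \<and> (\<forall>a\<in>A. g (h a) = f a)"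
  using assms
proof (induction A arbitrary: B rule: finite_induct)
  case empty
  then have "B = {}" by (metis image_mset_is_empty_iff mset_set.empty mset_set_empty_iff)
  then show ?case by (simp add: bij_betw_def)
next
  case (insert a A)
  then have "f a \<in># image_mset g (mset_set B)" by (metis image_mset_add_mset mset_set.insert union_single_eq_member)
  then obtain b where b: "b \<in> B" "g b = f a" using insert.prems by auto
  have "mset_set B = add_mset b (mset_set (B - {b}))"
    using b insert.prems by (simp add: mset_set.remove)
  then have "image_mset f (mset_set A) = image_mset g (mset_set (B - {b}))"
    using insert b by simp
  from insert.IH[OF _ this] insert.prems obtain h where
    h: "bij_betw h A (B - {b})" "\<forall>a\<in>A. g (h a) = f a" by auto
  have "bij_betw (h(a := b)) A (B - {b})" using h insert.hyps
    by (metis (no_types, lifting) bij_betw_cong fun_upd_apply)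
  then have "bij_betw (h(a := b)) (insert a A) (insert b (B - {b}))"
    using insert.hyps by (simp add: bij_betw_def inj_on_def) blast
  then have "bij_betw (h(a := b)) (insert a A) B" using b by (simp add: insert_absorb)
  moreover have "\<forall>x\<in>insert a A. g ((h(a := b)) x) = f x" using h b by auto
  ultimately show ?case by blast
qed

lemma mod_add_inj:
  fixes s s' r n :: nat
  assumes "s < n" "s' < n" "(s + r) mod n = (s' + r) mod n"
  shows "s = s'"
proof -
  have *: "s \<le> s'" if "s < n" "s' < n" "(s + r) mod n = (s' + r) mod n" for s s' :: nat
  proof (rule ccontr)
    assume "\<not> s \<le> s'"
    then have "n dvd (s + r) - (s' + r)" using that by (intro mod_eq_dvd_iff_nat[THEN iffD1]) auto
    then have "n dvd s - s'" by simp
    then show False using that \<open>\<not> s \<le> s'\<close> by (meson dvd_imp_le less_imp_diff_less not_le zero_less_diff)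
  qed
  show ?thesis using *[of s s'] *[of s' s] assms by auto
qed

text \<open>Matching equal words renames the nodes, and the rotation between matched words is the
  shift of the slots. Edges then agree because a label determines its two darts. Flatness matters:
  the shift may be odd, and a word does not tell over from under.\<close>

lemma codes_iso:
  assumes "codes D M" "codes D' M"
  shows "\<exists>f r. iso_by f r D D'"
proof -
  obtain e e' where e: "lab D e" "M = code D e (nodes D)" "flatdiag D"
    and e': "lab D' e'" "M = code D' e' (nodes D')" "flatdiag D'" using assms by (auto simp: codes_def)
  have fin: "finite (nodes D)" "finite (nodes D')" using e e' by (auto simp: lab_def pd_wf_def)
  obtain f where f: "bij_betw f (nodes D) (nodes D')"
    "\<forall>v\<in>nodes D. vert (vl D' e' (f v)) = vert (vl D e v)"
    using image_mset_bij[OF fin] e e' unfolding code_def by metis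
  have "\<exists>k. vl D e v = rotate k (vl D' e' (f v))" if "v \<in> nodes D" for v
    using vert_eqD[of "vl D' e' (f v)" "vl D e v"] f that by auto
  then obtain k where k: "\<And>v. v \<in> nodes D \<Longrightarrow> vl D e v = rotate (k v) (vl D' e' (f v))" by metis
  define r where "r v = k v mod pdeg D v" for v
  have deg: "pdeg D' (f v) = pdeg D v" if "v \<in> nodes D" for v
    using arg_cong[OF k[OF that], of length] by simp
  have fn: "f v \<in> nodes D'" if "v \<in> nodes D" for v using f that by (auto simp: bij_betw_def)
  \<comment> \<open>Neither node is real, so the length of the word decides between a flat crossing
    and a bead.\<close>
  have kind: "kind D' (f v) = kind D v" if "v \<in> nodes D" for v
  proof -
    have "kind D v \<noteq> Real" "kind D' (f v) \<noteq> Real" using e e' that fn by (auto simp: flatdiag_def)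
    then show ?thesis using deg[OF that] by (cases "kind D v"; cases "kind D' (f v)") (auto simp: pdeg_def)
  qed
  have pos: "0 < pdeg D v" for v by (simp add: pdeg_def)
  have lbl: "e' (imap f r D d) = e d" if d0: "d \<in> darts D" for d
  proof -
    obtain v s where d: "d = (v, s)" "v \<in> nodes D" "s < pdeg D v" using d0 by (cases d) (auto simp: darts_def)
    have "e (v, s) = vl D e v ! s" using d by (simp add: vl_def)
    also have "\<dots> = vl D' e' (f v) ! ((k v + s) mod pdeg D v)"
      using k[OF d(2)] d deg[OF d(2)] by (simp add: nth_rotate)
    also have "\<dots> = e' (f v, (k v + s) mod pdeg D v)"
      using deg[OF d(2)] pos[of v] by (simp add: vl_def)
    also have "(k v + s) mod pdeg D v = (s + r v) mod pdeg D v" by (simp add: r_def mod_simps add.commute)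
    finally show ?thesis by (simp add: imap_def d)
  qed
  have imd: "imap f r D d \<in> darts D'" if "d \<in> darts D" for d
    using that fn deg pos by (auto simp: imap_def darts_def)
  have inj: "d = d'" if d0: "d \<in> darts D" "d' \<in> darts D" "imap f r D d = imap f r D d'" for d d'
  proof -
    obtain v s v' s' where d: "d = (v, s)" "v \<in> nodes D" "s < pdeg D v" "d' = (v', s')" "v' \<in> nodes D" "s' < pdeg D v'"
      using d0 by (cases d, cases d') (auto simp: darts_def)
    have vv: "v = v'" using f d0 d by (auto simp: imap_def bij_betw_def inj_on_def)
    have "(s + r v) mod pdeg D v = (s' + r v) mod pdeg D v" using d0 d vv by (auto simp: imap_def)
    then have "s = s'" using d vv mod_add_inj by blast
    then show ?thesis using d vv by simp
  qed
  have "nb D' (imap f r D d) = imap f r D (nb D d)" if d: "d \<in> darts D" for d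
  proof -
    have n: "nb D d \<in> darts D" "nb D d \<noteq> d" "e (nb D d) = e d" using e d by (auto simp: lab_def pd_wf_def)
    have "e' (imap f r D d) = e' (imap f r D (nb D d))" using lbl n d by simp
    then have "imap f r D (nb D d) = imap f r D d \<or> imap f r D (nb D d) = nb D' (imap f r D d)"
      using e' imd d n by (auto simp: lab_def)
    then show ?thesis using inj n d by metis
  qed
  moreover have "r v < pdeg D v" for v using pos by (simp add: r_def)
  ultimately have "iso_by f r D D'" using f kind e
    by (auto simp: iso_by_def flatdiag_def)
  then show ?thesis by blast
qed

lemma wfc_count: "wfc M \<Longrightarrow> count (lb M) k = 0 \<or> count (lb M) k = 2" by (simp add: wfc_def)

text \<open>The words themselves, listed in some order, serve as nodes, and a dart is joined to the
  only other dart carrying its letter.\<close>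

lemma wfc_realizable:
  assumes "wfc M"
  shows "\<exists>D. codes D M"
proof -
  have "\<exists>ls. M = mset (map vert ls) \<and> (\<forall>l\<in>set ls. length l = 2 \<or> length l = 4)"
    if "\<forall>X\<in>#M. node_shape X" for M
    using that
  proof (induction M)
    case empty then show ?case by (intro exI[of _ "[]"]) simp
  next
    case (add X M)
    have "\<forall>X\<in>#M. node_shape X" "node_shape X" using add.prems by auto
    with add.IH obtain ls l where ls: "M = mset (map vert ls)" "\<forall>l\<in>set ls. length l = 2 \<or> length l = 4"
      "X = vert l" "length l = 2 \<or> length l = 4" unfolding node_shape_def by blast
    show ?case
    proof (intro exI conjI)
      show "add_mset X M = mset (map vert (l # ls))" by (simp add: ls(1,3))
      show "\<forall>l\<in>set (l # ls). length l = 2 \<or> length l = 4" using ls(2,4) by simp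
    qed
  qed
  then obtain ls where ls: "M = mset (map vert ls)" "\<forall>l\<in>set ls. length l = 2 \<or> length l = 4"
    using assms unfolding wfc_def by blast
  define e :: "dart \<Rightarrow> nat" where "e = (\<lambda>(v, s). ls ! v ! s)"
  define S where "S = {(v, s). v < length ls \<and> s < length (ls ! v)}"
  \<comment> \<open>The partner is a definite description; \<open>ex\<close> derives its unique
    existence from the count 2.\<close>
  define D where "D = \<lparr>nodes = {..<length ls}, kind = (\<lambda>v. if length (ls ! v) = 2 then Bead else Flat),
     nb = (\<lambda>d. THE d'. d' \<in> S \<and> d' \<noteq> d \<and> e d' = e d)\<rparr>"
  have deg: "pdeg D v = length (ls ! v)" if "v < length ls" for v
    using ls(2) nth_mem[OF that] by (auto simp: D_def pdeg_def)
  have dS: "darts D = S" using deg by (auto simp: darts_def S_def D_def)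
  have nodes: "nodes D = {..<length ls}" by (simp add: D_def)
  have vl: "vl D e v = ls ! v" if "v < length ls" for v
    using deg[OF that] by (intro nth_equalityI) (auto simp: vl_def e_def)
  have cd: "code D e (nodes D) = M"
  proof -
    have "mset_set {..<length ls} = mset [0..<length ls]" by (simp add: lessThan_atLeast0)
    then have "code D e (nodes D) = mset (map (\<lambda>v. vert (vl D e v)) [0..<length ls])"
      by (simp add: code_def nodes)
    also have "map (\<lambda>v. vert (vl D e v)) [0..<length ls] = map vert ls"
      by (intro nth_equalityI) (auto simp: vl)
    finally show ?thesis using ls by simp
  qed
  have card: "card {d \<in> S. e d = k} = 0 \<or> card {d \<in> S. e d = k} = 2" for k
    using wfc_count[OF assms, of k] cd count_lb_code[of "nodes D" D e k] by (simp add: darts_eq dS) (simp add: nodes)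
  have finS: "finite S"
  proof -
    have "S = Sigma {..<length ls} (\<lambda>v. {..<length (ls ! v)})" by (auto simp: S_def)
    then show ?thesis by simp
  qed
  have ex: "\<exists>!d'. d' \<in> S \<and> d' \<noteq> d \<and> e d' = e d" if "d \<in> S" for d
  proof -
    have d: "d \<in> {x \<in> S. e x = e d}" using that by simp
    then have "{x \<in> S. e x = e d} \<noteq> {}" by blast
    then have "card {x \<in> S. e x = e d} \<noteq> 0" using finS by (simp only: card_eq_0_iff) simp
    then have "card {x \<in> S. e x = e d} = 2" using card[of "e d"] by simp
    then obtain a b where ab: "{x \<in> S. e x = e d} = {a, b}" "a \<noteq> b" by (auto simp: card_2_iff)
    show ?thesis
    proof (cases "d = a")
      case True then show ?thesis using ab by (intro ex1I[of _ b]) auto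
    next
      case False then have "d = b" using d ab by auto
      then show ?thesis using ab by (intro ex1I[of _ a]) auto
    qed
  qed
  have nb: "nb D d \<in> S \<and> nb D d \<noteq> d \<and> e (nb D d) = e d" if "d \<in> S" for d
    using theI'[OF ex[OF that]] by (simp add: D_def)
  have nbu: "d' = nb D d" if "d \<in> S" "d' \<in> S" "d' \<noteq> d" "e d' = e d" for d d'
    using ex[OF that(1)] nb[OF that(1)] that by blast
  have "nb D (nb D d) = d" if "d \<in> S" for d using nb[OF that] nbu[of "nb D d" d] that by metis
  then have wf: "pd_wf D" using nb by (auto simp: pd_wf_def dS) (auto simp: nodes)
  have "lab D e" unfolding lab_def dS
  proof (intro conjI ballI impI)
    show "pd_wf D" by (rule wf)
    show "e (nb D d) = e d" if "d \<in> S" for d using nb[OF that] by simp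
    show "d' = d \<or> d' = nb D d" if "d \<in> S" "d' \<in> S" "e d = e d'" for d d' using nbu that by metis
  qed
  moreover have "flatdiag D" using wf by (auto simp: flatdiag_def) (auto simp: D_def split: if_splits)
  ultimately show ?thesis using cd unfolding codes_def by blast
qed

text \<open>By \<open>codes_equiv\<close> the class modulo \<open>veq\<close> does not depend on the
  chosen diagram. The number \<open>j\<close> stands for the factor t^(j/4).\<close>

definition val :: "nat list set multiset \<Rightarrow> int \<Rightarrow> pd \<times> int \<Rightarrow> int" where
  "val M j = delta (SOME D. codes D M) j"

lemma flat_equiv_sym: "flat_equiv D D' \<Longrightarrow> flat_equiv D' D" unfolding flat_equiv_def by (rule equivclp_sym)
lemma flat_equiv_trans: "flat_equiv D D' \<Longrightarrow> flat_equiv D' E \<Longrightarrow> flat_equiv D E"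
  unfolding flat_equiv_def by (rule equivclp_trans)

lemma flat_equiv_step: "flat_step D D' \<Longrightarrow> flat_equiv D D'" unfolding flat_equiv_def by (rule r_into_equivclp)

lemma codes_equiv: "codes D M \<Longrightarrow> codes D' M \<Longrightarrow> flat_equiv D D'"
  using codes_iso[of D M D'] by (intro flat_equiv_step) (auto simp: flat_step_def codes_def)

lemma delta_equiv: "flat_equiv D D' \<Longrightarrow> veq (delta D j) (delta D' j)"
  unfolding veq_def by (rule relspan_gen) (auto simp: relgen_def)

lemma val_codes: "codes D M \<Longrightarrow> veq (delta D j) (val M j)"
  unfolding val_def by (intro delta_equiv codes_equiv[of D M]) (auto intro: someI)

lemma val_move: "codes D M \<Longrightarrow> codes D' M' \<Longrightarrow> flat_equiv D D' \<Longrightarrow> veq (val M j) (val M' j)"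
  using val_codes[of D M j] val_codes[of D' M' j] delta_equiv[of D D' j] veq_sym veq_trans by metis

lemma code_extract:
  assumes "finite A" "code D e A = add_mset X M"
  shows "\<exists>a\<in>A. vert (vl D e a) = X \<and> code D e (A - {a}) = M"
proof -
  have "X \<in># code D e A" using assms by simp
  then obtain a where a: "a \<in> A" "vert (vl D e a) = X" using assms(1) by (auto simp: code_def)
  then have "mset_set A = add_mset a (mset_set (A - {a}))" using assms(1) by (simp add: mset_set.remove)
  then show ?thesis using assms a unfolding code_def by auto
qed

lemma code_insert [simp]: "finite A \<Longrightarrow> a \<notin> A \<Longrightarrow> code D e (insert a A) = add_mset (vert (vl D e a)) (code D e A)"
  by (simp add: code_def)

lemma code_cong:
  "finite A \<Longrightarrow> (\<And>v s. v \<in> A \<Longrightarrow> s < pdeg D v \<Longrightarrow> e (v, s) = e' (v, s)) \<Longrightarrow> (\<And>v. v \<in> A \<Longrightarrow> pdeg D' v = pdeg D v)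
    \<Longrightarrow> code D e A = code D' e' A"
  unfolding code_def by (intro image_mset_cong) (auto simp: vl_def intro!: arg_cong[of _ _ vert])

section \<open>Relinking darts\<close>

definition ends :: "('a \<times> 'a) list \<Rightarrow> 'a list" where "ends ps = map fst ps @ map snd ps"

lemma lnks_notin: "d \<notin> set (ends ps) \<Longrightarrow> lnks ps f d = f d"
  unfolding lnks_def ends_def by (induction ps arbitrary: f) auto

lemma lnks_in:
  "distinct (ends ps) \<Longrightarrow> (d, d') \<in> set ps \<Longrightarrow> lnks ps f d = d' \<and> lnks ps f d' = d"
proof (induction ps arbitrary: f)
  case Nil then show ?case by simp
next
  case (Cons p ps)
  obtain a b where p: "p = (a, b)" by (cases p)
  have 1: "lnks (p # ps) f = lnks ps (f(a := b, b := a))" by (simp add: lnks_def p)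
  show ?case
  proof (cases "(d, d') = (a, b)")
    case True
    have "a \<notin> set (ends ps)" "b \<notin> set (ends ps)" "a \<noteq> b" using Cons.prems p by (auto simp: ends_def)
    then show ?thesis using True by (simp add: 1 lnks_notin)
  next
    case False
    then have "(d, d') \<in> set ps" using Cons.prems p by auto
    moreover have "distinct (ends ps)" using Cons.prems by (auto simp: ends_def)
    ultimately show ?thesis using Cons.IH 1 by simp
  qed
qed

text \<open>Apart from the listed ends the old links survive, and \<open>rest\<close> says that none
  of them runs into a deleted node or into a relinked dart. The function \<open>g\<close> of the
  second claim has values of any type: it stands for edge labels and, by way of
  \<open>replace\<close>, for heights.\<close>

lemma relink:
  assumes wf: "pd_wf D" and fin: "finite (nodes D')" and dist: "distinct (ends ps)"
    and nb: "nb D' = lnks ps (nb D)" and E: "set (ends ps) \<subseteq> darts D'"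
    and rest: "\<And>d. d \<in> darts D' \<Longrightarrow> d \<notin> set (ends ps) \<Longrightarrow>
       d \<in> darts D \<and> nb D d \<in> darts D' \<and> nb D d \<notin> set (ends ps)"
  shows "pd_wf D'"
    and "(\<And>d d'. (d, d') \<in> set ps \<Longrightarrow> g d = g d') \<Longrightarrow>
     (\<And>d. d \<in> darts D' \<Longrightarrow> d \<notin> set (ends ps) \<Longrightarrow> g (nb D d) = g d) \<Longrightarrow> \<forall>d\<in>darts D'. g (nb D' d) = g d"
proof -
  have in_ps: "\<exists>d'. (d, d') \<in> set ps \<or> (d', d) \<in> set ps" if "d \<in> set (ends ps)" for d
    using that unfolding ends_def set_append set_map by (metis UnE imageE prod.collapse)
  have ne: "d \<noteq> d'" if "(d, d') \<in> set ps" for d d'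
    using dist that by (auto simp: ends_def) (metis disjoint_iff fst_conv imageI snd_conv)
  have i: "nb D' d = d'" "nb D' d' = d" if "(d, d') \<in> set ps" for d d'
    using lnks_in[OF dist that] nb by auto
  have o: "nb D' d = nb D d" if "d \<notin> set (ends ps)" for d using lnks_notin[OF that] nb by simp
  have ep: "d \<in> set (ends ps) \<and> d' \<in> set (ends ps)" if "(d, d') \<in> set ps" for d d'
    using that by (force simp: ends_def)
  have "nb D' d \<in> darts D' \<and> nb D' (nb D' d) = d \<and> nb D' d \<noteq> d" if d: "d \<in> darts D'" for d
  proof (cases "d \<in> set (ends ps)")
    case True
    then obtain d' where "(d, d') \<in> set ps \<or> (d', d) \<in> set ps" using in_ps by blast
    then show ?thesis using i ne ep E by (metis subsetD)
  next
    case False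
    then show ?thesis using rest[OF d False] o wf by (auto simp: pd_wf_def)
  qed
  then show "pd_wf D'" using fin by (simp add: pd_wf_def)
  assume g: "\<And>d d'. (d, d') \<in> set ps \<Longrightarrow> g d = g d'"
    and g2: "\<And>d. d \<in> darts D' \<Longrightarrow> d \<notin> set (ends ps) \<Longrightarrow> g (nb D d) = g d"
  show "\<forall>d\<in>darts D'. g (nb D' d) = g d"
  proof
    fix d assume d: "d \<in> darts D'"
    show "g (nb D' d) = g d"
    proof (cases "d \<in> set (ends ps)")
      case True
      then obtain d' where "(d, d') \<in> set ps \<or> (d', d) \<in> set ps" using in_ps by blast
      then show ?thesis using i g by metis
    next
      case False
      then show ?thesis using g2[OF d False] o by simp
    qed
  qed
qed

lemma vl_bead: "kind D v = Bead \<Longrightarrow> vl D e v = [e (v,0), e (v,Suc 0)]"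
  by (simp add: vl_def pdeg_def numeral_2_eq_2)

lemma vl_cross: "kind D v \<noteq> Bead \<Longrightarrow> vl D e v = [e (v,0), e (v,Suc 0), e (v,2), e (v,3)]"
  by (simp add: vl_def pdeg_def upt_rec numeral_2_eq_2 numeral_3_eq_3)

text \<open>A bead with the letter \<open>a\<close> in both slots is the circle that
  \<open>addO\<close> adjoins to a realization of \<open>N\<close>. As A^2 is t^(-1/2), the loop
  value -A^2 - A^(-2) moves the exponent by 2 in both directions.\<close>

lemma val_circle:
  assumes "wfc (add_mset (bd a a) N)"
  shows "veq (val (add_mset (bd a a) N) j) (\<lambda>x. - val N (j + 2) x - val N (j - 2) x)"
proof -
  have a: "count (lb N) a = 0" using wfc_count[OF assms, of a] by simp
  have cN: "count (lb N) k = 0 \<or> count (lb N) k = 2" for k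
    using wfc_count[OF assms, of k] by (auto split: if_splits)
  then have "wfc N" using assms by (auto simp: wfc_def)
  then obtain D where D: "codes D N" using wfc_realizable by blast
  then obtain e where e: "lab D e" "N = code D e (nodes D)" "flatdiag D" by (auto simp: codes_def)
  have wf: "pd_wf D" using e by (simp add: lab_def)
  then have fin: "finite (nodes D)" by (simp add: pd_wf_def)
  define x where "x = (LEAST x. x \<notin> nodes D)"
  have "\<exists>x. x \<notin> nodes D" using fin ex_new_if_finite[OF infinite_UNIV_nat] by auto
  then have x: "x \<notin> nodes D" unfolding x_def by (rule LeastI_ex)
  let ?D = "addO D" and ?ps = "[((x,0),(x,1))] :: (dart \<times> dart) list"
  define e' where "e' d = (if fst d = x then a else e d)" for d
  have D': "nodes ?D = insert x (nodes D)" "kind ?D = (kind D)(x := Bead)" "nb ?D = lnks ?ps (nb D)"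
    by (simp_all add: addO_def Let_def x_def)
  have darts: "darts ?D = {(x,0),(x,1)} \<union> darts D"
    using x by (auto simp: darts_def D' pdeg_def split: if_splits)
  have nx: "fst d \<noteq> x" if "d \<in> darts D" for d using that x by (auto simp: darts_def)
  have rl: "pd_wf ?D" "\<forall>d\<in>darts ?D. e' (nb ?D d) = e' d"
  proof -
    have 1: "finite (nodes ?D)" "distinct (ends ?ps)" "set (ends ?ps) \<subseteq> darts ?D" 
      using fin by (auto simp: D' ends_def darts)
    have 2: "d \<in> darts D \<and> nb D d \<in> darts ?D \<and> nb D d \<notin> set (ends ?ps)"
      if "d \<in> darts ?D" "d \<notin> set (ends ?ps)" for d
    proof -
      have "d \<in> darts D" using that by (auto simp: darts ends_def)
      then have n: "nb D d \<in> darts D" using wf by (simp add: pd_wf_def)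
      show ?thesis using \<open>d \<in> darts D\<close> n nx[OF n] by (auto simp: darts ends_def)
    qed
    show "pd_wf ?D" using relink(1)[OF wf 1(1,2) D'(3) 1(3) 2] .
    show "\<forall>d\<in>darts ?D. e' (nb ?D d) = e' d"
    proof (rule relink(2)[OF wf 1(1,2) D'(3) 1(3) 2])
      show "e' d = e' d'" if "(d, d') \<in> set ?ps" for d d' using that by (auto simp: e'_def)
      show "e' (nb D d) = e' d" if "d \<in> darts ?D" "d \<notin> set (ends ?ps)" for d
        using 2[OF that] nx[of d] nx[of "nb D d"] wf e by (auto simp: e'_def lab_def pd_wf_def)
    qed
  qed
  have "code ?D e' (nodes D) = N" unfolding e(2) 
    using x by (intro code_cong) (auto simp: fin e'_def D' pdeg_def)
  moreover have "vl ?D e' x = [a, a]" by (simp add: vl_bead D' e'_def)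
  ultimately have cd: "code ?D e' (nodes ?D) = add_mset (bd a a) N" using x fin by (simp add: D'(1))
  have "lab ?D e'" 
  proof (rule labI[OF rl])
    have "\<forall>k. count (lb (add_mset (bd a a) N)) k = 0 \<or> count (lb (add_mset (bd a a) N)) k = 2"
      using assms by (simp add: wfc_def)
    then show "\<forall>k. count (lb (code ?D e' (nodes ?D))) k \<le> 2" by (metis cd le_refl zero_le)
  qed
  moreover have "flatdiag ?D" using e(3) rl by (auto simp: flatdiag_def D')
  ultimately have "codes ?D (add_mset (bd a a) N)" using cd by (auto simp: codes_def)
  then have "veq (val (add_mset (bd a a) N) j) (delta ?D j)" using val_codes veq_sym by blast
  also have "veq (delta ?D j) (\<lambda>x. - delta D (j+2) x - delta D (j-2) x)"
  proof -
    have "(\<lambda>x. delta (addO D) j x + delta D (j + 2) x + delta D (j - 2) x) \<in> relspan"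
      using e(3) by (intro relspan_gen) (auto simp: relgen_def)
    then show ?thesis by (simp add: veq_def algebra_simps)
  qed
  also have "veq (\<lambda>x. - delta D (j+2) x - delta D (j-2) x) (\<lambda>x. - val N (j + 2) x - val N (j - 2) x)"
    using veq_add[OF veq_uminus[OF val_codes[OF D, of "j+2"]] veq_uminus[OF val_codes[OF D, of "j-2"]]] by simp
  finally show ?thesis .
qed

section \<open>Renaming labels and deleting beads\<close>

definition ren :: "(nat \<Rightarrow> nat) \<Rightarrow> nat list set multiset \<Rightarrow> nat list set multiset" where
  "ren f M = image_mset ((`) (map f)) M"

lemma ren_vert [simp]: "map f ` vert l = vert (map f l)"
  by (auto simp: vert_def rotate_map image_iff)

lemma ren_simps [simp]: "ren f {#} = {#}" "ren f (add_mset X M) = add_mset (map f ` X) (ren f M)"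
  "ren f (M + M') = ren f M + ren f M'"
  by (auto simp: ren_def)

lemma ren_code: "ren f (code D e A) = code D (\<lambda>d. f (e d)) A"
  unfolding ren_def code_def by (simp add: multiset.map_comp comp_def) (simp add: vl_def comp_def)

lemma ren_id:
  assumes "\<forall>X\<in>#M. node_shape X" "\<And>k. k \<in># lb M \<Longrightarrow> f k = k"
  shows "ren f M = M"
  using assms
proof (induction M)
  case empty then show ?case by simp
next
  case (add X M)
  have "node_shape X" using add.prems by simp
  then obtain l where l: "X = vert l" unfolding node_shape_def by blast
  have "map f l = l" using add.prems(2) l by (intro map_idI) simp
  then show ?case using add l by simp
qed

lemma labD: "lab D e \<Longrightarrow> d \<in> darts D \<Longrightarrow> d' \<in> darts D \<Longrightarrow> e d = e d' \<Longrightarrow> d' \<noteq> d \<Longrightarrow> d' = nb D d"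
  unfolding lab_def by blast

lemma lab_nb: "lab D e \<Longrightarrow> d \<in> darts D \<Longrightarrow> nb D d \<in> darts D \<and> nb D (nb D d) = d \<and> nb D d \<noteq> d \<and> e (nb D d) = e d"
  unfolding lab_def pd_wf_def by blast

lemma rotate_two: "rotate k [a, b] = [a, b] \<or> rotate k [a, b] = [b, a]"
  by (induction k) auto

text \<open>The bead is deleted from a realization of the left-hand side.\<close>

lemma val_bead:
  assumes M: "wfc (add_mset (bd a b) N)" and "a \<noteq> b"
  shows "veq (val (add_mset (bd a b) N) j) (val (ren (id(b := a)) N) j)"
proof -
  obtain D where D: "codes D (add_mset (bd a b) N)" using wfc_realizable M by blast
  then obtain e where e: "lab D e" "code D e (nodes D) = add_mset (bd a b) N" and fD: "flatdiag D"
    by (auto simp: codes_def)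
  have wf: "pd_wf D" using e by (simp add: lab_def)
  then have fin: "finite (nodes D)" by (simp add: pd_wf_def)
  obtain v where v: "v \<in> nodes D" "vert (vl D e v) = bd a b" and N: "code D e (nodes D - {v}) = N"
    using code_extract[OF fin e(2)] by blast
  obtain k where "vl D e v = rotate k [a, b]" using vert_eqD[of "[a, b]"] v by metis
  then have "vl D e v = [a, b] \<or> vl D e v = [b, a]" "length (vl D e v) = 2"
    using rotate_two[of k a b] by auto
  have kv: "kind D v = Bead"
    using \<open>length (vl D e v) = 2\<close> by (auto simp: pdeg_def split: if_splits)
  have ab: "{e (v, 0), e (v, 1)} = {a, b}" "e (v, 0) \<noteq> e (v, 1)"
    using \<open>vl D e v = [a, b] \<or> vl D e v = [b, a]\<close> assms(2) by (auto simp: vl_bead[OF kv])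
  let ?f = "id(b := a)"
  define p where "p = nb D (v, 0)"
  define q where "q = nb D (v, 1)"
  have vd: "(v, 0) \<in> darts D" "(v, 1) \<in> darts D" using v kv by (auto simp: darts_def pdeg_def)
  have p: "p \<in> darts D" "nb D p = (v, 0)" "e p = e (v, 0)" using lab_nb[OF e(1) vd(1)] p_def by auto
  have q: "q \<in> darts D" "nb D q = (v, 1)" "e q = e (v, 1)" using lab_nb[OF e(1) vd(2)] q_def by auto
  have vs: "d = (v, 0) \<or> d = (v, 1)" if "d \<in> darts D" "fst d = v" for d
    using that kv by (cases d) (auto simp: darts_def pdeg_def)
  have pv: "fst p \<noteq> v" "fst q \<noteq> v" using vs[OF p(1)] vs[OF q(1)] p q ab lab_nb[OF e(1) vd(1)] lab_nb[OF e(1) vd(2)]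
    by metis+
  have pq: "p \<noteq> q" using p q ab by metis
  define D0 where "D0 = \<lparr>nodes = nodes D - {v}, kind = kind D, nb = lnks [(p, q)] (nb D)\<rparr>"
  have D0: "nodes D0 = nodes D - {v}" "kind D0 = kind D" "nb D0 = lnks [(p, q)] (nb D)" by (simp_all add: D0_def)
  have d0: "darts D0 = {d \<in> darts D. fst d \<noteq> v}" by (auto simp: darts_def D0 pdeg_def)
  have nbq: "nb D d = p \<longleftrightarrow> d = (v, 0)" "nb D d = q \<longleftrightarrow> d = (v, 1)" if "d \<in> darts D" for d
    using lab_nb[OF e(1) that] lab_nb[OF e(1) vd(1)] lab_nb[OF e(1) vd(2)] p_def q_def by metis+
  have 2: "d \<in> darts D \<and> nb D d \<in> darts D0 \<and> nb D d \<notin> set (ends [(p, q)])"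
    if "d \<in> darts D0" "d \<notin> set (ends [(p, q)])" for d
  proof -
    have d: "d \<in> darts D" "fst d \<noteq> v" "d \<noteq> p" "d \<noteq> q" using that by (auto simp: d0 ends_def)
    have n: "nb D d \<in> darts D" "nb D (nb D d) = d" using lab_nb[OF e(1) d(1)] by auto
    have "fst (nb D d) \<noteq> v" using vs[OF n(1)] n d p_def q_def by metis
    moreover have "nb D d \<noteq> p" "nb D d \<noteq> q" using nbq[OF d(1)] d(2) by auto
    ultimately show ?thesis using d n by (simp add: d0 ends_def)
  qed
  have wf0: "pd_wf D0" and ec0: "\<forall>d\<in>darts D0. ?f (e (nb D0 d)) = ?f (e d)"
  proof -
    have 1: "finite (nodes D0)" "distinct (ends [(p, q)])" "set (ends [(p, q)]) \<subseteq> darts D0"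
      using fin pq pv p q by (auto simp: D0 d0 ends_def)
    show "pd_wf D0" using relink(1)[OF wf 1(1,2) D0(3) 1(3) 2] .
    show "\<forall>d\<in>darts D0. ?f (e (nb D0 d)) = ?f (e d)"
    proof (rule relink(2)[OF wf 1(1,2) D0(3) 1(3) 2])
      show "?f (e d) = ?f (e d')" if "(d, d') \<in> set [(p, q)]" for d d'
        using that p q ab by (auto simp: doubleton_eq_iff)
      show "?f (e (nb D d)) = ?f (e d)" if "d \<in> darts D0" "d \<notin> set (ends [(p, q)])" for d
        using 2[OF that] e(1) by (simp add: lab_def)
    qed
  qed
  have cd: "code D0 (\<lambda>d. ?f (e d)) (nodes D0) = ren ?f N"
  proof -
    have "code D0 (\<lambda>d. ?f (e d)) (nodes D0) = code D (\<lambda>d. ?f (e d)) (nodes D - {v})"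
      unfolding D0(1) by (rule code_cong) (use fin in \<open>auto simp: D0 pdeg_def\<close>)
    then show ?thesis by (simp add: ren_code flip: N)
  qed
  have "lab D0 (\<lambda>d. ?f (e d))"
    unfolding lab_def
  proof (intro conjI ballI impI)
    show "pd_wf D0" by (rule wf0)
    show "?f (e (nb D0 d)) = ?f (e d)" if "d \<in> darts D0" for d using ec0 that by blast
    fix d d' assume d: "d \<in> darts D0" "d' \<in> darts D0" "?f (e d) = ?f (e d')"
    have dD: "d \<in> darts D" "d' \<in> darts D" "fst d \<noteq> v" "fst d' \<noteq> v" using d by (auto simp: d0)
    have pp: "d = p \<or> d = q" if "e d = a \<or> e d = b" "d \<in> darts D" "fst d \<noteq> v" for d
    proof -
      have "e d = e (v, 0) \<or> e d = e (v, 1)" using that ab(1) by blast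
      moreover have "d \<noteq> (v, 0)" "d \<noteq> (v, 1)" using that(3) by auto
      ultimately show ?thesis using labD[OF e(1) vd(1) that(2)] labD[OF e(1) vd(2) that(2)]
        unfolding p_def q_def by metis
    qed
    have nbp: "nb D0 p = q" "nb D0 q = p" using pq by (auto simp: D0 lnks_def)
    show "d' = d \<or> d' = nb D0 d"
    proof (cases "e d = a \<or> e d = b")
      case True
      then have "e d' = a \<or> e d' = b" using d(3) by (auto split: if_splits)
      then have "d' = p \<or> d' = q" using pp[OF _ dD(2,4)] by simp
      moreover have "d = p \<or> d = q" using pp[OF True dD(1,3)] .
      ultimately show ?thesis using nbp by auto
    next
      case False
      then have "e d' \<noteq> b \<and> e d = e d'" using d(3) assms(2) by (auto split: if_splits)
      then have "e d = e d'" by simp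
      moreover have "d \<noteq> p" "d \<noteq> q" using False p q ab(1) by (metis insertCI insertE singletonD)+
      ultimately show ?thesis using labD[OF e(1) dD(1,2)] by (auto simp: D0 lnks_def)
    qed
  qed
  moreover have fD0: "flatdiag D0" using fD wf0 by (auto simp: flatdiag_def D0)
  ultimately have c0: "codes D0 (ren ?f N)" unfolding codes_def cd[symmetric] by blast
  \<comment> \<open>\<open>bead_ins\<close> only inserts, so the deletion is justified by putting
    \<open>v\<close> back on the merged edge.\<close>
  define D1 where "D1 = \<lparr>nodes = insert v (nodes D0), kind = (kind D0)(v := Bead),
     nb = lnks [(p,(v,0)), ((v,1), nb D0 p)] (nb D0)\<rparr>"
  have bi: "bead_ins D0 D1"
    unfolding bead_ins_def D1_def using p pv by (intro exI[of _ p] exI[of _ v]) (auto simp: d0 D0(1))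
  have nbD1: "nb D1 d = nb D d" if "d \<in> darts D" for d
  proof -
    have "nb D0 p = q" using pq by (auto simp: D0 lnks_def)
    then have "nb D1 = lnks [(p,(v,0)), ((v,1), q)] (lnks [(p,q)] (nb D))" by (simp add: D1_def D0)
    then show ?thesis using p q pq pv p_def q_def by (auto simp: lnks_def)
  qed
  have D1: "nodes D1 = nodes D" "kind D1 = kind D" using v kv by (auto simp: D1_def D0)
  have dD1: "darts D1 = darts D" by (simp add: darts_def D1 pdeg_def)
  have wf1: "pd_wf D1" using wf nbD1 by (auto simp: pd_wf_def dD1 D1)
  have fD1: "flatdiag D1" using fD wf1 by (simp add: flatdiag_def D1)
  \<comment> \<open>Links are compared on darts only, and agreement there makes the identity with
    zero rotation an isomorphism.\<close>
  have "iso_by id (\<lambda>_. 0) D1 D"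
  proof -
    have "imap id (\<lambda>_. 0) D1 d = d" if "d \<in> darts D" for d
      using that by (cases d) (auto simp: imap_def darts_def pdeg_def D1)
    moreover have "0 < pdeg D1 v" for v by (simp add: pdeg_def)
    ultimately show ?thesis using wf nbD1 by (auto simp: iso_by_def D1 dD1 pd_wf_def)
  qed
  then have "flat_equiv D1 D" using fD fD1 by (intro flat_equiv_step) (auto simp: flat_step_def)
  moreover have "flat_equiv D0 D1" using bi fD0 fD1 by (intro flat_equiv_step) (auto simp: flat_step_def rmove_def)
  ultimately have "flat_equiv D D0" using flat_equiv_trans flat_equiv_sym by blast
  then show ?thesis using val_move D c0 by blast
qed

text \<open>The letter \<open>b\<close> is used up by the two beads, so merging it into
  \<open>a\<close> leaves \<open>N\<close> alone; the second bead survives and now joins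
  \<open>a\<close> to \<open>c\<close>.\<close>

lemma val_chain:
  assumes "wfc (add_mset (bd a b) (add_mset (bd b c) N))"
  shows "veq (val (add_mset (bd a b) (add_mset (bd b c) N)) j) (val (add_mset (bd a c) N) j)"
proof -
  have b: "count (lb N) b = 0" "a \<noteq> b" "c \<noteq> b" using wfc_count[OF assms, of b] by (auto split: if_splits)
  have "ren (id(b := a)) N = N"
  proof (rule ren_id)
    show "\<forall>X\<in>#N. node_shape X" using assms by (simp add: wfc_def)
    show "(id(b := a)) k = k" if "k \<in># lb N" for k using b(1) that by (auto simp: count_eq_zero_iff)
  qed
  then show ?thesis using val_bead[OF assms b(2), of j] b by simp
qed

lemma val_absorb:
  assumes "wfc (add_mset (bd a b) (add_mset (fl b c d e) N))"
  shows "veq (val (add_mset (bd a b) (add_mset (fl b c d e) N)) j) (val (add_mset (fl a c d e) N) j)"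
proof -
  have b: "count (lb N) b = 0" "a \<noteq> b" "c \<noteq> b" "d \<noteq> b" "e \<noteq> b" using wfc_count[OF assms, of b] by (auto split: if_splits)
  have "ren (id(b := a)) N = N"
  proof (rule ren_id)
    show "\<forall>X\<in>#N. node_shape X" using assms by (simp add: wfc_def)
    show "(id(b := a)) k = k" if "k \<in># lb N" for k using b(1) that by (auto simp: count_eq_zero_iff)
  qed
  then show ?thesis using val_bead[OF assms b(2), of j] b by simp
qed

section \<open>Reidemeister moves on diagrams and their codes\<close>

definition row :: "(dart \<Rightarrow> 'a) \<Rightarrow> nat \<Rightarrow> nat \<Rightarrow> 'a list" where
  "row g v a = [g (v, a), g (v, (a + 1) mod 4), g (v, (a + 2) mod 4), g (v, (a + 3) mod 4)]"

lemma less4: "(i::nat) < 4 \<longleftrightarrow> i = 0 \<or> i = 1 \<or> i = 2 \<or> i = 3" by auto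

lemma row_simps:
  "row g v 0 = [g (v,0), g (v,Suc 0), g (v,2), g (v,3)]" "row g v (Suc 0) = [g (v,Suc 0), g (v,2), g (v,3), g (v,0)]"
  "row g v 2 = [g (v,2), g (v,3), g (v,0), g (v,Suc 0)]" "row g v 3 = [g (v,3), g (v,0), g (v,Suc 0), g (v,2)]"
proof -
  have "((1::nat) + 1) mod 4 = 2" "((1::nat) + 2) mod 4 = 3" "((1::nat) + 3) mod 4 = 0" "(2 + (1::nat)) mod 4 = 3"
    "(2 + (2::nat)) mod 4 = 0" "(2 + (3::nat)) mod 4 = 1" "(3 + (1::nat)) mod 4 = 0" "(3 + (2::nat)) mod 4 = 1"
    "(3 + (3::nat)) mod 4 = 2" "(0 + (1::nat)) mod 4 = 1" "(0 + (2::nat)) mod 4 = 2" "(0 + (3::nat)) mod 4 = 3"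
    by (simp_all del: One_nat_def)
  note n = this
  show "row g v 0 = [g (v,0), g (v,Suc 0), g (v,2), g (v,3)]" "row g v (Suc 0) = [g (v,Suc 0), g (v,2), g (v,3), g (v,0)]"
    "row g v 2 = [g (v,2), g (v,3), g (v,0), g (v,Suc 0)]" "row g v 3 = [g (v,3), g (v,0), g (v,Suc 0), g (v,2)]"
    unfolding row_def One_nat_def[symmetric] n by (rule refl)+
qed

lemma vert_row:
  assumes "kind D v \<noteq> Bead" "a < 4"
  shows "vert (vl D e v) = vert (row e v a)"
proof -
  have "a = 0 \<or> a = Suc 0 \<or> a = 2 \<or> a = 3" using assms(2) by auto
  moreover have "vert (row e v 0) = vert (row e v (Suc 0))" "vert (row e v (Suc 0)) = vert (row e v 2)"
    "vert (row e v 2) = vert (row e v 3)"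
    unfolding row_simps by (rule fl_rotate)+
  moreover have "vl D e v = row e v 0" by (simp add: row_simps vl_cross[OF assms(1)])
  ultimately show ?thesis by metis
qed

lemma rotate_row: "\<exists>a<4. rotate k (row g v 0) = row g v a"
proof (induction k)
  case 0 then show ?case by (intro exI[of _ 0]) simp
next
  case (Suc k)
  then obtain a where a: "a < 4" and r: "rotate k (row g v 0) = row g v a" by blast
  have "a = 0 \<or> a = Suc 0 \<or> a = 2 \<or> a = 3" using a by auto
  moreover have "rotate1 (row g v 0) = row g v (Suc 0)" "rotate1 (row g v (Suc 0)) = row g v 2"
    "rotate1 (row g v 2) = row g v 3" "rotate1 (row g v 3) = row g v 0"
    by (simp_all add: row_simps)
  ultimately have "rotate1 (row g v a) \<in> {row g v 0, row g v (Suc 0), row g v 2, row g v 3}" by (elim disjE) auto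
  then show ?case unfolding rotate_Suc r
    by (elim insertE emptyE) (rule exI[of _ 0] exI[of _ "Suc 0"] exI[of _ 2] exI[of _ 3], simp; fail)+
qed

lemma vert_rowE:
  assumes "vert (vl D e v) = fl p q r s"
  obtains a where "a < 4" "row e v a = [p, q, r, s]" "kind D v \<noteq> Bead"
proof -
  obtain k where k: "[p, q, r, s] = rotate k (vl D e v)" using vert_eqD[OF assms] by blast
  have len: "pdeg D v = 4"
  proof -
    have "length [p, q, r, s] = pdeg D v" by (simp only: k length_rotate length_vl)
    then show ?thesis by simp
  qed
  then have kv: "kind D v \<noteq> Bead" by (auto simp: pdeg_def)
  have "vl D e v = row e v 0" by (simp add: row_simps vl_cross[OF kv])
  then show ?thesis using rotate_row[of k e v] k kv that by metis
qed

text \<open>Inverse to \<open>row\<close>: what slot \<open>s\<close> receives when \<open>l\<close>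
  is laid down from slot \<open>a\<close> on. The summand 4 keeps the subtraction of natural numbers
  from being cut off at 0.\<close>

definition put :: "nat \<Rightarrow> 'a list \<Rightarrow> nat \<Rightarrow> 'a" where
  "put a l s = l ! ((s + 4 - a) mod 4)"

lemma put_simps [simp]:
  assumes "a < 4"
  shows "put a [p, q, r, t] a = p" "put a [p, q, r, t] ((a + 1) mod 4) = q" "put a [p, q, r, t] (Suc a mod 4) = q"
    "put a [p, q, r, t] ((a + 2) mod 4) = r" "put a [p, q, r, t] ((a + 3) mod 4) = t"
  using assms by (auto simp: put_def less4)

lemma slot_cases: "s < 4 \<Longrightarrow> a < 4 \<Longrightarrow> s = a \<or> s = (a + 1) mod 4 \<or> s = (a + 2) mod 4 \<or> s = (a + 3) mod (4::nat)"
  by (auto simp: less4)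

lemma slot_neq:
  assumes "a < 4"
  shows "a \<noteq> (a + 1) mod 4" "a \<noteq> (a + 2) mod 4" "a \<noteq> (a + 3) mod 4" "(a + 1) mod 4 \<noteq> (a + 2) mod 4"
    "(a + 1) mod 4 \<noteq> (a + 3) mod 4" "(a + 2) mod 4 \<noteq> (a + 3) mod (4::nat)"
  using assms by (auto simp: less4)

text \<open>The common frame of the three moves: nodes \<open>R\<close> give way to nodes
  \<open>S\<close>. By \<open>E\<close> the listed ends are precisely the darts of the new nodes and
  the surviving darts that lost their partner, so nothing dangles and all other edges are untouched.
  \<open>replace_const\<close> carries a function that is constant along edges across the
  move.\<close>

lemma replace:
  assumes wf: "pd_wf D" and nodes: "nodes D' = S \<union> (nodes D - R)" and S: "finite S" "S \<inter> nodes D = {}"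
    and kinds: "\<And>v. v \<in> nodes D - R \<Longrightarrow> kind D' v = kind D v"
    and dist: "distinct (ends ps)" and nb: "nb D' = lnks ps (nb D)"
    and E: "set (ends ps) = {d \<in> darts D'. fst d \<in> S} \<union> {d \<in> darts D. fst d \<notin> R \<and> fst (nb D d) \<in> R}"
  shows replace_wf: "pd_wf D'"
    and replace_links: "\<And>d d'. (d, d') \<in> set ps \<Longrightarrow> nb D' d = d' \<and> nb D' d' = d"
    and replace_const: "\<And>g g0. \<forall>d\<in>darts D. g0 (nb D d) = g0 d \<Longrightarrow> (\<And>d. d \<in> darts D \<Longrightarrow> fst d \<notin> R \<Longrightarrow> g d = g0 d) \<Longrightarrow>
       (\<And>d d'. (d, d') \<in> set ps \<Longrightarrow> g d = g d') \<Longrightarrow> \<forall>d\<in>darts D'. g (nb D' d) = g d"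
proof -
  have fin: "finite (nodes D')" using wf S by (simp add: nodes pd_wf_def)
  have dV: "d \<in> darts D' \<longleftrightarrow> d \<in> darts D" if "fst d \<in> nodes D" "fst d \<notin> R" for d
    using that S kinds[of "fst d"] by (auto simp: darts_def nodes pdeg_def)
  have dD: "fst d \<in> nodes D" if "d \<in> darts D" for d using that by (auto simp: darts_def)
  have nbD: "nb D d \<in> darts D" "nb D (nb D d) = d" if "d \<in> darts D" for d using wf that by (auto simp: pd_wf_def)
  have sub: "set (ends ps) \<subseteq> darts D'"
    unfolding E using dV dD by auto
  have rest: "d \<in> darts D \<and> nb D d \<in> darts D' \<and> nb D d \<notin> set (ends ps)" "fst d \<notin> R" "fst (nb D d) \<notin> R"
    if d: "d \<in> darts D'" "d \<notin> set (ends ps)" for d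
  proof -
    have "fst d \<notin> S" using d E by auto
    then have 1: "fst d \<in> nodes D" "fst d \<notin> R" using d(1) by (auto simp: darts_def nodes)
    then have 2: "d \<in> darts D" using dV d by simp
    then have 3: "fst (nb D d) \<notin> R" using d 1 E by auto
    have 4: "nb D d \<in> darts D'" using dV[of "nb D d"] dD nbD(1)[OF 2] 3 by simp
    have "fst (nb D d) \<notin> S" using S(2) dD[OF nbD(1)[OF 2]] by auto
    then have 5: "nb D d \<notin> set (ends ps)" using nbD[OF 2] 1 E by auto
    show "d \<in> darts D \<and> nb D d \<in> darts D' \<and> nb D d \<notin> set (ends ps)" "fst d \<notin> R" "fst (nb D d) \<notin> R"
      using 1 2 3 4 5 by auto
  qed
  show "pd_wf D'" by (rule relink(1)[OF wf fin dist nb sub rest(1)])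
  show "nb D' d = d' \<and> nb D' d' = d" if "(d, d') \<in> set ps" for d d' using lnks_in[OF dist that] nb by simp
  fix g g0 :: "dart \<Rightarrow> 'a"
  assume g: "\<forall>d\<in>darts D. g0 (nb D d) = g0 d" "\<And>d. d \<in> darts D \<Longrightarrow> fst d \<notin> R \<Longrightarrow> g d = g0 d"
    "\<And>d d'. (d, d') \<in> set ps \<Longrightarrow> g d = g d'"
  show "\<forall>d\<in>darts D'. g (nb D' d) = g d"
  proof (rule relink(2)[OF wf fin dist nb sub rest(1)])
    show "g d = g d'" if "(d, d') \<in> set ps" for d d' using g(3) that .
    show "g (nb D d) = g d" if "d \<in> darts D'" "d \<notin> set (ends ps)" for d
      using rest[OF that] g nbD by metis
  qed
qed

text \<open>This definition and the next two are the bodies of \<open>r1\<close>, \<open>r2\<close>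
  and \<open>r3\<close> with the quantified data as parameters, so that later statements can name
  the nodes, slots and outer darts of a move.\<close>

definition kink_move :: "nkind \<Rightarrow> pd \<Rightarrow> pd \<Rightarrow> nat \<Rightarrow> nat \<Rightarrow> nat \<Rightarrow> dart \<Rightarrow> dart \<Rightarrow> bool" where
  "kink_move k D D' b x i p q \<longleftrightarrow> b \<in> nodes D \<and> kind D b = Bead \<and> x \<notin> nodes D \<and> i < 4 \<and>
     ((p = nb D (b,0) \<and> q = nb D (b,1)) \<or> (p = nb D (b,1) \<and> q = nb D (b,0))) \<and>
     fst p \<noteq> b \<and> fst q \<noteq> b \<and>
     D' = \<lparr>nodes = insert x (nodes D - {b}), kind = (kind D)(x := k),
           nb = lnks [((x,i),(x,(i+1) mod 4)), ((x,(i+2) mod 4), p), ((x,(i+3) mod 4), q)] (nb D)\<rparr>"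

definition bigon_move :: "nkind \<Rightarrow> pd \<Rightarrow> pd \<Rightarrow> nat \<Rightarrow> nat \<Rightarrow> nat \<Rightarrow> nat \<Rightarrow> nat \<Rightarrow> nat \<Rightarrow> dart \<Rightarrow> dart \<Rightarrow> dart \<Rightarrow> dart \<Rightarrow> bool" where
  "bigon_move k D D' b c x y i j p1 q1 p2 q2 \<longleftrightarrow>
     b \<in> nodes D \<and> c \<in> nodes D \<and> b \<noteq> c \<and> kind D b = Bead \<and> kind D c = Bead \<and>
     x \<notin> nodes D \<and> y \<notin> nodes D \<and> x \<noteq> y \<and> i < 4 \<and> j < 4 \<and>
     (k = Real \<longrightarrow> i mod 2 = (j+1) mod 2) \<and>
     ((p1 = nb D (b,0) \<and> q1 = nb D (b,1)) \<or> (p1 = nb D (b,1) \<and> q1 = nb D (b,0))) \<and>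
     ((p2 = nb D (c,0) \<and> q2 = nb D (c,1)) \<or> (p2 = nb D (c,1) \<and> q2 = nb D (c,0))) \<and>
     fst p1 \<notin> {b,c} \<and> fst q1 \<notin> {b,c} \<and> fst p2 \<notin> {b,c} \<and> fst q2 \<notin> {b,c} \<and>
     D' = \<lparr>nodes = insert x (insert y (nodes D - {b,c})), kind = (kind D)(x := k, y := k),
           nb = lnks [((x,i),(y,(j+1) mod 4)), ((x,(i+1) mod 4),(y,j)),
                      ((x,(i+2) mod 4), p1), ((y,(j+3) mod 4), q1),
                      ((x,(i+3) mod 4), p2), ((y,(j+2) mod 4), q2)] (nb D)\<rparr>"

definition tri_move :: "nkind \<Rightarrow> pd \<Rightarrow> pd \<Rightarrow> nat \<Rightarrow> nat \<Rightarrow> nat \<Rightarrow> nat \<Rightarrow> nat \<Rightarrow> nat \<Rightarrow> nat \<Rightarrow> nat \<Rightarrow> nat \<Rightarrow> bool" where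
  "tri_move k D D' x y z a b c x' y' z' \<longleftrightarrow>
     x \<in> nodes D \<and> y \<in> nodes D \<and> z \<in> nodes D \<and> distinct [x,y,z] \<and>
     kind D x = k \<and> kind D y = k \<and> kind D z = k \<and> a < 4 \<and> b < 4 \<and> c < 4 \<and>
     nb D (x,(a+1) mod 4) = (y,b) \<and> nb D (y,(b+1) mod 4) = (z,c) \<and> nb D (z,(c+1) mod 4) = (x,a) \<and>
     (k = Real \<longrightarrow> ((odd (a+1) \<and> odd b) \<or> (odd (b+1) \<and> odd c) \<or> (odd (c+1) \<and> odd a))) \<and>
     distinct [x',y',z'] \<and> x' \<notin> nodes D \<and> y' \<notin> nodes D \<and> z' \<notin> nodes D \<and>
     fst ` {nb D (z,(c+3) mod 4), nb D (y,(b+2) mod 4), nb D (y,(b+3) mod 4),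
            nb D (x,(a+2) mod 4), nb D (x,(a+3) mod 4), nb D (z,(c+2) mod 4)} \<inter> {x,y,z} = {} \<and>
     D' = \<lparr>nodes = {x',y',z'} \<union> (nodes D - {x,y,z}), kind = (kind D)(x' := k, y' := k, z' := k),
           nb = lnks [((x',a), nb D (z,(c+3) mod 4)), ((x',(a+1) mod 4), nb D (y,(b+2) mod 4)),
             ((x',(a+2) mod 4), (z',(c+3) mod 4)), ((x',(a+3) mod 4), (y',(b+2) mod 4)),
             ((z',c), nb D (y,(b+3) mod 4)), ((z',(c+1) mod 4), nb D (x,(a+2) mod 4)),
             ((z',(c+2) mod 4), (y',(b+3) mod 4)), ((y',b), nb D (x,(a+3) mod 4)),
             ((y',(b+1) mod 4), nb D (z,(c+2) mod 4))] (nb D)\<rparr>"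

lemma r1_iff: "r1 k D D' \<longleftrightarrow> (\<exists>b x i p q. kink_move k D D' b x i p q)"
  unfolding r1_def kink_move_def by (rule refl)

lemma r2_iff: "r2 k D D' \<longleftrightarrow> (\<exists>b c x y i j p1 q1 p2 q2. bigon_move k D D' b c x y i j p1 q1 p2 q2)"
  unfolding r2_def bigon_move_def by (rule refl)

text \<open>The indices \<open>AB\<close>, \<open>AC\<close>, \<open>BC\<close> of \<open>r3\<close>
  are reduced modulo 4 to offsets from \<open>a\<close>, \<open>c\<close>, \<open>b\<close>: the
  crossings \<open>x'\<close>, \<open>z'\<close>, \<open>y'\<close> reuse the slot numbers of
  \<open>x\<close>, \<open>z\<close>, \<open>y\<close>.\<close>

lemma r3_iff: "r3 k D D' \<longleftrightarrow> (\<exists>x y z a b c x' y' z'. tri_move k D D' x y z a b c x' y' z')"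
proof -
  have s: "(0 + a) mod 4 = a" "(1 + a) mod 4 = (a + 1) mod 4" "(2 + a) mod 4 = (a + 2) mod 4" "(3 + a) mod 4 = (a + 3) mod 4"
    "(0 + a + 3) mod 4 = (a + 3) mod 4" "(1 + a + 3) mod 4 = a" "(2 + a + 3) mod 4 = (a + 1) mod 4" "(3 + a + 3) mod 4 = (a + 2) mod 4"
    "(0 + a + 2) mod 4 = (a + 2) mod 4" "(1 + a + 2) mod 4 = (a + 3) mod 4" "(2 + a + 2) mod 4 = a" "(3 + a + 2) mod 4 = (a + 1) mod 4"
    if "a < 4" for a :: nat
    using that by (auto simp: less4)
  show ?thesis
    unfolding r3_def tri_move_def Let_def
    by (intro arg_cong[of _ _ Ex] ext) (smt (verit, ccfv_SIG) s)
qed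

lemma count_add_of_bool: "count (add_mset x M) l = of_bool (x = l) + count M l" by simp

lemma count_lb_fresh:
  assumes "lab D e" "w \<notin> e ` darts D"
  shows "count (lb (code D e (nodes D))) w = 0"
proof -
  have fin: "finite (nodes D)" using assms(1) by (simp add: lab_def pd_wf_def)
  have "{d \<in> darts D. e d = w} = {}" using assms(2) by auto
  then show ?thesis by (simp only: count_lb_code[OF fin] darts_eq) simp
qed

lemma slot_set: "a < 4 \<Longrightarrow> {..<4} = {a, (a + 1) mod 4, (a + 2) mod 4, (a + 3) mod (4::nat)}"
  using slot_cases[of _ a] by auto

lemma dart_cross: "kind D v \<noteq> Bead \<Longrightarrow> (v, s) \<in> darts D \<longleftrightarrow> v \<in> nodes D \<and> s < 4"
  by (simp add: darts_def pdeg_def)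

lemma dart_bead: "kind D v = Bead \<Longrightarrow> (v, s) \<in> darts D \<longleftrightarrow> v \<in> nodes D \<and> (s = 0 \<or> s = 1)"
  by (auto simp: darts_def pdeg_def)

lemma wf_nb: "pd_wf D \<Longrightarrow> d \<in> darts D \<Longrightarrow> nb D d \<in> darts D \<and> nb D (nb D d) = d \<and> nb D d \<noteq> d"
  unfolding pd_wf_def by blast

lemma in_darts_node: "d \<in> darts D \<Longrightarrow> fst d \<in> nodes D" by (auto simp: darts_def)

section \<open>The second move: links and labels of the new bigon\<close>

context
  fixes k D D' b c x y i j p1 q1 p2 q2
  assumes mv: "bigon_move k D D' b c x y i j p1 q1 p2 q2" and wf: "pd_wf D" and k: "k \<noteq> Bead"
begin

lemma bigon_basic:
  "b \<in> nodes D" "c \<in> nodes D" "b \<noteq> c" "kind D b = Bead" "kind D c = Bead"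
  "x \<notin> nodes D" "y \<notin> nodes D" "x \<noteq> y" "i < 4" "j < 4"
  "(p1 = nb D (b,0) \<and> q1 = nb D (b,1)) \<or> (p1 = nb D (b,1) \<and> q1 = nb D (b,0))"
  "(p2 = nb D (c,0) \<and> q2 = nb D (c,1)) \<or> (p2 = nb D (c,1) \<and> q2 = nb D (c,0))"
  "fst p1 \<notin> {b,c}" "fst q1 \<notin> {b,c}" "fst p2 \<notin> {b,c}" "fst q2 \<notin> {b,c}"
  "nodes D' = {x, y} \<union> (nodes D - {b,c})" "kind D' = (kind D)(x := k, y := k)"
  "nb D' = lnks [((x,i),(y,(j+1) mod 4)), ((x,(i+1) mod 4),(y,j)),
                      ((x,(i+2) mod 4), p1), ((y,(j+3) mod 4), q1),
                      ((x,(i+3) mod 4), p2), ((y,(j+2) mod 4), q2)] (nb D)"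
  using mv unfolding bigon_move_def by (auto simp del: One_nat_def)

lemma bigon_darts:
  "p1 \<in> darts D" "q1 \<in> darts D" "p2 \<in> darts D" "q2 \<in> darts D" "distinct [p1, q1, p2, q2]"
  "{nb D p1, nb D q1} = {(b,0),(b,1)}" "{nb D p2, nb D q2} = {(c,0),(c,1)}"
proof -
  note B = bigon_basic
  have d: "(b,0) \<in> darts D" "(b,1) \<in> darts D" "(c,0) \<in> darts D" "(c,1) \<in> darts D"
    using B by (auto simp: dart_bead)
  note n = wf_nb[OF wf d(1)] wf_nb[OF wf d(2)] wf_nb[OF wf d(3)] wf_nb[OF wf d(4)]
  show "p1 \<in> darts D" "q1 \<in> darts D" "p2 \<in> darts D" "q2 \<in> darts D"
    "{nb D p1, nb D q1} = {(b,0),(b,1)}" "{nb D p2, nb D q2} = {(c,0),(c,1)}"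
    using B(11,12) n by auto
  have "distinct [nb D (b,0), nb D (b,1), nb D (c,0), nb D (c,1)]"
    using n B(3) by (metis Pair_inject distinct_length_2_or_more distinct_singleton zero_neq_one)
  then show "distinct [p1, q1, p2, q2]" using B(11,12) by auto
qed

lemma bigon_replace:
  shows bigon_wf: "pd_wf D'"
    and bigon_links: "nb D' (x,i) = (y,(j+1) mod 4)" "nb D' (x,(i+1) mod 4) = (y,j)"
      "nb D' (x,(i+2) mod 4) = p1" "nb D' (y,(j+3) mod 4) = q1" "nb D' (x,(i+3) mod 4) = p2" "nb D' (y,(j+2) mod 4) = q2"
    and bigon_const: "\<And>g g0. \<forall>d\<in>darts D. g0 (nb D d) = g0 d \<Longrightarrow> (\<And>d. d \<in> darts D \<Longrightarrow> fst d \<notin> {b, c} \<Longrightarrow> g d = g0 d) \<Longrightarrow>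
      g (x,i) = g (y,(j+1) mod 4) \<Longrightarrow> g (x,(i+1) mod 4) = g (y,j) \<Longrightarrow> g (x,(i+2) mod 4) = g0 p1 \<Longrightarrow>
      g (y,(j+3) mod 4) = g0 q1 \<Longrightarrow> g (x,(i+3) mod 4) = g0 p2 \<Longrightarrow> g (y,(j+2) mod 4) = g0 q2 \<Longrightarrow> \<forall>d\<in>darts D'. g (nb D' d) = g d"
proof -
  note B = bigon_basic and P = bigon_darts
  define ps where "ps = [((x,i),(y,(j+1) mod 4)), ((x,(i+1) mod 4),(y,j)),
                      ((x,(i+2) mod 4), p1), ((y,(j+3) mod 4), q1),
                      ((x,(i+3) mod 4), p2), ((y,(j+2) mod 4), q2)]"
  have pn: "fst p1 \<in> nodes D" "fst q1 \<in> nodes D" "fst p2 \<in> nodes D" "fst q2 \<in> nodes D"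
    using P in_darts_node by auto
  have ne: "p \<noteq> (x, s)" "p \<noteq> (y, s)" if "fst p \<in> nodes D" for p s using that B by auto
  have dist: "distinct (ends ps)"
    using slot_neq[OF B(9)] slot_neq[OF B(10)] B(8) P(5) ne[OF pn(1)] ne[OF pn(2)] ne[OF pn(3)] ne[OF pn(4)]
    unfolding ps_def ends_def by (simp del: One_nat_def) metis
  have xs: "{d \<in> darts D'. fst d \<in> {x, y}} = {(x,i),(x,(i+1) mod 4),(x,(i+2) mod 4),(x,(i+3) mod 4),(y,j),(y,(j+1) mod 4),(y,(j+2) mod 4),(y,(j+3) mod 4)}"
  proof -
    have "kind D' x \<noteq> Bead" "kind D' y \<noteq> Bead" using k by (simp_all add: B(18))
    then have "{d \<in> darts D'. fst d \<in> {x, y}} = Pair x ` {..<4} \<union> Pair y ` {..<4}"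
      by (auto simp: dart_cross B(17))
    also have "\<dots> = Pair x ` {i, (i + 1) mod 4, (i + 2) mod 4, (i + 3) mod 4} \<union> Pair y ` {j, (j + 1) mod 4, (j + 2) mod 4, (j + 3) mod 4}"
      by (simp only: slot_set[OF B(9), symmetric] slot_set[OF B(10), symmetric])
    finally show ?thesis by (simp only: image_insert image_empty Un_insert_left Un_empty_left)
  qed
  have vs: "{d \<in> darts D. fst d \<notin> {b, c} \<and> fst (nb D d) \<in> {b, c}} = {p1, q1, p2, q2}"
  proof
    show "{p1, q1, p2, q2} \<subseteq> {d \<in> darts D. fst d \<notin> {b, c} \<and> fst (nb D d) \<in> {b, c}}"
      using P B(13-16) by (auto simp: doubleton_eq_iff)
    show "{d \<in> darts D. fst d \<notin> {b, c} \<and> fst (nb D d) \<in> {b, c}} \<subseteq> {p1, q1, p2, q2}"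
    proof
      fix d assume "d \<in> {d \<in> darts D. fst d \<notin> {b, c} \<and> fst (nb D d) \<in> {b, c}}"
      then have d: "d \<in> darts D" "fst (nb D d) \<in> {b, c}" by auto
      note n = wf_nb[OF wf d(1)]
      have "nb D d \<in> {(b,0),(b,1),(c,0),(c,1)}"
        using d(2) n B(4,5) by (cases "nb D d") (auto simp: dart_bead)
      then have "nb D d \<in> {nb D p1, nb D q1} \<union> {nb D p2, nb D q2}" unfolding P(6,7) by auto
      then show "d \<in> {p1, q1, p2, q2}" using n wf_nb[OF wf P(1)] wf_nb[OF wf P(2)] wf_nb[OF wf P(3)] wf_nb[OF wf P(4)]
        by (metis UnE insertCI insertE singletonD)
    qed
  qed
  have E: "set (ends ps) = {d \<in> darts D'. fst d \<in> {x, y}} \<union> {d \<in> darts D. fst d \<notin> {b, c} \<and> fst (nb D d) \<in> {b, c}}"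
    unfolding xs vs by (simp only: ps_def ends_def) auto
  have kinds: "kind D' v = kind D v" if "v \<in> nodes D - {b, c}" for v using that B by auto
  have S: "finite {x, y}" "{x, y} \<inter> nodes D = {}" using B by auto
  note rep = wf B(17) S kinds dist B(19)[folded ps_def] E
  show "pd_wf D'" by (rule replace_wf[OF rep])
  have L': "\<forall>p\<in>set ps. nb D' (fst p) = snd p" using replace_links[OF rep] by (metis prod.collapse)
  show "nb D' (x,i) = (y,(j+1) mod 4)" "nb D' (x,(i+1) mod 4) = (y,j)"
      "nb D' (x,(i+2) mod 4) = p1" "nb D' (y,(j+3) mod 4) = q1" "nb D' (x,(i+3) mod 4) = p2" "nb D' (y,(j+2) mod 4) = q2"
    using L' by (simp_all add: ps_def)
  fix g g0 :: "dart \<Rightarrow> 'a"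
  assume g: "\<forall>d\<in>darts D. g0 (nb D d) = g0 d" "\<And>d. d \<in> darts D \<Longrightarrow> fst d \<notin> {b, c} \<Longrightarrow> g d = g0 d"
    and l: "g (x,i) = g (y,(j+1) mod 4)" "g (x,(i+1) mod 4) = g (y,j)" "g (x,(i+2) mod 4) = g0 p1"
      "g (y,(j+3) mod 4) = g0 q1" "g (x,(i+3) mod 4) = g0 p2" "g (y,(j+2) mod 4) = g0 q2"
  have gp: "g p1 = g0 p1" "g q1 = g0 q1" "g p2 = g0 p2" "g q2 = g0 q2" using g(2) P B(13-16) by auto
  show "\<forall>d\<in>darts D'. g (nb D' d) = g d"
  proof (rule replace_const[OF rep g])
    have "\<forall>p\<in>set ps. g (fst p) = g (snd p)" using l gp by (simp add: ps_def)
    then show "g d = g d'" if "(d, d') \<in> set ps" for d d' using that by fastforce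
  qed
qed

lemma bigon_code: "A \<subseteq> nodes D - {b, c} \<Longrightarrow> (\<And>d. d \<in> darts D \<Longrightarrow> fst d \<notin> {b, c} \<Longrightarrow> e' d = e d) \<Longrightarrow> code D' e' A = code D e A"
proof (rule code_cong)
  assume A: "A \<subseteq> nodes D - {b, c}" and e: "\<And>d. d \<in> darts D \<Longrightarrow> fst d \<notin> {b, c} \<Longrightarrow> e' d = e d"
  show "finite A" using wf A by (meson finite_Diff finite_subset pd_wf_def)
  show "pdeg D v = pdeg D' v" if "v \<in> A" for v using A that bigon_basic(6,7) by (auto simp: pdeg_def bigon_basic(18))
  then show "e' (v, s) = e (v, s)" if "v \<in> A" "s < pdeg D' v" for v s
    using that A by (intro e) (auto simp: darts_def)
qed

text \<open>\<open>u\<close> and \<open>v\<close> label the two sides of the bigon; the outer slots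
  inherit the labels of the edges that ended at the beads.\<close>

definition bigon_label :: "(dart \<Rightarrow> nat) \<Rightarrow> nat \<Rightarrow> nat \<Rightarrow> dart \<Rightarrow> nat" where
  "bigon_label e u v = (\<lambda>d. if fst d = x then put i [u, v, e p1, e p2] (snd d)
     else if fst d = y then put j [v, u, e q2, e q1] (snd d) else e d)"

lemma bigon_label_row:
  "row (bigon_label e u v) x i = [u, v, e p1, e p2]" "row (bigon_label e u v) y j = [v, u, e q2, e q1]"
  "d \<in> darts D \<Longrightarrow> bigon_label e u v d = e d"
proof -
  note B = bigon_basic
  have xy: "bigon_label e u v (x, s) = put i [u, v, e p1, e p2] s" "bigon_label e u v (y, s) = put j [v, u, e q2, e q1] s" for s
    using B(8) by (simp_all add: bigon_label_def)
  show "row (bigon_label e u v) x i = [u, v, e p1, e p2]" "row (bigon_label e u v) y j = [v, u, e q2, e q1]"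
    by (simp_all only: row_def xy put_simps[OF B(9)] put_simps[OF B(10)])
  show "bigon_label e u v d = e d" if "d \<in> darts D" using in_darts_node[OF that] B(6,7) by (auto simp: bigon_label_def)
qed

text \<open>The new code has the letters of the old one and in addition \<open>u\<close> and
  \<open>v\<close>, twice each. Both are fresh, so no count exceeds 2 and \<open>labI\<close>
  applies.\<close>

lemma bigon_lab:
  assumes lab: "lab D e" and uv: "u \<noteq> v" "u \<notin> e ` darts D" "v \<notin> e ` darts D"
  shows "lab D' (bigon_label e u v)"
proof -
  note B = bigon_basic
  let ?e = "bigon_label e u v"
  have fin: "finite (nodes D)" using wf by (simp add: pd_wf_def)
  have "\<forall>d\<in>darts D'. ?e (nb D' d) = ?e d"
  proof (rule bigon_const[of e])
    show "\<forall>d\<in>darts D. e (nb D d) = e d" using lab by (simp add: lab_def)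
    show "?e d = e d" if "d \<in> darts D" for d using bigon_label_row(3) that .
    have xy: "?e (x, s) = put i [u, v, e p1, e p2] s" "?e (y, s) = put j [v, u, e q2, e q1] s" for s
      using B(8) by (simp_all add: bigon_label_def)
    show "?e (x,i) = ?e (y,(j+1) mod 4)" "?e (x,(i+1) mod 4) = ?e (y,j)" "?e (x,(i+2) mod 4) = e p1"
      "?e (y,(j+3) mod 4) = e q1" "?e (x,(i+3) mod 4) = e p2" "?e (y,(j+2) mod 4) = e q2"
      by (simp_all only: xy put_simps[OF B(9)] put_simps[OF B(10)])
  qed
  moreover have "count (lb (code D' ?e (nodes D'))) l \<le> 2" for l
  proof -
    let ?V = "nodes D - {b, c}"
    have 1: "nodes D' = insert x (insert y ?V)" "nodes D = insert b (insert c ?V)" using B by auto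
    have c1: "code D' ?e (nodes D') = add_mset (fl u v (e p1) (e p2)) (add_mset (fl v u (e q2) (e q1)) (code D e ?V))"
    proof -
      have "vert (vl D' ?e x) = fl u v (e p1) (e p2)" "vert (vl D' ?e y) = fl v u (e q2) (e q1)"
        using vert_row[of D' x i ?e] vert_row[of D' y j ?e] bigon_label_row k B by simp_all
      then show ?thesis unfolding 1(1) using B(6-8) fin bigon_code[of ?V ?e e] bigon_label_row(3) by simp
    qed
    have c2: "code D e (nodes D) = add_mset (bd (e (b,0)) (e (b,1))) (add_mset (bd (e (c,0)) (e (c,1))) (code D e ?V))"
      by (subst 1(2)) (use B(3-5) fin in \<open>simp add: vl_bead\<close>)
    have ep: "{e p1, e q1} = {e (b,0), e (b,1)}" "{#e p1, e q1#} = {#e (b,0), e (b,1)#}" "{#e p2, e q2#} = {#e (c,0), e (c,1)#}"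
    proof -
      have "e (nb D (b,0)) = e (b,0)" "e (nb D (b,1)) = e (b,1)" "e (nb D (c,0)) = e (c,0)" "e (nb D (c,1)) = e (c,1)"
        using B(1-5) lab by (simp_all add: lab_def dart_bead)
      note n = this
      show "{e p1, e q1} = {e (b,0), e (b,1)}" "{#e p1, e q1#} = {#e (b,0), e (b,1)#}"
        using B(11) by (elim disjE conjE; simp only: n insert_commute add_mset_commute)+
      show "{#e p2, e q2#} = {#e (c,0), e (c,1)#}"
        using B(12) by (elim disjE conjE; simp only: n add_mset_commute)
    qed
    have eq: "count (lb (code D' ?e (nodes D'))) l = count {#u, v, u, v#} l + count (lb (code D e (nodes D))) l"
      using arg_cong[OF ep(2), of "\<lambda>M. count M l"] arg_cong[OF ep(3), of "\<lambda>M. count M l"]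
      unfolding c1 c2 by (simp only: lb_simps lbv_vert mset.simps count_add_of_bool count_empty count_union; linarith)
    have "count (lb (code D e (nodes D))) l \<le> 2" using wfc_count[OF lab_wfc[OF lab], of l] by auto
    then show ?thesis unfolding eq using count_lb_fresh[OF lab uv(2)] count_lb_fresh[OF lab uv(3)] uv(1) by (cases "l = u"; cases "l = v"; simp)
  qed
  ultimately show ?thesis using bigon_wf by (intro labI) auto
qed

end

section \<open>The first move: links and labels of the new kink\<close>

context
  fixes k D D' b x i p q
  assumes mv: "kink_move k D D' b x i p q" and wf: "pd_wf D" and k: "k \<noteq> Bead"
begin

lemma kink_basic:
  "b \<in> nodes D" "kind D b = Bead" "x \<notin> nodes D" "i < 4"
  "(p = nb D (b,0) \<and> q = nb D (b,1)) \<or> (p = nb D (b,1) \<and> q = nb D (b,0))"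
  "fst p \<noteq> b" "fst q \<noteq> b"
  "nodes D' = {x} \<union> (nodes D - {b})" "kind D' = (kind D)(x := k)"
  "nb D' = lnks [((x,i),(x,(i+1) mod 4)), ((x,(i+2) mod 4), p), ((x,(i+3) mod 4), q)] (nb D)"
  using mv unfolding kink_move_def by (auto simp del: One_nat_def)

lemma kink_darts:
  "p \<in> darts D" "q \<in> darts D" "p \<noteq> q" "{nb D p, nb D q} = {(b,0),(b,1)}"
proof -
  note B = kink_basic
  have d: "(b,0) \<in> darts D" "(b,1) \<in> darts D" using B by (auto simp: dart_bead)
  note n = wf_nb[OF wf d(1)] wf_nb[OF wf d(2)]
  show "p \<in> darts D" "q \<in> darts D" "{nb D p, nb D q} = {(b,0),(b,1)}"
    using B(5) n by auto
  have "nb D (b,0) \<noteq> nb D (b,1)" using n by (metis Pair_inject zero_neq_one)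
  then show "p \<noteq> q" using B(5) by auto
qed

lemma kink_replace:
  shows kink_wf: "pd_wf D'"
    and kink_links: "nb D' (x,i) = (x,(i+1) mod 4)" "nb D' (x,(i+2) mod 4) = p" "nb D' (x,(i+3) mod 4) = q"
    and kink_const: "\<And>g g0. \<forall>d\<in>darts D. g0 (nb D d) = g0 d \<Longrightarrow> (\<And>d. d \<in> darts D \<Longrightarrow> fst d \<notin> {b} \<Longrightarrow> g d = g0 d) \<Longrightarrow>
      g (x,i) = g (x,(i+1) mod 4) \<Longrightarrow> g (x,(i+2) mod 4) = g0 p \<Longrightarrow> g (x,(i+3) mod 4) = g0 q \<Longrightarrow> \<forall>d\<in>darts D'. g (nb D' d) = g d"
proof -
  note B = kink_basic and P = kink_darts
  define ps where "ps = [((x,i),(x,(i+1) mod 4)), ((x,(i+2) mod 4), p), ((x,(i+3) mod 4), q)]"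
  have pn: "fst p \<in> nodes D" "fst q \<in> nodes D" using P in_darts_node by auto
  have ne: "d \<noteq> (x, s)" if "fst d \<in> nodes D" for d s using that B by auto
  have dist: "distinct (ends ps)"
    using slot_neq[OF B(4)] P(3) ne[OF pn(1)] ne[OF pn(2)]
    unfolding ps_def ends_def by (simp del: One_nat_def) metis
  have xs: "{d \<in> darts D'. fst d \<in> {x}} = {(x,i),(x,(i+1) mod 4),(x,(i+2) mod 4),(x,(i+3) mod 4)}"
  proof -
    have "kind D' x \<noteq> Bead" using k by (simp_all add: B(9))
    then have "{d \<in> darts D'. fst d \<in> {x}} = Pair x ` {..<4}" by (auto simp: dart_cross B(8))
    then show ?thesis by (simp only: slot_set[OF B(4)] image_insert image_empty)
  qed
  have vs: "{d \<in> darts D. fst d \<notin> {b} \<and> fst (nb D d) \<in> {b}} = {p, q}"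
  proof
    show "{p, q} \<subseteq> {d \<in> darts D. fst d \<notin> {b} \<and> fst (nb D d) \<in> {b}}"
      using P B(6,7) by (auto simp: doubleton_eq_iff)
    show "{d \<in> darts D. fst d \<notin> {b} \<and> fst (nb D d) \<in> {b}} \<subseteq> {p, q}"
    proof
      fix d assume "d \<in> {d \<in> darts D. fst d \<notin> {b} \<and> fst (nb D d) \<in> {b}}"
      then have d: "d \<in> darts D" "fst (nb D d) \<in> {b}" by auto
      note n = wf_nb[OF wf d(1)]
      have "nb D d \<in> {(b,0),(b,1)}" using d(2) n B(2) by (cases "nb D d") (auto simp: dart_bead)
      then have "nb D d \<in> {nb D p, nb D q}" unfolding P(4) by auto
      then show "d \<in> {p, q}" using n wf_nb[OF wf P(1)] wf_nb[OF wf P(2)]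
        by (metis insertCI insertE singletonD)
    qed
  qed
  have E: "set (ends ps) = {d \<in> darts D'. fst d \<in> {x}} \<union> {d \<in> darts D. fst d \<notin> {b} \<and> fst (nb D d) \<in> {b}}"
    unfolding xs vs by (simp only: ps_def ends_def) auto
  have kinds: "kind D' v = kind D v" if "v \<in> nodes D - {b}" for v using that B by auto
  have S: "finite {x}" "{x} \<inter> nodes D = {}" using B by auto
  note rep = wf B(8) S kinds dist B(10)[folded ps_def] E
  show "pd_wf D'" by (rule replace_wf[OF rep])
  have L': "\<forall>p\<in>set ps. nb D' (fst p) = snd p" using replace_links[OF rep] by (metis prod.collapse)
  show "nb D' (x,i) = (x,(i+1) mod 4)" "nb D' (x,(i+2) mod 4) = p" "nb D' (x,(i+3) mod 4) = q"
    using L' by (simp_all add: ps_def)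
  fix g g0 :: "dart \<Rightarrow> 'a"
  assume g: "\<forall>d\<in>darts D. g0 (nb D d) = g0 d" "\<And>d. d \<in> darts D \<Longrightarrow> fst d \<notin> {b} \<Longrightarrow> g d = g0 d"
    and l: "g (x,i) = g (x,(i+1) mod 4)" "g (x,(i+2) mod 4) = g0 p" "g (x,(i+3) mod 4) = g0 q"
  have gp: "g p = g0 p" "g q = g0 q" using g(2) P B(6,7) by auto
  show "\<forall>d\<in>darts D'. g (nb D' d) = g d"
  proof (rule replace_const[OF rep g])
    have "\<forall>p\<in>set ps. g (fst p) = g (snd p)" using l gp by (simp add: ps_def)
    then show "g d = g d'" if "(d, d') \<in> set ps" for d d' using that by fastforce
  qed
qed

lemma kink_code: "A \<subseteq> nodes D - {b} \<Longrightarrow> (\<And>d. d \<in> darts D \<Longrightarrow> fst d \<notin> {b} \<Longrightarrow> e' d = e d) \<Longrightarrow> code D' e' A = code D e A"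
proof (rule code_cong)
  assume A: "A \<subseteq> nodes D - {b}" and e: "\<And>d. d \<in> darts D \<Longrightarrow> fst d \<notin> {b} \<Longrightarrow> e' d = e d"
  show "finite A" using wf A by (meson finite_Diff finite_subset pd_wf_def)
  show "pdeg D v = pdeg D' v" if "v \<in> A" for v using A that kink_basic(3) by (auto simp: pdeg_def kink_basic(9))
  then show "e' (v, s) = e (v, s)" if "v \<in> A" "s < pdeg D' v" for v s
    using that A by (intro e) (auto simp: darts_def)
qed

text \<open>\<open>u\<close> labels the loop of the kink, which joins the adjacent slots
  \<open>i\<close> and \<open>i + 1\<close>.\<close>

definition kink_label :: "(dart \<Rightarrow> nat) \<Rightarrow> nat \<Rightarrow> dart \<Rightarrow> nat" where
  "kink_label e u = (\<lambda>d. if fst d = x then put i [u, u, e p, e q] (snd d) else e d)"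

lemma kink_label_row:
  "row (kink_label e u) x i = [u, u, e p, e q]" "d \<in> darts D \<Longrightarrow> kink_label e u d = e d"
proof -
  note B = kink_basic
  have x: "kink_label e u (x, s) = put i [u, u, e p, e q] s" for s by (simp add: kink_label_def)
  show "row (kink_label e u) x i = [u, u, e p, e q]"
    by (simp_all only: row_def x put_simps[OF B(4)])
  show "kink_label e u d = e d" if "d \<in> darts D" using in_darts_node[OF that] B(3) by (auto simp: kink_label_def)
qed

lemma kink_bead: 
  assumes "lab D e"
  shows "vert (vl D e b) = bd (e p) (e q)" "{#e p, e q#} = {#e (b,0), e (b,1)#}" 
proof -
  note B = kink_basic
  have n: "e (nb D (b,0)) = e (b,0)" "e (nb D (b,1)) = e (b,1)"
    using B(1-2) assms by (simp_all add: lab_def dart_bead)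
  show "{#e p, e q#} = {#e (b,0), e (b,1)#}"
    using B(5) by (elim disjE conjE; simp only: n add_mset_commute)
  show "vert (vl D e b) = bd (e p) (e q)" unfolding vl_bead[OF B(2)]
    using B(5) n by (elim disjE conjE) (simp_all add: bd_commute)
qed

lemma kink_lab:
  assumes lab: "lab D e" and u: "u \<notin> e ` darts D"
  shows "lab D' (kink_label e u)"
proof -
  note B = kink_basic
  let ?e = "kink_label e u"
  have fin: "finite (nodes D)" using wf by (simp add: pd_wf_def)
  have "\<forall>d\<in>darts D'. ?e (nb D' d) = ?e d"
  proof (rule kink_const[of e])
    show "\<forall>d\<in>darts D. e (nb D d) = e d" using lab by (simp add: lab_def)
    show "?e d = e d" if "d \<in> darts D" for d using kink_label_row(2) that .
    have x: "?e (x, s) = put i [u, u, e p, e q] s" for s by (simp add: kink_label_def)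
    show "?e (x,i) = ?e (x,(i+1) mod 4)" "?e (x,(i+2) mod 4) = e p" "?e (x,(i+3) mod 4) = e q"
      by (simp_all only: x put_simps[OF B(4)])
  qed
  moreover have "count (lb (code D' ?e (nodes D'))) l \<le> 2" for l
  proof -
    let ?V = "nodes D - {b}"
    have 1: "nodes D' = insert x ?V" "nodes D = insert b ?V" using B by auto
    have c1: "code D' ?e (nodes D') = add_mset (fl u u (e p) (e q)) (code D e ?V)"
    proof -
      have "vert (vl D' ?e x) = fl u u (e p) (e q)"
        using vert_row[of D' x i ?e] kink_label_row k B by simp_all
      then show ?thesis unfolding 1(1) using B(3) fin kink_code[of ?V ?e e] kink_label_row(2) by simp
    qed
    have c2: "code D e (nodes D) = add_mset (bd (e p) (e q)) (code D e ?V)"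
      using code_insert[of ?V b D e] fin kink_bead(1)[OF lab] unfolding 1(2)[symmetric] by simp
    have eq: "count (lb (code D' ?e (nodes D'))) l = count {#u, u#} l + count (lb (code D e (nodes D))) l"
      unfolding c1 c2 by (simp only: lb_simps lbv_vert mset.simps count_add_of_bool count_empty count_union; linarith)
    have "count (lb (code D e (nodes D))) l \<le> 2" using wfc_count[OF lab_wfc[OF lab], of l] by auto
    then show ?thesis unfolding eq using count_lb_fresh[OF lab u] by (cases "l = u"; simp)
  qed
  ultimately show ?thesis using kink_wf by (intro labI) auto
qed

end

section \<open>The third move: links and labels of the new triangle\<close>

context
  fixes k D D' x y z a b c x' y' z'
  assumes mv: "tri_move k D D' x y z a b c x' y' z'" and wf: "pd_wf D" and k: "k \<noteq> Bead"
begin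

lemma tri_links_def: "nodes D' = {x',y',z'} \<union> (nodes D - {x,y,z})" "kind D' = (kind D)(x' := k, y' := k, z' := k)"
  "nb D' = lnks [((x',a), nb D (z,(c+3) mod 4)), ((x',(a+1) mod 4), nb D (y,(b+2) mod 4)),
             ((x',(a+2) mod 4), (z',(c+3) mod 4)), ((x',(a+3) mod 4), (y',(b+2) mod 4)),
             ((z',c), nb D (y,(b+3) mod 4)), ((z',(c+1) mod 4), nb D (x,(a+2) mod 4)),
             ((z',(c+2) mod 4), (y',(b+3) mod 4)), ((y',b), nb D (x,(a+3) mod 4)),
             ((y',(b+1) mod 4), nb D (z,(c+2) mod 4))] (nb D)"
  using mv unfolding tri_move_def by (elim conjE; simp only: pd.simps)+

lemma tri_basic:
  "x \<in> nodes D" "y \<in> nodes D" "z \<in> nodes D" "distinct [x,y,z]"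
  "kind D x = k" "kind D y = k" "kind D z = k" "a < 4" "b < 4" "c < 4"
  "nb D (x,(a+1) mod 4) = (y,b)" "nb D (y,(b+1) mod 4) = (z,c)" "nb D (z,(c+1) mod 4) = (x,a)"
  "distinct [x',y',z']" "x' \<notin> nodes D" "y' \<notin> nodes D" "z' \<notin> nodes D"
  "nodes D' = {x',y',z'} \<union> (nodes D - {x,y,z})" "kind D' = (kind D)(x' := k, y' := k, z' := k)"
  "nb D' = lnks [((x',a), nb D (z,(c+3) mod 4)), ((x',(a+1) mod 4), nb D (y,(b+2) mod 4)),
             ((x',(a+2) mod 4), (z',(c+3) mod 4)), ((x',(a+3) mod 4), (y',(b+2) mod 4)),
             ((z',c), nb D (y,(b+3) mod 4)), ((z',(c+1) mod 4), nb D (x,(a+2) mod 4)),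
             ((z',(c+2) mod 4), (y',(b+3) mod 4)), ((y',b), nb D (x,(a+3) mod 4)),
             ((y',(b+1) mod 4), nb D (z,(c+2) mod 4))] (nb D)"
  "k = Real \<Longrightarrow> (odd (a+1) \<and> odd b) \<or> (odd (b+1) \<and> odd c) \<or> (odd (c+1) \<and> odd a)"
proof -
  show "nodes D' = {x',y',z'} \<union> (nodes D - {x,y,z})" "kind D' = (kind D)(x' := k, y' := k, z' := k)"
  "nb D' = lnks [((x',a), nb D (z,(c+3) mod 4)), ((x',(a+1) mod 4), nb D (y,(b+2) mod 4)),
             ((x',(a+2) mod 4), (z',(c+3) mod 4)), ((x',(a+3) mod 4), (y',(b+2) mod 4)),
             ((z',c), nb D (y,(b+3) mod 4)), ((z',(c+1) mod 4), nb D (x,(a+2) mod 4)),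
             ((z',(c+2) mod 4), (y',(b+3) mod 4)), ((y',b), nb D (x,(a+3) mod 4)),
             ((y',(b+1) mod 4), nb D (z,(c+2) mod 4))] (nb D)" by (rule tri_links_def)+
qed (use mv in \<open>unfold tri_move_def, blast+\<close>)

lemma tri_outer:
  "fst (nb D (z,(c+3) mod 4)) \<notin> {x,y,z}" "fst (nb D (y,(b+2) mod 4)) \<notin> {x,y,z}" "fst (nb D (y,(b+3) mod 4)) \<notin> {x,y,z}"
  "fst (nb D (x,(a+2) mod 4)) \<notin> {x,y,z}" "fst (nb D (x,(a+3) mod 4)) \<notin> {x,y,z}" "fst (nb D (z,(c+2) mod 4)) \<notin> {x,y,z}"
proof -
  let ?S = "{nb D (z,(c+3) mod 4), nb D (y,(b+2) mod 4), nb D (y,(b+3) mod 4),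
            nb D (x,(a+2) mod 4), nb D (x,(a+3) mod 4), nb D (z,(c+2) mod 4)}"
  have disj: "fst ` ?S \<inter> {x,y,z} = {}" using mv unfolding tri_move_def by (elim conjE)
  have *: "fst d \<notin> {x,y,z}" if "d \<in> ?S" for d
    using disj[unfolded disjoint_iff, rule_format, OF imageI[OF that, of fst]] .
  show "fst (nb D (z,(c+3) mod 4)) \<notin> {x,y,z}" by (rule *, rule insertI1)
  show "fst (nb D (y,(b+2) mod 4)) \<notin> {x,y,z}" by (rule *, rule insertI2, rule insertI1)
  show "fst (nb D (y,(b+3) mod 4)) \<notin> {x,y,z}" by (rule *) (simp only: insert_iff simp_thms)
  show "fst (nb D (x,(a+2) mod 4)) \<notin> {x,y,z}" by (rule *) (simp only: insert_iff simp_thms)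
  show "fst (nb D (x,(a+3) mod 4)) \<notin> {x,y,z}" by (rule *) (simp only: insert_iff simp_thms)
  show "fst (nb D (z,(c+2) mod 4)) \<notin> {x,y,z}" by (rule *) (simp only: insert_iff simp_thms)
qed

lemma tri_darts: "s < 4 \<Longrightarrow> (x, s) \<in> darts D" "s < 4 \<Longrightarrow> (y, s) \<in> darts D" "s < 4 \<Longrightarrow> (z, s) \<in> darts D"
  using tri_basic k by (auto simp: dart_cross)

lemma tri_replace:
  shows tri_wf: "pd_wf D'"
    and tri_links: "nb D' (x',a) = nb D (z,(c+3) mod 4)" "nb D' (x',(a+1) mod 4) = nb D (y,(b+2) mod 4)"
       "nb D' (x',(a+2) mod 4) = (z',(c+3) mod 4)" "nb D' (x',(a+3) mod 4) = (y',(b+2) mod 4)"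
       "nb D' (z',c) = nb D (y,(b+3) mod 4)" "nb D' (z',(c+1) mod 4) = nb D (x,(a+2) mod 4)"
       "nb D' (z',(c+2) mod 4) = (y',(b+3) mod 4)" "nb D' (y',b) = nb D (x,(a+3) mod 4)"
       "nb D' (y',(b+1) mod 4) = nb D (z,(c+2) mod 4)"
    and tri_const: "\<And>g g0. \<forall>d\<in>darts D. g0 (nb D d) = g0 d \<Longrightarrow> (\<And>d. d \<in> darts D \<Longrightarrow> fst d \<notin> {x, y, z} \<Longrightarrow> g d = g0 d) \<Longrightarrow>
      g (x',a) = g0 (z,(c+3) mod 4) \<Longrightarrow> g (x',(a+1) mod 4) = g0 (y,(b+2) mod 4) \<Longrightarrow>
      g (x',(a+2) mod 4) = g (z',(c+3) mod 4) \<Longrightarrow> g (x',(a+3) mod 4) = g (y',(b+2) mod 4) \<Longrightarrow>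
      g (z',c) = g0 (y,(b+3) mod 4) \<Longrightarrow> g (z',(c+1) mod 4) = g0 (x,(a+2) mod 4) \<Longrightarrow>
      g (z',(c+2) mod 4) = g (y',(b+3) mod 4) \<Longrightarrow> g (y',b) = g0 (x,(a+3) mod 4) \<Longrightarrow>
      g (y',(b+1) mod 4) = g0 (z,(c+2) mod 4) \<Longrightarrow> \<forall>d\<in>darts D'. g (nb D' d) = g d"
proof -
  note B = tri_basic
  define R where "R = {x, y, z}"
  define I where "I = [(x,a), (x,(a+1) mod 4), (y,b), (y,(b+1) mod 4), (z,c), (z,(c+1) mod 4)]"
  define O1 where "O1 = [(z,(c+3) mod 4), (y,(b+2) mod 4), (y,(b+3) mod 4), (x,(a+2) mod 4), (x,(a+3) mod 4), (z,(c+2) mod 4)]"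
  have d: "d \<in> darts D" if "d \<in> set O1 \<union> set I" for d
    using that tri_darts B(8-10) unfolding O1_def I_def by (auto simp del: One_nat_def)
  have dO: "distinct O1" using slot_neq[OF B(8)] slot_neq[OF B(9)] slot_neq[OF B(10)] B(4) unfolding O1_def
    by (simp only: distinct.simps list.set insert_iff empty_iff prod.inject) metis
  have inj: "inj_on (nb D) (darts D)" by (rule inj_onI) (metis wf_nb[OF wf])
  have dP: "distinct (map (nb D) O1)" using dO inj d by (simp add: distinct_map) (meson inj_on_subset subsetI)
  have "\<forall>d\<in>set O1. fst (nb D d) \<notin> R"
    unfolding O1_def R_def list.set ball_simps by (intro conjI TrueI tri_outer)
  then have oR: "fst (nb D d) \<notin> R" if "d \<in> set O1" for d using that by blast
  \<comment> \<open>The sides of the triangle link \<open>R\<close> to itself; these six darts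
    create no outer end.\<close>
  have iR: "fst (nb D d) \<in> R" if "d \<in> set I" for d
  proof -
    have "nb D (y,b) = (x,(a+1) mod 4)" "nb D (z,c) = (y,(b+1) mod 4)" "nb D (x,a) = (z,(c+1) mod 4)"
      using B(11-13) wf_nb[OF wf] tri_darts B(8-10) by (metis mod_less_divisor zero_less_numeral)+
    then show ?thesis using that B(11-13) unfolding R_def I_def by auto
  qed
  have allR: "d \<in> set O1 \<union> set I" if "d \<in> darts D" "fst d \<in> R" for d
  proof (cases d)
    case (Pair v s)
    then have "s < 4" using that(1) by (auto simp: darts_def pdeg_def split: if_splits)
    then show ?thesis using that(2) slot_cases[OF _ B(8), of s] slot_cases[OF _ B(9), of s] slot_cases[OF _ B(10), of s]
      unfolding Pair R_def O1_def I_def by auto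
  qed
  define ps where "ps = [((x',a), nb D (z,(c+3) mod 4)), ((x',(a+1) mod 4), nb D (y,(b+2) mod 4)),
             ((x',(a+2) mod 4), (z',(c+3) mod 4)), ((x',(a+3) mod 4), (y',(b+2) mod 4)),
             ((z',c), nb D (y,(b+3) mod 4)), ((z',(c+1) mod 4), nb D (x,(a+2) mod 4)),
             ((z',(c+2) mod 4), (y',(b+3) mod 4)), ((y',b), nb D (x,(a+3) mod 4)),
             ((y',(b+1) mod 4), nb D (z,(c+2) mod 4))]"
  define N where "N = [(x',a), (x',(a+1) mod 4), (x',(a+2) mod 4), (x',(a+3) mod 4), (y',b), (y',(b+1) mod 4), (y',(b+2) mod 4), (y',(b+3) mod 4),
      (z',c), (z',(c+1) mod 4), (z',(c+2) mod 4), (z',(c+3) mod 4)]"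
  \<comment> \<open>The 18 ends are the 12 darts of the new crossings and the 6 outer darts. After
    this regrouping distinctness is checked for the two groups separately.\<close>
  have perm: "mset (ends ps) = mset (N @ map (nb D) O1)"
    unfolding ps_def N_def O1_def ends_def by simp
  have n: "x' \<noteq> y'" "x' \<noteq> z'" "y' \<noteq> z'" using B(14) by auto
  have dN: "distinct N" unfolding N_def
    by (simp only: distinct.simps list.set insert_iff empty_iff prod.inject n slot_neq[OF B(8)] slot_neq[OF B(9)] slot_neq[OF B(10)]
      simp_thms)
  have NP: "set N \<inter> set (map (nb D) O1) = {}"
  proof -
    have "fst d \<in> {x', y', z'}" if "d \<in> set N" for d using that unfolding N_def by auto
    moreover have "fst d \<in> nodes D" if "d \<in> set (map (nb D) O1)" for d
      using that d wf_nb[OF wf] in_darts_node by (metis UnCI imageE set_map)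
    ultimately show ?thesis using B(15-17) by blast
  qed
  have dist: "distinct (ends ps)"
    using dN dP NP mset_eq_imp_distinct_iff[OF perm] by simp
  have xs: "{d \<in> darts D'. fst d \<in> {x', y', z'}} = set N"
  proof -
    have "kind D' x' \<noteq> Bead" "kind D' y' \<noteq> Bead" "kind D' z' \<noteq> Bead" using k by (simp_all add: B(19))
    then have "{d \<in> darts D'. fst d \<in> {x', y', z'}} = Pair x' ` {..<4} \<union> Pair y' ` {..<4} \<union> Pair z' ` {..<4}"
      by (auto simp: dart_cross B(18))
    also have "\<dots> = Pair x' ` {a, (a + 1) mod 4, (a + 2) mod 4, (a + 3) mod 4} \<union> Pair y' ` {b, (b + 1) mod 4, (b + 2) mod 4, (b + 3) mod 4}
       \<union> Pair z' ` {c, (c + 1) mod 4, (c + 2) mod 4, (c + 3) mod 4}"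
      by (simp only: slot_set[OF B(8), symmetric] slot_set[OF B(9), symmetric] slot_set[OF B(10), symmetric])
    also have "\<dots> = set N" unfolding N_def by auto
    finally show ?thesis .
  qed
  have vs: "{d \<in> darts D. fst d \<notin> R \<and> fst (nb D d) \<in> R} = set (map (nb D) O1)"
  proof
    show "set (map (nb D) O1) \<subseteq> {d \<in> darts D. fst d \<notin> R \<and> fst (nb D d) \<in> R}"
    proof
      fix w assume "w \<in> set (map (nb D) O1)"
      then obtain t where t: "t \<in> set O1" "w = nb D t" by auto
      have "fst t \<in> R" using t(1) unfolding O1_def R_def by auto
      then show "w \<in> {d \<in> darts D. fst d \<notin> R \<and> fst (nb D d) \<in> R}"
        using wf_nb[OF wf d[of t]] t oR by auto
    qed
    show "{d \<in> darts D. fst d \<notin> R \<and> fst (nb D d) \<in> R} \<subseteq> set (map (nb D) O1)"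
    proof
      fix w assume "w \<in> {d \<in> darts D. fst d \<notin> R \<and> fst (nb D d) \<in> R}"
      then have w: "w \<in> darts D" "fst w \<notin> R" "fst (nb D w) \<in> R" by auto
      note n = wf_nb[OF wf w(1)]
      have "nb D w \<in> set O1" using allR[of "nb D w"] n w iR[of "nb D w"] by auto
      then show "w \<in> set (map (nb D) O1)" using n by (metis image_eqI set_map)
    qed
  qed
  have E: "set (ends ps) = {d \<in> darts D'. fst d \<in> {x', y', z'}} \<union> {d \<in> darts D. fst d \<notin> R \<and> fst (nb D d) \<in> R}"
    unfolding xs vs using arg_cong[OF perm, of set_mset] by simp
  have kinds: "kind D' v = kind D v" if "v \<in> nodes D - R" for v using that B by auto
  have S: "finite {x', y', z'}" "{x', y', z'} \<inter> nodes D = {}" using B by auto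
  note rep = wf B(18)[folded R_def] S kinds dist B(20)[folded ps_def] E
  show "pd_wf D'" by (rule replace_wf[OF rep])
  have L': "\<forall>p\<in>set ps. nb D' (fst p) = snd p" using replace_links[OF rep] by (metis prod.collapse)
  show "nb D' (x',a) = nb D (z,(c+3) mod 4)" "nb D' (x',(a+1) mod 4) = nb D (y,(b+2) mod 4)"
       "nb D' (x',(a+2) mod 4) = (z',(c+3) mod 4)" "nb D' (x',(a+3) mod 4) = (y',(b+2) mod 4)"
       "nb D' (z',c) = nb D (y,(b+3) mod 4)" "nb D' (z',(c+1) mod 4) = nb D (x,(a+2) mod 4)"
       "nb D' (z',(c+2) mod 4) = (y',(b+3) mod 4)" "nb D' (y',b) = nb D (x,(a+3) mod 4)"
       "nb D' (y',(b+1) mod 4) = nb D (z,(c+2) mod 4)"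
    using L' by (simp_all add: ps_def)
  fix g g0 :: "dart \<Rightarrow> 'a"
  assume g: "\<forall>d\<in>darts D. g0 (nb D d) = g0 d" "\<And>d. d \<in> darts D \<Longrightarrow> fst d \<notin> {x, y, z} \<Longrightarrow> g d = g0 d"
    and l: "g (x',a) = g0 (z,(c+3) mod 4)" "g (x',(a+1) mod 4) = g0 (y,(b+2) mod 4)"
      "g (x',(a+2) mod 4) = g (z',(c+3) mod 4)" "g (x',(a+3) mod 4) = g (y',(b+2) mod 4)"
      "g (z',c) = g0 (y,(b+3) mod 4)" "g (z',(c+1) mod 4) = g0 (x,(a+2) mod 4)"
      "g (z',(c+2) mod 4) = g (y',(b+3) mod 4)" "g (y',b) = g0 (x,(a+3) mod 4)" "g (y',(b+1) mod 4) = g0 (z,(c+2) mod 4)"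
  have gp: "g (nb D t) = g0 t" if "t \<in> set O1" for t
    using g(2)[of "nb D t"] g(1) wf_nb[OF wf d[of t]] d[of t] oR[OF that] that unfolding R_def by auto
  show "\<forall>d\<in>darts D'. g (nb D' d) = g d"
  proof (rule replace_const[OF rep g(1)])
    show "g d = g0 d" if "d \<in> darts D" "fst d \<notin> R" for d using g(2) that by (simp add: R_def)
    have "\<forall>p\<in>set ps. g (fst p) = g (snd p)" using l gp by (simp add: ps_def O1_def del: One_nat_def)
    then show "g d = g d'" if "(d, d') \<in> set ps" for d d' using that by fastforce
  qed
qed

text \<open>No fresh labels: the sides of the new triangle take over the labels of the old sides. A
  strand meets its two crossings in the opposite order but through the same slots, so outer labels
  of \<open>z\<close> and \<open>y\<close> appear at \<open>x'\<close>, those of \<open>x\<close>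
  and \<open>z\<close> at \<open>y'\<close>, and those of \<open>y\<close> and \<open>x\<close> at
  \<open>z'\<close>.\<close>

definition tri_label :: "(dart \<Rightarrow> nat) \<Rightarrow> dart \<Rightarrow> nat" where
  "tri_label e = (\<lambda>d. if fst d = x' then put a [e (z,(c+3) mod 4), e (y,(b+2) mod 4), e (x,a), e (x,(a+1) mod 4)] (snd d)
     else if fst d = y' then put b [e (x,(a+3) mod 4), e (z,(c+2) mod 4), e (x,(a+1) mod 4), e (y,(b+1) mod 4)] (snd d)
     else if fst d = z' then put c [e (y,(b+3) mod 4), e (x,(a+2) mod 4), e (y,(b+1) mod 4), e (x,a)] (snd d) else e d)"

lemma tri_label_row:
  "row (tri_label e) x' a = [e (z,(c+3) mod 4), e (y,(b+2) mod 4), e (x,a), e (x,(a+1) mod 4)]"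
  "row (tri_label e) y' b = [e (x,(a+3) mod 4), e (z,(c+2) mod 4), e (x,(a+1) mod 4), e (y,(b+1) mod 4)]"
  "row (tri_label e) z' c = [e (y,(b+3) mod 4), e (x,(a+2) mod 4), e (y,(b+1) mod 4), e (x,a)]"
  "d \<in> darts D \<Longrightarrow> tri_label e d = e d"
proof -
  note B = tri_basic
  have n: "x' \<noteq> y'" "x' \<noteq> z'" "y' \<noteq> z'" using B(14) by auto
  have xy: "tri_label e (x', s) = put a [e (z,(c+3) mod 4), e (y,(b+2) mod 4), e (x,a), e (x,(a+1) mod 4)] s"
    "tri_label e (y', s) = put b [e (x,(a+3) mod 4), e (z,(c+2) mod 4), e (x,(a+1) mod 4), e (y,(b+1) mod 4)] s"
    "tri_label e (z', s) = put c [e (y,(b+3) mod 4), e (x,(a+2) mod 4), e (y,(b+1) mod 4), e (x,a)] s" for s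
    using n by (simp_all add: tri_label_def)
  show "row (tri_label e) x' a = [e (z,(c+3) mod 4), e (y,(b+2) mod 4), e (x,a), e (x,(a+1) mod 4)]"
  "row (tri_label e) y' b = [e (x,(a+3) mod 4), e (z,(c+2) mod 4), e (x,(a+1) mod 4), e (y,(b+1) mod 4)]"
  "row (tri_label e) z' c = [e (y,(b+3) mod 4), e (x,(a+2) mod 4), e (y,(b+1) mod 4), e (x,a)]"
    by (simp_all only: row_def xy put_simps[OF B(8)] put_simps[OF B(9)] put_simps[OF B(10)])
  show "tri_label e d = e d" if "d \<in> darts D" using in_darts_node[OF that] B(15-17) by (auto simp: tri_label_def)
qed

lemma tri_row_old:
  assumes "lab D e"
  shows "row e x a = [e (x,a), e (x,(a+1) mod 4), e (x,(a+2) mod 4), e (x,(a+3) mod 4)]"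
    "row e y b = [e (x,(a+1) mod 4), e (y,(b+1) mod 4), e (y,(b+2) mod 4), e (y,(b+3) mod 4)]"
    "row e z c = [e (y,(b+1) mod 4), e (x,a), e (z,(c+2) mod 4), e (z,(c+3) mod 4)]"
proof -
  note B = tri_basic
  have "e (nb D (x,(a+1) mod 4)) = e (x,(a+1) mod 4)" "e (nb D (y,(b+1) mod 4)) = e (y,(b+1) mod 4)" "e (nb D (z,(c+1) mod 4)) = e (z,(c+1) mod 4)"
    using lab_nb[OF assms] tri_darts by simp_all
  then show "row e x a = [e (x,a), e (x,(a+1) mod 4), e (x,(a+2) mod 4), e (x,(a+3) mod 4)]"
    "row e y b = [e (x,(a+1) mod 4), e (y,(b+1) mod 4), e (y,(b+2) mod 4), e (y,(b+3) mod 4)]"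
    "row e z c = [e (y,(b+1) mod 4), e (x,a), e (z,(c+2) mod 4), e (z,(c+3) mod 4)]"
    by (simp_all only: B(11-13) row_def)
qed

lemma tri_code: "A \<subseteq> nodes D - {x, y, z} \<Longrightarrow> (\<And>d. d \<in> darts D \<Longrightarrow> fst d \<notin> {x, y, z} \<Longrightarrow> e' d = e d) \<Longrightarrow> code D' e' A = code D e A"
proof (rule code_cong)
  assume A: "A \<subseteq> nodes D - {x, y, z}" and e: "\<And>d. d \<in> darts D \<Longrightarrow> fst d \<notin> {x, y, z} \<Longrightarrow> e' d = e d"
  show "finite A" using wf A by (meson finite_Diff finite_subset pd_wf_def)
  show "pdeg D v = pdeg D' v" if "v \<in> A" for v using A that tri_basic(15-17) by (auto simp: pdeg_def tri_basic(19))
  then show "e' (v, s) = e (v, s)" if "v \<in> A" "s < pdeg D' v" for v s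
    using that A by (intro e) (auto simp: darts_def)
qed

lemma tri_lab:
  assumes lab: "lab D e"
  shows "lab D' (tri_label e)"
proof -
  note B = tri_basic
  let ?e = "tri_label e"
  have fin: "finite (nodes D)" using wf by (simp add: pd_wf_def)
  have "\<forall>d\<in>darts D'. ?e (nb D' d) = ?e d"
  proof (rule tri_const[of e])
    show "\<forall>d\<in>darts D. e (nb D d) = e d" using lab by (simp add: lab_def)
    show "?e d = e d" if "d \<in> darts D" for d using tri_label_row(4) that .
  qed (simp_all only: tri_label_row(1-3)[of e, unfolded row_def list.inject])
  moreover have "count (lb (code D' ?e (nodes D'))) l \<le> 2" for l
  proof -
    let ?V = "nodes D - {x, y, z}"
    have 1: "nodes D' = insert x' (insert y' (insert z' ?V))" "nodes D = insert x (insert y (insert z ?V))" using B by auto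
    have n: "x' \<notin> insert y' (insert z' ?V)" "y' \<notin> insert z' ?V" "z' \<notin> ?V" "x \<notin> insert y (insert z ?V)" "y \<notin> insert z ?V" "z \<notin> ?V"
      using B by auto
    have c1: "code D' ?e (nodes D') = add_mset (vert (row ?e x' a)) (add_mset (vert (row ?e y' b)) (add_mset (vert (row ?e z' c)) (code D e ?V)))"
      unfolding 1(1) using n fin tri_code[of ?V ?e e] tri_label_row(4) k
        vert_row[of D' x' a ?e] vert_row[of D' y' b ?e] vert_row[of D' z' c ?e] by (simp add: B)
    have c2: "code D e (nodes D) = add_mset (vert (row e x a)) (add_mset (vert (row e y b)) (add_mset (vert (row e z c)) (code D e ?V)))"
      using code_insert[of "insert y (insert z ?V)" x D e] code_insert[of "insert z ?V" y D e] code_insert[of ?V z D e] n fin k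
        vert_row[of D x a e] vert_row[of D y b e] vert_row[of D z c e] unfolding 1(2)[symmetric] by (simp add: B)
    have eq: "count (lb (code D' ?e (nodes D'))) l = count (lb (code D e (nodes D))) l"
      unfolding c1 c2 tri_label_row tri_row_old[OF lab]
      by (simp only: lb_simps lbv_vert mset.simps count_add_of_bool count_empty count_union)
    show ?thesis unfolding eq using wfc_count[OF lab_wfc[OF lab], of l] by auto
  qed
  ultimately show ?thesis using tri_wf by (intro labI) auto
qed

end

lemma notin_label:
  assumes "lab D e" "count (lb (code D e (nodes D))) w = 0"
  shows "w \<notin> e ` darts D"
proof
  assume "w \<in> e ` darts D"
  then obtain d where "d \<in> darts D" "e d = w" by auto
  then have ne: "{d \<in> darts D. e d = w} \<noteq> {}" by blast
  have wf: "pd_wf D" using assms(1) by (simp add: lab_def)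
  then have fin: "finite (nodes D)" by (simp add: pd_wf_def)
  have "card {d \<in> darts D. e d = w} = 0" using assms(2) by (simp only: count_lb_code[OF fin] darts_eq)
  then show False using ne finite_darts[OF wf] by (simp only: card_eq_0_iff) simp
qed

lemma vert_beadE:
  assumes "vert (vl D e b) = bd p q"
  shows "kind D b = Bead" "\<exists>s t. (s, t) \<in> {(0, 1), (1, 0)} \<and> e (b, s) = p \<and> e (b, t) = q"
proof -
  obtain k where k: "[p, q] = rotate k (vl D e b)" using vert_eqD[OF assms] by blast
  have "length [p, q] = pdeg D b" by (simp only: k length_rotate length_vl)
  then show kb: "kind D b = Bead" by (auto simp: pdeg_def split: if_splits)
  have "[p, q] = [e (b,0), e (b,1)] \<or> [p, q] = [e (b,1), e (b,0)]"
    using k rotate_two[of k "e (b,0)" "e (b,1)"] unfolding vl_bead[OF kb] by auto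
  then show "\<exists>s t. (s, t) \<in> {(0, 1), (1, 0)} \<and> e (b, s) = p \<and> e (b, t) = q" by auto
qed

lemma codesI: "flatdiag D \<Longrightarrow> lab D e \<Longrightarrow> code D e (nodes D) = M \<Longrightarrow> codes D M"
  unfolding codes_def by blast

text \<open>The move is performed on a realization of the side with the beads. Distinct outer labels
  ensure that no outer dart lies at one of the two beads, the side condition of \<open>r2\<close>.
  The new crossings are glued from slot 0 on, which is no loss since a code does not see
  rotations.\<close>

lemma val_bigon:
  assumes M: "wfc (add_mset (fl u v p1 p2) (add_mset (fl v u q2 q1) N))" and dist: "distinct [p1, q1, p2, q2]"
  shows "veq (val (add_mset (fl u v p1 p2) (add_mset (fl v u q2 q1) N)) j) (val (add_mset (bd p1 q1) (add_mset (bd p2 q2) N)) j)"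
proof -
  let ?M = "add_mset (fl u v p1 p2) (add_mset (fl v u q2 q1) N)"
  let ?L = "add_mset (bd p1 q1) (add_mset (bd p2 q2) N)"
  have cnt: "count (lb ?M) l = 2 * of_bool (u = l) + 2 * of_bool (v = l) + count (lb ?L) l" for l
    by (simp only: lb_simps lbv_vert mset.simps count_add_of_bool count_empty count_union; linarith)
  have M0: "wfc ?L"
  proof -
    have "\<forall>X\<in>#?L. node_shape X" using M by (simp add: wfc_def)
    moreover have "count (lb ?L) l = 0 \<or> count (lb ?L) l = 2" for l
      using wfc_count[OF M, of l] cnt[of l] by (cases "u = l"; cases "v = l"; simp del: lb_simps; linarith)
    ultimately show ?thesis unfolding wfc_def by blast
  qed
  have uv: "u \<noteq> v" "count (lb ?L) u = 0" "count (lb ?L) v = 0"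
  proof -
    have u: "2 * of_bool (v = u) + count (lb ?L) u = 0"
      using wfc_count[OF M, of u] cnt[of u] by (simp only: simp_thms of_bool_eq; linarith)
    then have "of_bool (v = u) = (0::nat)" by linarith
    then show "u \<noteq> v" by auto
    show "count (lb ?L) u = 0" using u by linarith
    show "count (lb ?L) v = 0"
      using wfc_count[OF M, of v] cnt[of v] by (simp only: simp_thms of_bool_eq; linarith)
  qed
  obtain D where D: "codes D ?L" using wfc_realizable M0 by blast
  then obtain e where e: "lab D e" "code D e (nodes D) = ?L" and fD: "flatdiag D" by (auto simp: codes_def)
  have wf: "pd_wf D" using e by (simp add: lab_def)
  then have fin: "finite (nodes D)" by (simp add: pd_wf_def)
  obtain b where b: "b \<in> nodes D" "vert (vl D e b) = bd p1 q1"
    and N1: "code D e (nodes D - {b}) = add_mset (bd p2 q2) N" using code_extract[OF fin e(2)] by blast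
  obtain c where c: "c \<in> nodes D - {b}" "vert (vl D e c) = bd p2 q2"
    and N2: "code D e (nodes D - {b} - {c}) = N" using code_extract[OF _ N1] fin by blast
  have N: "code D e (nodes D - {b, c}) = N" using N2 by (subst Diff_insert2)
  note kb = vert_beadE(1)[OF b(2)] and kc = vert_beadE(1)[OF c(2)]
  obtain s t where st: "(s, t) \<in> {(0, 1), (1, 0)}" "e (b, s) = p1" "e (b, t) = q1"
    using vert_beadE(2)[OF b(2)] by (elim exE conjE) rule
  obtain s' t' where st': "(s', t') \<in> {(0, 1), (1, 0)}" "e (c, s') = p2" "e (c, t') = q2"
    using vert_beadE(2)[OF c(2)] by (elim exE conjE) rule
  have dd: "(b, s) \<in> darts D" "(b, t) \<in> darts D" "(c, s') \<in> darts D" "(c, t') \<in> darts D"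
    using b c kb kc st st' by (auto simp: dart_bead)
  have all: "d \<in> {(b,s),(b,t),(c,s'),(c,t')}" if "d \<in> darts D" "fst d \<in> {b, c}" for d
    using that kb kc st(1) st'(1) by (cases d) (auto simp: dart_bead)
  have out: "fst (nb D d) \<notin> {b, c}" if d: "d \<in> {(b,s),(b,t),(c,s'),(c,t')}" for d
  proof
    assume "fst (nb D d) \<in> {b, c}"
    moreover have dD: "d \<in> darts D" using d dd by auto
    note n = lab_nb[OF e(1) dD]
    ultimately have "nb D d \<in> {(b,s),(b,t),(c,s'),(c,t')}" using all by blast
    moreover have "inj_on e {(b,s),(b,t),(c,s'),(c,t')}" using dist st st' unfolding inj_on_def by auto
    ultimately show False using n d by (meson inj_onD)
  qed
  obtain x where x: "x \<notin> nodes D" using fin ex_new_if_finite[OF infinite_UNIV_nat] by blast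
  obtain y where y: "y \<notin> insert x (nodes D)" using fin ex_new_if_finite[OF infinite_UNIV_nat, of "insert x (nodes D)"] by blast
  let ?P1 = "nb D (b, s)" and ?Q1 = "nb D (b, t)" and ?P2 = "nb D (c, s')" and ?Q2 = "nb D (c, t')"
  define D' where "D' = \<lparr>nodes = insert x (insert y (nodes D - {b,c})), kind = (kind D)(x := Flat, y := Flat),
           nb = lnks [((x,0),(y,(0+1) mod 4)), ((x,(0+1) mod 4),(y,0)),
                      ((x,(0+2) mod 4), ?P1), ((y,(0+3) mod 4), ?Q1),
                      ((x,(0+3) mod 4), ?P2), ((y,(0+2) mod 4), ?Q2)] (nb D)\<rparr>"
  have mv: "bigon_move Flat D D' b c x y 0 0 ?P1 ?Q1 ?P2 ?Q2"
    unfolding bigon_move_def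
  proof (intro conjI)
    show "?P1 = nb D (b, 0) \<and> ?Q1 = nb D (b, 1) \<or> ?P1 = nb D (b, 1) \<and> ?Q1 = nb D (b, 0)" using st(1) by blast
    show "?P2 = nb D (c, 0) \<and> ?Q2 = nb D (c, 1) \<or> ?P2 = nb D (c, 1) \<and> ?Q2 = nb D (c, 0)" using st'(1) by blast
    show "fst ?P1 \<notin> {b, c}" "fst ?Q1 \<notin> {b, c}" "fst ?P2 \<notin> {b, c}" "fst ?Q2 \<notin> {b, c}" by (rule out, simp)+
    show "b \<noteq> c" "x \<noteq> y" "x \<notin> nodes D" "y \<notin> nodes D" "b \<in> nodes D" "c \<in> nodes D" using b c x y by auto
    show "Flat = Real \<longrightarrow> 0 mod 2 = (0 + 1) mod (2::nat)" by simp
  qed (fact kb kc D'_def zero_less_numeral)+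
  have ne: "Flat \<noteq> Bead" by simp
  note ctx = mv wf ne
  let ?e = "bigon_label x y 0 0 ?P1 ?Q1 ?P2 ?Q2 e u v"
  have ep: "e ?P1 = p1" "e ?Q1 = q1" "e ?P2 = p2" "e ?Q2 = q2" using lab_nb[OF e(1)] dd st st' by auto
  have lab': "lab D' ?e"
    by (rule bigon_lab[OF ctx e(1) uv(1)]; rule notin_label[OF e(1)], simp only: e(2) uv)
  note B = bigon_basic[OF ctx] and R = bigon_label_row[OF ctx, where e = e and u = u and v = v, unfolded ep]
  have "code D' ?e (nodes D') = ?M"
  proof -
    have "vert (vl D' ?e x) = fl u v p1 p2" "vert (vl D' ?e y) = fl v u q2 q1"
      using vert_row[of D' x 0 ?e] vert_row[of D' y 0 ?e] R(1,2) B(18) by (simp_all)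
    moreover have "nodes D' = insert x (insert y (nodes D - {b, c}))" using B(17) by simp
    moreover have "code D' ?e (nodes D - {b, c}) = N" using bigon_code[OF ctx, of "nodes D - {b, c}" ?e e] R(3) N by simp
    ultimately show ?thesis using x y fin by simp
  qed
  moreover have fD': "flatdiag D'"
    using fD bigon_wf[OF ctx] B(17,18) by (auto simp: flatdiag_def)
  ultimately have c': "codes D' ?M" using lab' codesI by blast
  have "r2 Flat D D'" unfolding r2_iff using mv by blast
  then have "flat_equiv D D'" using fD fD' by (intro flat_equiv_step) (simp add: flat_step_def rmove_def)
  then show ?thesis by (intro val_move[OF c' D]) (rule flat_equiv_sym)
qed

text \<open>The words tell the slots from which the triangle is to be read, and their common letters
  are its sides. The outer letters differ from each other by hypothesis and from \<open>m1\<close>,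
  \<open>m2\<close>, \<open>m3\<close> by counting; each therefore occurs once at the triangle and
  its edge leaves the triangle, as \<open>r3\<close> demands.\<close>

lemma val_tri:
  assumes M: "wfc (add_mset (fl m3 m1 p4 p5) (add_mset (fl m1 m2 p2 p3) (add_mset (fl m2 m3 p6 p1) N)))"
    and dist: "distinct [p1, p2, p3, p4, p5, p6]"
  shows "veq (val (add_mset (fl m3 m1 p4 p5) (add_mset (fl m1 m2 p2 p3) (add_mset (fl m2 m3 p6 p1) N))) j)
     (val (add_mset (fl p1 p2 m3 m1) (add_mset (fl p5 p6 m1 m2) (add_mset (fl p3 p4 m2 m3) N))) j)"
proof -
  let ?M = "add_mset (fl m3 m1 p4 p5) (add_mset (fl m1 m2 p2 p3) (add_mset (fl m2 m3 p6 p1) N))"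
  let ?M' = "add_mset (fl p1 p2 m3 m1) (add_mset (fl p5 p6 m1 m2) (add_mset (fl p3 p4 m2 m3) N))"
  have cnt: "count (lb ?M) l = of_bool (p1 = l) + of_bool (p2 = l) + of_bool (p3 = l) + of_bool (p4 = l) + of_bool (p5 = l) + of_bool (p6 = l)
     + 2 * of_bool (m1 = l) + 2 * of_bool (m2 = l) + 2 * of_bool (m3 = l) + count (lb N) l" for l
    by (simp only: lb_simps lbv_vert mset.simps count_add_of_bool count_empty count_union; linarith)
  have P0: "of_bool (p1 = l) + of_bool (p2 = l) + of_bool (p3 = l) + of_bool (p4 = l) + of_bool (p5 = l) + of_bool (p6 = l) = (0::nat)"
    if "of_bool (m1 = l) + of_bool (m2 = l) + of_bool (m3 = l) \<ge> (1::nat)" for l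
    using wfc_count[OF M, of l] cnt[of l] that by linarith
  have pm: "p1 \<noteq> m1" "p1 \<noteq> m2" "p1 \<noteq> m3" "p2 \<noteq> m1" "p2 \<noteq> m2" "p2 \<noteq> m3" "p3 \<noteq> m1" "p3 \<noteq> m2" "p3 \<noteq> m3"
    "p4 \<noteq> m1" "p4 \<noteq> m2" "p4 \<noteq> m3" "p5 \<noteq> m1" "p5 \<noteq> m2" "p5 \<noteq> m3" "p6 \<noteq> m1" "p6 \<noteq> m2" "p6 \<noteq> m3"
    using P0[of m1] P0[of m2] P0[of m3] by simp_all
  obtain D where D: "codes D ?M" using wfc_realizable M by blast
  then obtain e where e: "lab D e" "code D e (nodes D) = ?M" and fD: "flatdiag D" by (auto simp: codes_def)
  have wf: "pd_wf D" using e by (simp add: lab_def)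
  then have fin: "finite (nodes D)" by (simp add: pd_wf_def)
  obtain x where x: "x \<in> nodes D" "vert (vl D e x) = fl m3 m1 p4 p5"
    and N1: "code D e (nodes D - {x}) = add_mset (fl m1 m2 p2 p3) (add_mset (fl m2 m3 p6 p1) N)" using code_extract[OF fin e(2)] by blast
  obtain y where y: "y \<in> nodes D - {x}" "vert (vl D e y) = fl m1 m2 p2 p3"
    and N2: "code D e (nodes D - {x} - {y}) = add_mset (fl m2 m3 p6 p1) N" using code_extract[OF _ N1] fin by blast
  obtain z where z: "z \<in> nodes D - {x} - {y}" "vert (vl D e z) = fl m2 m3 p6 p1"
    and N3: "code D e (nodes D - {x} - {y} - {z}) = N" using code_extract[OF _ N2] fin by blast
  have Deq: "nodes D - {x} - {y} - {z} = nodes D - {x, y, z}" by auto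
  obtain a where a: "a < 4" "row e x a = [m3, m1, p4, p5]" "kind D x \<noteq> Bead" using vert_rowE[OF x(2)] .
  obtain b where b: "b < 4" "row e y b = [m1, m2, p2, p3]" "kind D y \<noteq> Bead" using vert_rowE[OF y(2)] .
  obtain c where c: "c < 4" "row e z c = [m2, m3, p6, p1]" "kind D z \<noteq> Bead" using vert_rowE[OF z(2)] .
  note ra = a(2)[unfolded row_def list.inject] and rb = b(2)[unfolded row_def list.inject] and rc = c(2)[unfolded row_def list.inject]
  have xyz: "x \<in> nodes D" "y \<in> nodes D" "z \<in> nodes D" "x \<noteq> y" "x \<noteq> z" "y \<noteq> z" using x y z by auto
  have dd: "(x, s) \<in> darts D" "(y, s) \<in> darts D" "(z, s) \<in> darts D" if "s < 4" for s
    using that xyz a(3) b(3) c(3) by (simp_all add: dart_cross)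
  have m4: "n mod 4 < 4" for n :: nat by simp
  have link: "nb D (x,(a+1) mod 4) = (y,b)" "nb D (y,(b+1) mod 4) = (z,c)" "nb D (z,(c+1) mod 4) = (x,a)"
    by (rule labD[OF e(1), symmetric]; use dd ra rb rc xyz a(1) b(1) c(1) in simp)+
  have all: "d = (x,a) \<or> d = (x,(a+1) mod 4) \<or> d = (x,(a+2) mod 4) \<or> d = (x,(a+3) mod 4) \<or>
     d = (y,b) \<or> d = (y,(b+1) mod 4) \<or> d = (y,(b+2) mod 4) \<or> d = (y,(b+3) mod 4) \<or>
     d = (z,c) \<or> d = (z,(c+1) mod 4) \<or> d = (z,(c+2) mod 4) \<or> d = (z,(c+3) mod 4)"
    if "d \<in> darts D" "fst d \<in> {x, y, z}" for d
  proof (cases d)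
    case (Pair v s)
    then have "s < 4" using that(1) by (auto simp: darts_def pdeg_def split: if_splits)
    then show ?thesis using that(2) slot_cases[OF _ a(1), of s] slot_cases[OF _ b(1), of s] slot_cases[OF _ c(1), of s]
      unfolding Pair by (simp only: fst_conv prod.inject insert_iff empty_iff) metis
  qed
  have pp: "p1 \<noteq> p2" "p1 \<noteq> p3" "p1 \<noteq> p4" "p1 \<noteq> p5" "p1 \<noteq> p6" "p2 \<noteq> p3" "p2 \<noteq> p4" "p2 \<noteq> p5" "p2 \<noteq> p6"
    "p3 \<noteq> p4" "p3 \<noteq> p5" "p3 \<noteq> p6" "p4 \<noteq> p5" "p4 \<noteq> p6" "p5 \<noteq> p6" using dist by auto
  have uniq: "e w = p1 \<Longrightarrow> w = (z,(c+3) mod 4)" "e w = p2 \<Longrightarrow> w = (y,(b+2) mod 4)" "e w = p3 \<Longrightarrow> w = (y,(b+3) mod 4)"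
    "e w = p4 \<Longrightarrow> w = (x,(a+2) mod 4)" "e w = p5 \<Longrightarrow> w = (x,(a+3) mod 4)" "e w = p6 \<Longrightarrow> w = (z,(c+2) mod 4)"
    if w: "w \<in> darts D" "fst w \<in> {x, y, z}" for w
    using all[OF w] by (elim disjE; simp only: ra rb rc pm pm[symmetric] pp pp[symmetric] simp_thms)+
  have out: "fst (nb D d) \<notin> {x, y, z}" if d: "d \<in> darts D" "\<And>w. w \<in> darts D \<Longrightarrow> fst w \<in> {x, y, z} \<Longrightarrow> e w = e d \<Longrightarrow> w = d" for d
    using lab_nb[OF e(1) d(1)] d(2) by metis
  have o6: "fst (nb D (z,(c+3) mod 4)) \<notin> {x,y,z}" "fst (nb D (y,(b+2) mod 4)) \<notin> {x,y,z}" "fst (nb D (y,(b+3) mod 4)) \<notin> {x,y,z}"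
    "fst (nb D (x,(a+2) mod 4)) \<notin> {x,y,z}" "fst (nb D (x,(a+3) mod 4)) \<notin> {x,y,z}" "fst (nb D (z,(c+2) mod 4)) \<notin> {x,y,z}"
    by (rule out; (simp only: dd m4; fail)?; erule (1) uniq; simp only: ra rb rc)+
  obtain x' where x': "x' \<notin> nodes D" using fin ex_new_if_finite[OF infinite_UNIV_nat] by blast
  obtain y' where y': "y' \<notin> insert x' (nodes D)" using fin ex_new_if_finite[OF infinite_UNIV_nat, of "insert x' (nodes D)"] by blast
  obtain z' where z': "z' \<notin> insert x' (insert y' (nodes D))"
    using fin ex_new_if_finite[OF infinite_UNIV_nat, of "insert x' (insert y' (nodes D))"] by blast
  have flat: "kind D x = Flat" "kind D y = Flat" "kind D z = Flat"
    using xyz(1-3) fD a(3) b(3) c(3) unfolding flatdiag_def by (metis nkind.exhaust)+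
  define D' where "D' = \<lparr>nodes = {x',y',z'} \<union> (nodes D - {x,y,z}), kind = (kind D)(x' := Flat, y' := Flat, z' := Flat),
           nb = lnks [((x',a), nb D (z,(c+3) mod 4)), ((x',(a+1) mod 4), nb D (y,(b+2) mod 4)),
             ((x',(a+2) mod 4), (z',(c+3) mod 4)), ((x',(a+3) mod 4), (y',(b+2) mod 4)),
             ((z',c), nb D (y,(b+3) mod 4)), ((z',(c+1) mod 4), nb D (x,(a+2) mod 4)),
             ((z',(c+2) mod 4), (y',(b+3) mod 4)), ((y',b), nb D (x,(a+3) mod 4)),
             ((y',(b+1) mod 4), nb D (z,(c+2) mod 4))] (nb D)\<rparr>"
  have mv: "tri_move Flat D D' x y z a b c x' y' z'"
    unfolding tri_move_def
  proof (intro conjI)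
    show "fst ` {nb D (z,(c+3) mod 4), nb D (y,(b+2) mod 4), nb D (y,(b+3) mod 4),
            nb D (x,(a+2) mod 4), nb D (x,(a+3) mod 4), nb D (z,(c+2) mod 4)} \<inter> {x,y,z} = {}"
      by (simp only: image_insert image_empty Int_insert_left o6 if_False Int_empty_left)
    show "distinct [x,y,z]" "distinct [x',y',z']" using xyz x' y' z' by auto
    show "Flat = Real \<longrightarrow> odd (a + 1) \<and> odd b \<or> odd (b + 1) \<and> odd c \<or> odd (c + 1) \<and> odd a" by simp
    show "x' \<notin> nodes D" "y' \<notin> nodes D" "z' \<notin> nodes D" using x' y' z' by auto
  qed (fact xyz flat a(1) b(1) c(1) link D'_def)+
  have ne: "Flat \<noteq> Bead" by simp
  note ctx = mv wf ne
  let ?e = "tri_label x y z a b c x' y' z' e"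
  have lab': "lab D' ?e" by (rule tri_lab[OF ctx e(1)])
  note B = tri_basic[OF ctx] and R4 = tri_label_row(4)[OF ctx, where e = e]
  have R: "row ?e x' a = [p1, p2, m3, m1]" "row ?e y' b = [p5, p6, m1, m2]" "row ?e z' c = [p3, p4, m2, m3]"
    unfolding tri_label_row(1)[OF ctx, where e = e] tri_label_row(2)[OF ctx, where e = e] tri_label_row(3)[OF ctx, where e = e] list.inject
    using ra rb rc by blast+
  have kd: "kind D' x' \<noteq> Bead" "kind D' y' \<noteq> Bead" "kind D' z' \<noteq> Bead" by (simp_all add: B(19))
  have "code D' ?e (nodes D') = ?M'"
  proof -
    have "vert (vl D' ?e x') = fl p1 p2 m3 m1" "vert (vl D' ?e y') = fl p5 p6 m1 m2" "vert (vl D' ?e z') = fl p3 p4 m2 m3"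
      using vert_row[OF kd(1) a(1), of ?e] vert_row[OF kd(2) b(1), of ?e] vert_row[OF kd(3) c(1), of ?e] by (simp_all only: R)
    moreover have "nodes D' = insert x' (insert y' (insert z' (nodes D - {x, y, z})))" using B(18) by simp
    moreover have "code D' ?e (nodes D - {x, y, z}) = N" using tri_code[OF ctx, of "nodes D - {x, y, z}" ?e e] R4 N3 Deq by simp
    ultimately show ?thesis using x' y' z' fin by simp
  qed
  moreover have fD': "flatdiag D'"
    using fD tri_wf[OF ctx] B(18,19) by (auto simp: flatdiag_def)
  ultimately have c': "codes D' ?M'" using lab' codesI by blast
  have "r3 Flat D D'" unfolding r3_iff using mv by blast
  then have "flat_equiv D D'" using fD fD' by (intro flat_equiv_step) (simp add: flat_step_def rmove_def)
  then show ?thesis by (rule val_move[OF D c'])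
qed

section \<open>The bracket of a code\<close>

text \<open>Well-formedness is passed on together with the value, so that local rules compose
  without checking it again. All exponents \<open>j\<close> are allowed because these rules involve
  no power of A.\<close>

definition red :: "nat list set multiset \<Rightarrow> nat list set multiset \<Rightarrow> bool" where
  "red M M' \<longleftrightarrow> (wfc M \<longrightarrow> wfc M' \<and> (\<forall>j. veq (val M j) (val M' j)))"

lemma red_trans: "red M M' \<Longrightarrow> red M' M'' \<Longrightarrow> red M M''"
  unfolding red_def using veq_trans by blast

text \<open>Letters disappear in pairs, and in a well-formed code such a pair was the whole
  count.\<close>

lemma wfc_mono:
  assumes "wfc M" "\<forall>X\<in>#M'. node_shape X" "\<And>l. count (lb M) l = count (lb M') l + 2 * k l"
  shows "wfc M'"
proof -
  have "count (lb M') l = 0 \<or> count (lb M') l = 2" for l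
    using wfc_count[OF assms(1), of l] assms(3)[of l] by (cases "k l") auto
  then show ?thesis using assms(2) by (simp add: wfc_def)
qed

lemma red_chain: "red (add_mset (bd a b) (add_mset (bd b c) R)) (add_mset (bd a c) R)"
  unfolding red_def
proof (intro impI conjI allI)
  assume w: "wfc (add_mset (bd a b) (add_mset (bd b c) R))"
  show "veq (val (add_mset (bd a b) (add_mset (bd b c) R)) j) (val (add_mset (bd a c) R) j)" for j
    using val_chain[OF w] .
  show "wfc (add_mset (bd a c) R)"
  proof (rule wfc_mono[OF w, where k = "\<lambda>l. of_bool (b = l)"])
    show "\<forall>X\<in>#add_mset (bd a c) R. node_shape X" using w by (simp add: wfc_def)
  qed (simp only: lb_simps lbv_vert mset.simps count_add_of_bool count_empty count_union; linarith)
qed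

lemma red_chain3: "red (add_mset (bd a b) (add_mset (bd b c) (add_mset (bd c d) R))) (add_mset (bd a d) R)"
  by (rule red_trans[OF red_chain red_chain])

lemma red_chain4: "red (add_mset (bd a b) (add_mset (bd b c) (add_mset (bd c d) (add_mset (bd d e) R)))) (add_mset (bd a e) R)"
  by (rule red_trans[OF red_chain red_chain3])

lemma red_absorb: "red (add_mset (bd a b) (add_mset (fl b c d e) R)) (add_mset (fl a c d e) R)"
  unfolding red_def
proof (intro impI conjI allI)
  assume w: "wfc (add_mset (bd a b) (add_mset (fl b c d e) R))"
  show "veq (val (add_mset (bd a b) (add_mset (fl b c d e) R)) j) (val (add_mset (fl a c d e) R) j)" for j
    using val_absorb[OF w] .
  show "wfc (add_mset (fl a c d e) R)"
  proof (rule wfc_mono[OF w, where k = "\<lambda>l. of_bool (b = l)"])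
    show "\<forall>X\<in>#add_mset (fl a c d e) R. node_shape X" using w by (simp add: wfc_def)
  qed (simp only: lb_simps lbv_vert mset.simps count_add_of_bool count_empty count_union; linarith)
qed

lemma red_bigon:
  assumes "distinct [p1, q1, p2, q2]"
  shows "red (add_mset (fl u v p1 p2) (add_mset (fl v u q2 q1) R)) (add_mset (bd p1 q1) (add_mset (bd p2 q2) R))"
  unfolding red_def
proof (intro impI conjI allI)
  assume w: "wfc (add_mset (fl u v p1 p2) (add_mset (fl v u q2 q1) R))"
  show "veq (val (add_mset (fl u v p1 p2) (add_mset (fl v u q2 q1) R)) j) (val (add_mset (bd p1 q1) (add_mset (bd p2 q2) R)) j)" for j
    using val_bigon[OF w assms] .
  show "wfc (add_mset (bd p1 q1) (add_mset (bd p2 q2) R))"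
  proof (rule wfc_mono[OF w, where k = "\<lambda>l. of_bool (u = l) + of_bool (v = l)"])
    show "\<forall>X\<in>#add_mset (bd p1 q1) (add_mset (bd p2 q2) R). node_shape X" using w by (simp add: wfc_def)
  qed (simp only: lb_simps lbv_vert mset.simps count_add_of_bool count_empty count_union distrib_left; linarith)
qed

section \<open>Smoothings, states and the skein relation\<close>

definition smA :: "(dart \<Rightarrow> nat) \<Rightarrow> nat \<Rightarrow> nat list set multiset" where
  "smA e c = {#bd (e (c,0)) (e (c,1)), bd (e (c,2)) (e (c,3))#}"

definition smB :: "(dart \<Rightarrow> nat) \<Rightarrow> nat \<Rightarrow> nat list set multiset" where
  "smB e c = {#bd (e (c,1)) (e (c,2)), bd (e (c,3)) (e (c,0))#}"

text \<open>\<open>N\<close> is the code of everything that stays; only the crossings of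
  \<open>C\<close> are read off from \<open>e\<close>, and each contributes two beads.\<close>

definition state :: "nat list set multiset \<Rightarrow> (dart \<Rightarrow> nat) \<Rightarrow> nat set \<Rightarrow> nat set \<Rightarrow> nat list set multiset" where
  "state N e C T = N + (\<Sum>c\<in>T. smA e c) + (\<Sum>c\<in>C - T. smB e c)"

text \<open>Since A is t^(-1/4), an A-smoothing lowers the exponent by one and a B-smoothing raises
  it by one. The offset \<open>j\<close> is set to 3w in the end, the exponent of A^(-3w).\<close>

definition br :: "nat list set multiset \<Rightarrow> (dart \<Rightarrow> nat) \<Rightarrow> nat set \<Rightarrow> int \<Rightarrow> pd \<times> int \<Rightarrow> int" where
  "br N e C j = (\<lambda>x. \<Sum>T\<in>Pow C. val (state N e C T) (j - int (card T) + int (card (C - T))) x)"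

text \<open>Either smoothing of a crossing uses each of its four letters once, so this one
  condition, with the crossings in place, makes all states well formed; see
  \<open>wfm_state\<close>.\<close>

definition wfm :: "nat list set multiset \<Rightarrow> (dart \<Rightarrow> nat) \<Rightarrow> nat set \<Rightarrow> bool" where
  "wfm N e C \<longleftrightarrow> wfc (N + (\<Sum>c\<in>C. {#vert (row e c 0)#}))"

lemma lb_sum: "finite A \<Longrightarrow> lb (\<Sum>a\<in>A. f a) = (\<Sum>a\<in>A. lb (f a))"
  by (induction A rule: finite_induct) simp_all

lemma lb_sm: "lb (smA e c) = mset (row e c 0)" "lb (smB e c) = mset (row e c 0)"
  by (simp_all add: smA_def smB_def row_simps add_mset_commute)

lemma lb_state:
  assumes "finite C" "T \<subseteq> C"
  shows "lb (state N e C T) = lb (N + (\<Sum>c\<in>C. {#vert (row e c 0)#}))"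
proof -
  have "finite T" "finite (C - T)" using assms finite_subset by auto
  then have "lb (state N e C T) = lb N + ((\<Sum>c\<in>T. mset (row e c 0)) + (\<Sum>c\<in>C - T. mset (row e c 0)))"
    by (simp add: state_def lb_sum lb_sm add.assoc)
  also have "\<dots> = lb N + (\<Sum>c\<in>C. mset (row e c 0))"
    using sum.subset_diff[OF assms(2,1), of "\<lambda>c. mset (row e c 0)"] by (simp add: add.commute)
  finally show ?thesis using assms(1) by (simp add: lb_sum)
qed

lemma shape_state:
  assumes "finite C" "T \<subseteq> C" "\<forall>X\<in>#N. node_shape X"
  shows "\<forall>X\<in>#state N e C T. node_shape X"
proof -
  have "finite T" "finite (C - T)" using assms finite_subset by auto
  then show ?thesis using assms(3) by (auto simp: state_def smA_def smB_def set_mset_sum)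
qed

lemma wfm_state: "finite C \<Longrightarrow> T \<subseteq> C \<Longrightarrow> wfm N e C \<Longrightarrow> wfc (state N e C T)"
  using shape_state[of C T N e] lb_state[of C T N e] unfolding wfm_def wfc_def by auto

text \<open>The skein relation. The states split according to the smoothing of \<open>x\<close>,
  whose two beads then count as part of what stays. Repeated use reduces an identity of brackets to
  rules for a few words.\<close>

lemma br_insert:
  assumes "finite C" "x \<notin> C"
  shows "br N e (insert x C) j = (\<lambda>t. br (N + smA e x) e C (j - 1) t + br (N + smB e x) e C (j + 1) t)"
proof
  fix t
  let ?f = "\<lambda>T. val (state N e (insert x C) T) (j - int (card T) + int (card (insert x C - T))) t"
  have disj: "Pow C \<inter> insert x ` Pow C = {}" using assms(2) by auto
  have inj: "inj_on (insert x) (Pow C)" using assms(2) by (auto simp: inj_on_def)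
  have "br N e (insert x C) j t = sum ?f (Pow C) + sum ?f (insert x ` Pow C)"
    unfolding br_def Pow_insert using assms(1) disj by (subst sum.union_disjoint) auto
  also have "sum ?f (insert x ` Pow C) = (\<Sum>T\<in>Pow C. ?f (insert x T))"
    using sum.reindex[OF inj, of ?f] by (simp add: comp_def)
  also have "\<dots> = br (N + smA e x) e C (j - 1) t"
    unfolding br_def
  proof (rule sum.cong[OF refl])
    fix T assume "T \<in> Pow C"
    then have T: "finite T" "x \<notin> T" "insert x C - insert x T = C - T" using assms finite_subset by auto
    have "state N e (insert x C) (insert x T) = state (N + smA e x) e C T"
      unfolding state_def T(3) using T(1,2) by (simp add: ac_simps)
    then show "?f (insert x T) = val (state (N + smA e x) e C T) (j - 1 - int (card T) + int (card (C - T))) t"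
      using T by (simp add: algebra_simps)
  qed
  also have "sum ?f (Pow C) = br (N + smB e x) e C (j + 1) t"
    unfolding br_def
  proof (rule sum.cong[OF refl])
    fix T assume "T \<in> Pow C"
    then have T: "finite (C - T)" "x \<notin> C - T" "insert x C - T = insert x (C - T)" using assms finite_subset by auto
    have "state N e (insert x C) T = state (N + smB e x) e C T"
      unfolding state_def T(3) using T(1,2) by (simp add: ac_simps)
    then show "?f T = val (state (N + smB e x) e C T) (j + 1 - int (card T) + int (card (C - T))) t"
      using T by (simp add: algebra_simps)
  qed
  finally show "br N e (insert x C) j t = br (N + smA e x) e C (j - 1) t + br (N + smB e x) e C (j + 1) t" by simp
qed

lemma wfm_insert:
  assumes "finite C" "x \<notin> C" "wfm N e (insert x C)"
  shows "wfm (N + smA e x) e C" "wfm (N + smB e x) e C"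
  using assms by (auto simp: wfm_def wfc_def lb_sm smA_def smB_def lb_sum row_simps add_mset_commute ac_simps)

lemma br_cong:
  assumes "\<And>c. c \<in> C \<Longrightarrow> row e c 0 = row e' c 0"
  shows "br N e C j = br N e' C j"
proof -
  have "smA e c = smA e' c" "smB e c = smB e' c" if "c \<in> C" for c
    using assms[OF that] by (simp_all add: row_simps smA_def smB_def)
  then have "state N e C T = state N e' C T" if "T \<in> Pow C" for T
    using that by (auto simp: state_def intro!: arg_cong2[of _ _ _ _ "(+)"] sum.cong)
  then show ?thesis unfolding br_def by (intro ext sum.cong) auto
qed

lemma state_add: "state (N + L) e C T = state N e C T + L" "state (add_mset X N) e C T = add_mset X (state N e C T)"
  by (simp_all add: state_def ac_simps)

text \<open>A rule that holds next to every code \<open>M\<close> applies inside each state,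
  whatever the other smoothings are.\<close>

lemma br_red:
  assumes "finite C" "wfm (N + L) e C" "\<And>M. red (M + L) (M + L')"
  shows "veq (br (N + L) e C j) (br (N + L') e C j)"
  unfolding br_def
proof (rule veq_sum)
  fix T assume "T \<in> Pow C"
  then have "wfc (state (N + L) e C T)" using wfm_state assms by auto
  then show "veq (val (state (N + L) e C T) (j - int (card T) + int (card (C - T))))
      (val (state (N + L') e C T) (j - int (card T) + int (card (C - T))))"
    using assms(3)[of "state N e C T"] unfolding state_add red_def by blast
qed

lemma br_circle:
  assumes "finite C" "wfm (add_mset (bd a a) N) e C"
  shows "veq (br (add_mset (bd a a) N) e C j) (\<lambda>x. - br N e C (j + 2) x - br N e C (j - 2) x)"
proof -
  have "veq (br (add_mset (bd a a) N) e C j) (\<lambda>x. \<Sum>T\<in>Pow C. - val (state N e C T) (j - int (card T) + int (card (C - T)) + 2) x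
      - val (state N e C T) (j - int (card T) + int (card (C - T)) - 2) x)"
    unfolding br_def
  proof (rule veq_sum)
    fix T assume "T \<in> Pow C"
    then have "wfc (state (add_mset (bd a a) N) e C T)" using wfm_state assms by auto
    then show "veq (val (state (add_mset (bd a a) N) e C T) (j - int (card T) + int (card (C - T))))
       (\<lambda>x. - val (state N e C T) (j - int (card T) + int (card (C - T)) + 2) x
      - val (state N e C T) (j - int (card T) + int (card (C - T)) - 2) x)"
      unfolding state_add by (rule val_circle)
  qed
  also have "(\<lambda>x. \<Sum>T\<in>Pow C. - val (state N e C T) (j - int (card T) + int (card (C - T)) + 2) x
      - val (state N e C T) (j - int (card T) + int (card (C - T)) - 2) x) = (\<lambda>x. - br N e C (j + 2) x - br N e C (j - 2) x)"
    by (simp add: br_def sum_subtractf sum_negf algebra_simps)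
  finally show ?thesis .
qed

lemma ren_state: "finite C \<Longrightarrow> T \<subseteq> C \<Longrightarrow> ren f (state N e C T) = state (ren f N) (\<lambda>d. f (e d)) C T"
proof -
  assume C: "finite C" "T \<subseteq> C"
  have s: "ren f (\<Sum>c\<in>A. g c) = (\<Sum>c\<in>A. ren f (g c))" if "finite A" for A :: "nat set" and g
    using that by (induction A rule: finite_induct) simp_all
  have "finite T" "finite (C - T)" using C finite_subset by auto
  then show ?thesis by (simp add: state_def s smA_def smB_def)
qed

text \<open>The edge at the bead may end at a smoothed crossing, so the renaming acts on the
  labelling \<open>e\<close> as well as on \<open>N\<close>.\<close>

lemma br_bead:
  assumes "finite C" "wfm (add_mset (bd a b) N) e C" "a \<noteq> b"
  shows "veq (br (add_mset (bd a b) N) e C j) (br (ren (id(b := a)) N) (\<lambda>d. (id(b := a)) (e d)) C j)"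
  unfolding br_def
proof (rule veq_sum)
  fix T assume "T \<in> Pow C"
  then have T: "T \<subseteq> C" by simp
  have "wfc (state (add_mset (bd a b) N) e C T)" using wfm_state assms T by auto
  then show "veq (val (state (add_mset (bd a b) N) e C T) (j - int (card T) + int (card (C - T))))
      (val (state (ren (id(b := a)) N) (\<lambda>d. (id(b := a)) (e d)) C T) (j - int (card T) + int (card (C - T))))"
    unfolding state_add ren_state[OF assms(1) T, symmetric] using val_bead assms(3) by blast
qed

text \<open>The A-smoothing joins slots 0,1 and 2,3. Read from an even slot it joins the first two
  letters, read from an odd slot the middle two. The parity of the starting slot is how over and
  under enter the bracket.\<close>

lemma sm_row:
  assumes "row e x i = [p, q, r, s]" "i < 4"
  shows "even i \<Longrightarrow> smA e x = {#bd p q, bd r s#} \<and> smB e x = {#bd q r, bd s p#}"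
    and "odd i \<Longrightarrow> smB e x = {#bd p q, bd r s#} \<and> smA e x = {#bd q r, bd s p#}"
proof -
  have i: "i = 0 \<or> i = Suc 0 \<or> i = 2 \<or> i = 3" using assms(2) by auto
  show "even i \<Longrightarrow> smA e x = {#bd p q, bd r s#} \<and> smB e x = {#bd q r, bd s p#}"
    using assms(1) i by (elim disjE) (auto simp: row_simps smA_def smB_def add_mset_commute)
  show "odd i \<Longrightarrow> smB e x = {#bd p q, bd r s#} \<and> smA e x = {#bd q r, bd s p#}"
    using assms(1) i by (elim disjE) (auto simp: row_simps smA_def smB_def add_mset_commute)
qed

lemma row_shift:
  assumes "row e x i = [p, q, r, s]" "i < 4"
  shows "row e x ((i + 2) mod 4) = [r, s, p, q]"
proof -
  have i: "i = 0 \<or> i = Suc 0 \<or> i = 2 \<or> i = 3" using assms(2) by auto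
  have "(0 + 2) mod 4 = (2::nat)" "(Suc 0 + 2) mod 4 = (3::nat)" "(2 + 2) mod 4 = (0::nat)" "(3 + 2) mod 4 = Suc 0" by simp_all
  then show ?thesis using assms(1) i by (elim disjE) (simp_all only: row_simps list.inject simp_thms)
qed

lemma red_chain22:
  "red (add_mset (bd a b) (add_mset (bd b c) (add_mset (bd a' b') (add_mset (bd b' c') R)))) (add_mset (bd a c) (add_mset (bd a' c') R))"
proof (rule red_trans[OF red_chain])
  show "red (add_mset (bd a c) (add_mset (bd a' b') (add_mset (bd b' c') R))) (add_mset (bd a c) (add_mset (bd a' c') R))"
    using red_chain[of a' b' c' "add_mset (bd a c) R"] by (simp add: add_mset_commute)
qed

lemma red_chain23:
  "red (add_mset (bd a b) (add_mset (bd b c) (add_mset (bd a' b') (add_mset (bd b' c') (add_mset (bd c' d') R)))))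
     (add_mset (bd a c) (add_mset (bd a' d') R))"
proof (rule red_trans[OF red_chain])
  show "red (add_mset (bd a c) (add_mset (bd a' b') (add_mset (bd b' c') (add_mset (bd c' d') R)))) (add_mset (bd a c) (add_mset (bd a' d') R))"
    using red_chain3[of a' b' c' d' "add_mset (bd a c) R"] by (simp add: add_mset_commute)
qed

lemma red_chain222:
  "red (add_mset (bd a b) (add_mset (bd b c) (add_mset (bd a' b') (add_mset (bd b' c') (add_mset (bd a'' b'') (add_mset (bd b'' c'') R))))))
     (add_mset (bd a c) (add_mset (bd a' c') (add_mset (bd a'' c'') R)))"
proof (rule red_trans[OF red_chain])
  show "red (add_mset (bd a c) (add_mset (bd a' b') (add_mset (bd b' c') (add_mset (bd a'' b'') (add_mset (bd b'' c'') R)))))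
     (add_mset (bd a c) (add_mset (bd a' c') (add_mset (bd a'' c'') R)))"
    using red_chain22[of a' b' c' a'' b'' c'' "add_mset (bd a c) R"] by (simp add: add_mset_commute)
qed

text \<open>One smoothing cuts off the loop \<open>u\<close> as a circle, the other merges it into
  the strand. For even \<open>i\<close> the weights add up to A (-A^2 - A^(-2)) + A^(-1) = -A^3, for
  odd \<open>i\<close> to -A^(-3).\<close>

lemma br_kink:
  assumes C: "finite C" "x \<notin> C" and i: "i < 4" and row: "row e x i = [u, u, p, q]" and w: "wfm N e (insert x C)"
  shows "veq (br N e (insert x C) j) (\<lambda>t. - br (add_mset (bd p q) N) e C (if even i then j - 3 else j + 3) t)"
proof -
  let ?X0 = "{#bd u u, bd p q#}" and ?X1 = "{#bd u p, bd q u#}"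
  have w': "wfm (N + smA e x) e C" "wfm (N + smB e x) e C" using wfm_insert[OF C w] .
  have 0: "veq (br (N + ?X0) e C k) (\<lambda>t. - br (add_mset (bd p q) N) e C (k + 2) t - br (add_mset (bd p q) N) e C (k - 2) t)"
    if "wfm (N + ?X0) e C" for k
    using br_circle[OF C(1), of u "add_mset (bd p q) N" e k] that by simp
  have 1: "veq (br (N + ?X1) e C k) (br (add_mset (bd p q) N) e C k)" if "wfm (N + ?X1) e C" for k
  proof -
    have "veq (br (N + ?X1) e C k) (br (N + {#bd p q#}) e C k)"
    proof (rule br_red[OF C(1) that])
      fix M show "red (M + ?X1) (M + {#bd p q#})"
        using red_chain[of q u p M] by (simp add: bd_commute add_mset_commute)
    qed
    then show ?thesis by simp
  qed
  show ?thesis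
  proof (cases "even i")
    case True
    then have s: "smA e x = ?X0" "smB e x = ?X1" using sm_row[OF row i] by auto
    have "veq (\<lambda>t. br (N + ?X0) e C (j - 1) t + br (N + ?X1) e C (j + 1) t)
       (\<lambda>t. (- br (add_mset (bd p q) N) e C (j - 1 + 2) t - br (add_mset (bd p q) N) e C (j - 1 - 2) t) + br (add_mset (bd p q) N) e C (j + 1) t)"
      using w' unfolding s by (intro veq_add 0 1)
    then show ?thesis using True by (simp add: br_insert[OF C] s algebra_simps)
  next
    case False
    then have s: "smB e x = ?X0" "smA e x = ?X1" using sm_row[OF row i] by auto
    have "veq (\<lambda>t. br (N + ?X1) e C (j - 1) t + br (N + ?X0) e C (j + 1) t)
       (\<lambda>t. br (add_mset (bd p q) N) e C (j - 1) t + (- br (add_mset (bd p q) N) e C (j + 1 + 2) t - br (add_mset (bd p q) N) e C (j + 1 - 2) t))"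
      using w' unfolding s by (intro veq_add 0 1)
    then show ?thesis using False by (simp add: br_insert[OF C] s algebra_simps)
  qed
qed

text \<open>The bead on one side of the bigon is what remains of a third crossing.\<close>

lemma br_bigon_bead:
  assumes C: "finite C" "x \<notin> C" "y \<notin> C" "x \<noteq> y" and ij: "i < 4" "j < 4" "odd (i + j)"
    and row: "row e x i = [u, v, p1, p2]" "row e y j = [v, u', q2, q1]"
    and w: "wfm N e (insert x (insert y C))"
    and N: "N = N0 \<and> u' = u \<or> N = add_mset (bd u u') N0"
  shows "veq (br N e (insert x (insert y C)) k) (br (add_mset (bd p1 q1) (add_mset (bd p2 q2) N0)) e C k)"
proof -
  let ?X0 = "{#bd u v, bd p1 p2#}" and ?X1 = "{#bd v p1, bd p2 u#}"
  let ?Y0 = "{#bd v u', bd q2 q1#}" and ?Y1 = "{#bd u' q2, bd q1 v#}"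
  \<comment> \<open>In \<open>?I\<close> both strands pass along the bigon, in \<open>?H\<close>
    they turn back on either side of it.\<close>
  let ?I = "add_mset (bd p1 q1) (add_mset (bd p2 q2) N0)" and ?H = "add_mset (bd p1 p2) (add_mset (bd q1 q2) N0)"
  \<comment> \<open>Either there is no bead and \<open>u'\<close> is \<open>u\<close>, or a bead
    joins the two labels; \<open>B\<close> treats both cases at once.\<close>
  define B where "B = (if N = N0 \<and> u' = u then {#} else {#bd u u'#})"
  have NB: "N = N0 + B" using N by (auto simp: B_def)
  have B: "B = {#} \<and> u' = u \<or> B = {#bd u u'#}" using N by (auto simp: B_def)
  have r01: "red (M + (B + ?X0 + ?Y1)) (M + {#bd p1 p2, bd q1 q2#})" for M
    using B red_chain3[of q1 v u q2 "add_mset (bd p1 p2) M"] red_chain4[of q1 v u u' q2 "add_mset (bd p1 p2) M"]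
    by (auto simp: bd_commute add_mset_commute)
  have r10: "red (M + (B + ?X1 + ?Y0)) (M + {#bd p1 p2, bd q1 q2#})" for M
    using B red_chain3[of p2 u v p1 "add_mset (bd q1 q2) M"] red_chain4[of p2 u u' v p1 "add_mset (bd q1 q2) M"]
    by (auto simp: bd_commute add_mset_commute)
  have r11: "red (M + (B + ?X1 + ?Y1)) (M + {#bd p1 q1, bd p2 q2#})" for M
    using B red_chain22[of p1 v q1 p2 u q2 M] red_chain23[of p1 v q1 p2 u u' q2 M]
    by (auto simp: bd_commute add_mset_commute)
  have r00: "red (M + (B + ?X0 + ?Y0)) (M + {#bd u u, bd p1 p2, bd q1 q2#})" for M
    using B red_chain[of u v u "add_mset (bd p1 p2) (add_mset (bd q1 q2) M)"] red_chain3[of u v u' u "add_mset (bd p1 p2) (add_mset (bd q1 q2) M)"]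
    by (auto simp: bd_commute add_mset_commute)
  have fin: "finite (insert y C)" "x \<notin> insert y C" using C by auto
  have ins: "br N e (insert x (insert y C)) k = (\<lambda>t.
      (br (N + smA e x + smA e y) e C (k - 2) t + br (N + smA e x + smB e y) e C k t) +
      (br (N + smB e x + smA e y) e C k t + br (N + smB e x + smB e y) e C (k + 2) t))"
    unfolding br_insert[OF fin] br_insert[OF C(1,3)] by (simp add: algebra_simps)
  note wx = wfm_insert[OF fin w]
  note wxy = wfm_insert[OF C(1,3) wx(1)] wfm_insert[OF C(1,3) wx(2)]
  have R: "veq (br (N + X + Y) e C l) (br (N0 + L) e C l)" if "wfm (N + X + Y) e C" "\<And>M. red (M + (B + X + Y)) (M + L)" for X Y L l
    using br_red[OF C(1), of N0 "B + X + Y" e L l] that unfolding NB by (simp add: ac_simps)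
  have a01: "veq (br (N + ?X0 + ?Y1) e C l) (br ?H e C l)" if "wfm (N + ?X0 + ?Y1) e C" for l using R[OF that r01] by simp
  have a10: "veq (br (N + ?X1 + ?Y0) e C l) (br ?H e C l)" if "wfm (N + ?X1 + ?Y0) e C" for l using R[OF that r10] by simp
  have a11: "veq (br (N + ?X1 + ?Y1) e C l) (br ?I e C l)" if "wfm (N + ?X1 + ?Y1) e C" for l using R[OF that r11] by simp
  \<comment> \<open>These smoothings cut the inside of the bigon off as a circle next to
    \<open>?H\<close>.\<close>
  have a00: "veq (br (N + ?X0 + ?Y0) e C l) (\<lambda>t. - br ?H e C (l + 2) t - br ?H e C (l - 2) t)" if "wfm (N + ?X0 + ?Y0) e C" for l
  proof -
    have "wfm (add_mset (bd u u) ?H) e C"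
    proof -
      have "wfc (M + {#bd u u, bd p1 p2, bd q1 q2#})" if "wfc (M + (B + ?X0 + ?Y0))" for M using r00[of M] that unfolding red_def by blast
      from this[of "N0 + (\<Sum>c\<in>C. {#vert (row e c 0)#})"] that show ?thesis unfolding wfm_def NB by (simp add: ac_simps add_mset_commute)
    qed
    then have "veq (br (add_mset (bd u u) ?H) e C l) (\<lambda>t. - br ?H e C (l + 2) t - br ?H e C (l - 2) t)"
      by (rule br_circle[OF C(1)])
    moreover have "veq (br (N + ?X0 + ?Y0) e C l) (br (add_mset (bd u u) ?H) e C l)" using R[OF that r00] by simp
    ultimately show ?thesis using veq_trans by blast
  qed
  \<comment> \<open>Three of the four states give \<open>?H\<close>, with weights A^2, A^(-2) and
    -A^2 - A^(-2), which cancel. The state \<open>?I\<close> has one smoothing of each kind, because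
    \<open>i + j\<close> is odd, and so has weight 1.\<close>
  show ?thesis
  proof (cases "even i")
    case True
    then have "odd j" using ij by simp
    then have s: "smA e x = ?X0" "smB e x = ?X1" "smB e y = ?Y0" "smA e y = ?Y1"
      using True sm_row[OF row(1) ij(1)] sm_row[OF row(2) ij(2)] by auto
    have "veq (br N e (insert x (insert y C)) k) (\<lambda>t. (br ?H e C (k - 2) t + (- br ?H e C (k + 2) t - br ?H e C (k - 2) t)) + (br ?I e C k t + br ?H e C (k + 2) t))"
      unfolding ins using wxy unfolding s by (intro veq_add a01 a10 a11 a00)
    then show ?thesis by simp
  next
    case False
    then have "even j" using ij by simp
    then have s: "smB e x = ?X0" "smA e x = ?X1" "smA e y = ?Y0" "smB e y = ?Y1"
      using False sm_row[OF row(1) ij(1)] sm_row[OF row(2) ij(2)] by auto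
    have "veq (br N e (insert x (insert y C)) k) (\<lambda>t. (br ?H e C (k - 2) t + br ?I e C k t) + ((- br ?H e C (k + 2) t - br ?H e C (k - 2) t) + br ?H e C (k + 2) t))"
      unfolding ins using wxy unfolding s by (intro veq_add a01 a10 a11 a00)
    then show ?thesis by simp
  qed
qed

text \<open>By the parity condition, one strand is the over strand, or the under strand, at both \<open>x\<close> and \<open>y\<close>.
  The crossing \<open>z\<close> of the two others is resolved: one of its smoothings leaves a bigon on both sides,
  the other one leaves the same diagram.\<close>

lemma br_tri3:
  assumes C: "finite C" "distinct [x, y, z]" "{x, y, z} \<inter> C = {}" "distinct [x', y', z']" "{x', y', z'} \<inter> C = {}"
    and abc: "a < 4" "b < 4" "c < 4" "odd (a + b)"
    and row: "row e x a = [m3, m1, p4, p5]" "row e y b = [m1, m2, p2, p3]" "row e z c = [m2, m3, p6, p1]"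
    and row': "row e' x' a = [p1, p2, m3, m1]" "row e' y' b = [p5, p6, m1, m2]" "row e' z' c = [p3, p4, m2, m3]"
    and ee: "\<And>v. v \<in> C \<Longrightarrow> row e v 0 = row e' v 0"
    and w: "wfm N e (insert z (insert x (insert y C)))" and w': "wfm N e' (insert z' (insert x' (insert y' C)))"
  shows "veq (br N e (insert z (insert x (insert y C))) k) (br N e' (insert z' (insert x' (insert y' C))) k)"
proof -
  have m4: "(n + 2) mod 4 < 4" for n :: nat by simp
  have xy: "x \<notin> C" "y \<notin> C" "x \<noteq> y" "x' \<notin> C" "y' \<notin> C" "x' \<noteq> y'" using C by auto
  have fz: "finite (insert x (insert y C))" "z \<notin> insert x (insert y C)" "finite (insert x' (insert y' C))" "z' \<notin> insert x' (insert y' C)"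
    using C by auto
  \<comment> \<open>\<open>?G\<close> and \<open>?G'\<close> join the two sides of the triangle at
    the resolved crossing to each other, which leaves a bigon; \<open>?K\<close> and
    \<open>?K'\<close> join each of them to an outer edge.\<close>
  let ?G = "{#bd m2 m3, bd p6 p1#}" and ?G' = "{#bd p3 p4, bd m2 m3#}"
  let ?K = "{#bd m3 p6, bd p1 m2#}" and ?K' = "{#bd p4 m2, bd m3 p3#}"
  have eq: "br M e C l = br M e' C l" for M l by (rule br_cong) (rule ee)
  have alpha: "veq (br (N + ?G) e (insert x (insert y C)) l) (br (N + ?G') e' (insert x' (insert y' C)) l)"
    if u: "wfm (N + ?G) e (insert x (insert y C))" and u': "wfm (N + ?G') e' (insert x' (insert y' C))" for l
  proof -
    have A: "veq (br (N + ?G) e (insert x (insert y C)) l) (br (add_mset (bd p4 p3) (add_mset (bd p5 p2) (N + {#bd p6 p1#}))) e C l)"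
      by (rule br_bigon_bead[OF C(1) xy(1-3) abc(1,2) abc(4) row(1,2) u]) (simp add: bd_commute add_mset_commute)
    \<comment> \<open>The new triangle faces the opposite way, so its sides sit in the slots from
      \<open>a + 2\<close> and \<open>b + 2\<close> on. Shifting both starting slots keeps their sum
      odd.\<close>
    have B: "veq (br (N + ?G') e' (insert x' (insert y' C)) l) (br (add_mset (bd p1 p6) (add_mset (bd p2 p5) (N + {#bd p3 p4#}))) e' C l)"
    proof (rule br_bigon_bead[OF C(1) xy(4-6) m4[of a] m4[of b] _ row_shift[OF row'(1) abc(1)] row_shift[OF row'(2) abc(2)] u'])
      show "odd ((a + 2) mod 4 + (b + 2) mod 4)" using abc(4) by presburger
    qed (simp add: bd_commute add_mset_commute)
    have I: "add_mset (bd p1 p6) (add_mset (bd p2 p5) (N + {#bd p3 p4#})) = add_mset (bd p4 p3) (add_mset (bd p5 p2) (N + {#bd p6 p1#}))"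
      by (simp add: bd_commute add_mset_commute)
    show ?thesis by (rule veq_trans[OF A veq_sym[OF B[unfolded I eq[symmetric]]]])
  qed
  let ?X0 = "{#bd m3 m1, bd p4 p5#}" and ?X1 = "{#bd m1 p4, bd p5 m3#}" and ?Y0 = "{#bd m1 m2, bd p2 p3#}" and ?Y1 = "{#bd m2 p2, bd p3 m1#}"
  let ?X0' = "{#bd p1 p2, bd m3 m1#}" and ?X1' = "{#bd p2 m3, bd m1 p1#}" and ?Y0' = "{#bd p5 p6, bd m1 m2#}" and ?Y1' = "{#bd p6 m1, bd m2 p5#}"
  have s: "(smA e x = ?X0 \<and> smB e x = ?X1 \<and> smA e y = ?Y1 \<and> smB e y = ?Y0 \<and> smA e' x' = ?X0' \<and> smB e' x' = ?X1' \<and> smA e' y' = ?Y1' \<and> smB e' y' = ?Y0')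
    \<or> (smB e x = ?X0 \<and> smA e x = ?X1 \<and> smB e y = ?Y1 \<and> smA e y = ?Y0 \<and> smB e' x' = ?X0' \<and> smA e' x' = ?X1' \<and> smB e' y' = ?Y1' \<and> smA e' y' = ?Y0')"
    using abc(4) sm_row[OF row(1) abc(1)] sm_row[OF row(2) abc(2)] sm_row[OF row'(1) abc(1)] sm_row[OF row'(2) abc(2)]
    by (cases "even a") simp_all
  have P: "veq (br (N + X) e C l) (br (N + X') e' C l)"
    if "wfm (N + X) e C" "wfm (N + X') e' C" "\<And>M. red (M + X) (M + L)" "\<And>M. red (M + X') (M + L)" for X X' L l
  proof -
    have "veq (br (N + X) e C l) (br (N + L) e C l)" by (rule br_red[OF C(1) that(1,3)])
    moreover have "veq (br (N + X') e' C l) (br (N + L) e' C l)" by (rule br_red[OF C(1) that(2,4)])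
    ultimately show ?thesis unfolding eq using veq_trans[OF _ veq_sym] by blast
  qed
  \<comment> \<open>After \<open>?K\<close> and \<open>?K'\<close> the crossing \<open>x\<close>
    corresponds to \<open>y'\<close>, and \<open>y\<close> to \<open>x'\<close>. Under this
    matching, each pair of states reduces to the same three strands; for this reason
    \<open>ins'\<close> names \<open>y'\<close> before \<open>x'\<close>.\<close>
  have q01: "red (M + (?K + ?X0 + ?Y1)) (M + {#bd p4 p5, bd p1 p2, bd p6 p3#})" "red (M + (?K' + ?Y1' + ?X0')) (M + {#bd p4 p5, bd p1 p2, bd p6 p3#})" for M
    using red_chain23[of p1 m2 p2 p6 m3 m1 p3 "add_mset (bd p4 p5) M"] red_chain23[of p4 m2 p5 p6 m1 m3 p3 "add_mset (bd p1 p2) M"]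
    by (simp_all add: bd_commute add_mset_commute)
  have q00: "red (M + (?K + ?X0 + ?Y0)) (M + {#bd p4 p5, bd p2 p3, bd p6 p1#})" "red (M + (?K' + ?Y1' + ?X1')) (M + {#bd p4 p5, bd p2 p3, bd p6 p1#})" for M
    using red_chain4[of p6 m3 m1 m2 p1 "add_mset (bd p4 p5) (add_mset (bd p2 p3) M)"] red_chain222[of p4 m2 p5 p2 m3 p3 p6 m1 p1 M]
    by (simp_all add: bd_commute add_mset_commute)
  have q11: "red (M + (?K + ?X1 + ?Y1)) (M + {#bd p6 p5, bd p1 p2, bd p4 p3#})" "red (M + (?K' + ?Y0' + ?X0')) (M + {#bd p6 p5, bd p1 p2, bd p4 p3#})" for M
    using red_chain4[of p4 m2 m1 m3 p3 "add_mset (bd p1 p2) (add_mset (bd p6 p5) M)"] red_chain222[of p6 m3 p5 p1 m2 p2 p4 m1 p3 M]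
    by (simp_all add: bd_commute add_mset_commute)
  have q10: "red (M + (?K + ?X1 + ?Y0)) (M + {#bd p6 p5, bd p1 p4, bd p2 p3#})" "red (M + (?K' + ?Y0' + ?X1')) (M + {#bd p6 p5, bd p1 p4, bd p2 p3#})" for M
    using red_chain23[of p6 m3 p5 p1 m2 m1 p4 "add_mset (bd p2 p3) M"] red_chain23[of p3 m3 p2 p4 m2 m1 p1 "add_mset (bd p5 p6) M"]
    by (simp_all add: bd_commute add_mset_commute)
  have fin: "finite (insert y C)" "x \<notin> insert y C" "finite (insert y' C)" "x' \<notin> insert y' C" using C xy by auto
  have ins: "br M e (insert x (insert y C)) l = (\<lambda>t.
      (br (M + smA e x + smA e y) e C (l - 2) t + br (M + smA e x + smB e y) e C l t) +
      (br (M + smB e x + smA e y) e C l t + br (M + smB e x + smB e y) e C (l + 2) t))" for M l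
    unfolding br_insert[OF fin(1,2)] br_insert[OF C(1) xy(2)] by (simp add: algebra_simps)
  have ins': "br M e' (insert x' (insert y' C)) l = (\<lambda>t.
      (br (M + smA e' y' + smA e' x') e' C (l - 2) t + br (M + smA e' y' + smB e' x') e' C l t) +
      (br (M + smB e' y' + smA e' x') e' C l t + br (M + smB e' y' + smB e' x') e' C (l + 2) t))" for M l
    unfolding br_insert[OF fin(3,4)] br_insert[OF C(1) xy(5)] by (simp add: ac_simps)
  have beta: "veq (br (N + ?K) e (insert x (insert y C)) l) (br (N + ?K') e' (insert x' (insert y' C)) l)"
    if u: "wfm (N + ?K) e (insert x (insert y C))" and u': "wfm (N + ?K') e' (insert x' (insert y' C))" for l
  proof -
    note ux = wfm_insert[OF fin(1,2) u] and ux' = wfm_insert[OF fin(3,4) u']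
    note v = wfm_insert[OF C(1) xy(2) ux(1)] wfm_insert[OF C(1) xy(2) ux(2)]
      wfm_insert[OF C(1) xy(5) ux'(1)] wfm_insert[OF C(1) xy(5) ux'(2)]
    have sw: "N + K + A + B = N + (K + A + B)" for K A B :: "nat list set multiset" by (simp add: ac_simps)
    have sw': "N + K + A + B = N + (K + B + A)" for K A B :: "nat list set multiset" by (simp add: ac_simps)
    have v1: "wfm (N + (?K + smA e x + smA e y)) e C" "wfm (N + (?K + smA e x + smB e y)) e C"
      "wfm (N + (?K + smB e x + smA e y)) e C" "wfm (N + (?K + smB e x + smB e y)) e C" using v(1-4) unfolding sw .
    have v2: "wfm (N + (?K' + smA e' y' + smA e' x')) e' C" "wfm (N + (?K' + smB e' y' + smA e' x')) e' C"
      "wfm (N + (?K' + smA e' y' + smB e' x')) e' C" "wfm (N + (?K' + smB e' y' + smB e' x')) e' C" using v(5-8) unfolding sw' .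
    show ?thesis using s
    proof (elim disjE conjE)
      assume t: "smA e x = ?X0" "smB e x = ?X1" "smA e y = ?Y1" "smB e y = ?Y0" "smA e' x' = ?X0'" "smB e' x' = ?X1'" "smA e' y' = ?Y1'" "smB e' y' = ?Y0'"
      note v1 = v1[unfolded t] and v2 = v2[unfolded t]
      show ?thesis unfolding ins ins' sw t
        by (intro veq_add P[OF v1(1) v2(1) q01] P[OF v1(2) v2(3) q00] P[OF v1(3) v2(2) q11] P[OF v1(4) v2(4) q10])
    next
      assume t: "smB e x = ?X0" "smA e x = ?X1" "smB e y = ?Y1" "smA e y = ?Y0" "smB e' x' = ?X0'" "smA e' x' = ?X1'" "smB e' y' = ?Y1'" "smA e' y' = ?Y0'"
      note v1 = v1[unfolded t] and v2 = v2[unfolded t]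
      show ?thesis unfolding ins ins' sw t
        by (intro veq_add P[OF v1(1) v2(1) q10] P[OF v1(2) v2(3) q11] P[OF v1(3) v2(2) q00] P[OF v1(4) v2(4) q01])
    qed
  qed
  note wz = wfm_insert[OF fz(1,2) w] and wz' = wfm_insert[OF fz(3,4) w']
  show ?thesis
  proof (cases "even c")
    case True
    then have t: "smA e z = ?G" "smB e z = ?K" "smA e' z' = ?G'" "smB e' z' = ?K'"
      using sm_row[OF row(3) abc(3)] sm_row[OF row'(3) abc(3)] by auto
    show ?thesis unfolding br_insert[OF fz(1,2)] br_insert[OF fz(3,4)]
      using wz wz' unfolding t by (intro veq_add alpha beta)
  next
    case False
    then have t: "smB e z = ?G" "smA e z = ?K" "smB e' z' = ?G'" "smA e' z' = ?K'"
      using sm_row[OF row(3) abc(3)] sm_row[OF row'(3) abc(3)] by auto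
    show ?thesis unfolding br_insert[OF fz(1,2)] br_insert[OF fz(3,4)]
      using wz wz' unfolding t by (intro veq_add alpha beta)
  qed
qed

text \<open>With \<open>z\<close> smoothed, the two other crossings are flat words. One smoothing of
  \<open>z\<close> closes them up to a bigon, which a flat second move removes on either side. The
  other one has its two beads absorbed by the crossings and gives the same two words on both sides,
  with \<open>x\<close> in the role of \<open>y'\<close>.\<close>

lemma br_tri1:
  assumes C: "finite C" "z \<notin> C" "z' \<notin> C" and c: "c < 4" and dist: "distinct [p1, p2, p3, p4, p5, p6]"
    and row: "row e z c = [m2, m3, p6, p1]" and row': "row e' z' c = [p3, p4, m2, m3]"
    and ee: "\<And>v. v \<in> C \<Longrightarrow> row e v 0 = row e' v 0"
    and w: "wfm (add_mset (fl m3 m1 p4 p5) (add_mset (fl m1 m2 p2 p3) N)) e (insert z C)"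
    and w': "wfm (add_mset (fl p1 p2 m3 m1) (add_mset (fl p5 p6 m1 m2) N)) e' (insert z' C)"
  shows "veq (br (add_mset (fl m3 m1 p4 p5) (add_mset (fl m1 m2 p2 p3) N)) e (insert z C) k)
     (br (add_mset (fl p1 p2 m3 m1) (add_mset (fl p5 p6 m1 m2) N)) e' (insert z' C) k)"
proof -
  let ?M = "add_mset (fl m3 m1 p4 p5) (add_mset (fl m1 m2 p2 p3) N)" and ?M' = "add_mset (fl p1 p2 m3 m1) (add_mset (fl p5 p6 m1 m2) N)"
  let ?L = "{#fl m3 m1 p4 p5, fl m1 m2 p2 p3#}" and ?L' = "{#fl p1 p2 m3 m1, fl p5 p6 m1 m2#}"
  let ?G = "{#bd m2 m3, bd p6 p1#}" and ?G' = "{#bd p3 p4, bd m2 m3#}"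
  let ?K = "{#bd m3 p6, bd p1 m2#}" and ?K' = "{#bd p4 m2, bd m3 p3#}"
  have eq: "br M e C l = br M e' C l" for M l by (rule br_cong) (rule ee)
  have P: "veq (br (?M + X) e C l) (br (?M' + X') e' C l)"
    if "wfm (?M + X) e C" "wfm (?M' + X') e' C" "\<And>M. red (M + (?L + X)) (M + L)" "\<And>M. red (M + (?L' + X')) (M + L)" for X X' L l
  proof -
    have 1: "?M + X = N + (?L + X)" "?M' + X' = N + (?L' + X')" by simp_all
    have "veq (br (N + (?L + X)) e C l) (br (N + L) e C l)" using that unfolding 1 by (intro br_red[OF C(1)])
    moreover have "veq (br (N + (?L' + X')) e' C l) (br (N + L) e' C l)" using that unfolding 1 by (intro br_red[OF C(1)])
    ultimately show ?thesis unfolding eq 1 using veq_trans[OF _ veq_sym] by blast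
  qed
  have r1: "fl m1 m2 p2 p3 = fl m2 p2 p3 m1" "fl m1 m3 p2 p3 = fl m3 p2 p3 m1" "fl p1 p2 m3 m1 = fl m3 m1 p1 p2"
    "fl p5 p6 m1 m2 = fl m2 p5 p6 m1" "fl m1 m3 p5 p6 = fl m3 p5 p6 m1"
    by (metis fl_rotate)+
  have r2: "fl m1 p1 p2 p3 = fl p1 p2 p3 m1" "fl p5 p6 m1 m2 = fl m2 p5 p6 m1" "fl p4 p5 p6 m1 = fl p6 m1 p4 p5"
    "fl p3 m1 p1 p2 = fl p1 p2 p3 m1"
    by (metis fl_rotate)+
  have d: "distinct [p4, p3, p5, p2]" "distinct [p1, p6, p2, p5]" using dist by auto
  have g1: "red (M + (?L + ?G)) (M + {#bd p1 p6, bd p3 p4, bd p2 p5#})" for M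
  proof -
    have "red (add_mset (bd m3 m2) (add_mset (fl m2 p2 p3 m1) (add_mset (fl m3 m1 p4 p5) (add_mset (bd p6 p1) M))))
       (add_mset (fl m3 p2 p3 m1) (add_mset (fl m3 m1 p4 p5) (add_mset (bd p6 p1) M)))" by (rule red_absorb)
    moreover have "red (add_mset (fl m3 m1 p4 p5) (add_mset (fl m1 m3 p2 p3) (add_mset (bd p6 p1) M)))
       (add_mset (bd p4 p3) (add_mset (bd p5 p2) (add_mset (bd p6 p1) M)))" by (rule red_bigon[OF d(1)])
    ultimately show ?thesis unfolding r1(1,2) using red_trans by (simp add: bd_commute add_mset_commute)
  qed
  have g2: "red (M + (?L' + ?G')) (M + {#bd p1 p6, bd p3 p4, bd p2 p5#})" for M
  proof -
    have "red (add_mset (bd m3 m2) (add_mset (fl m2 p5 p6 m1) (add_mset (fl m3 m1 p1 p2) (add_mset (bd p3 p4) M))))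
       (add_mset (fl m3 p5 p6 m1) (add_mset (fl m3 m1 p1 p2) (add_mset (bd p3 p4) M)))" by (rule red_absorb)
    moreover have "red (add_mset (fl m3 m1 p1 p2) (add_mset (fl m1 m3 p5 p6) (add_mset (bd p3 p4) M)))
       (add_mset (bd p1 p6) (add_mset (bd p2 p5) (add_mset (bd p3 p4) M)))" by (rule red_bigon[OF d(2)])
    ultimately show ?thesis unfolding r1(3-5) using red_trans by (simp add: bd_commute add_mset_commute)
  qed
  have k1: "red (M + (?L + ?K)) (M + {#fl p6 m1 p4 p5, fl p1 p2 p3 m1#})" for M
  proof -
    have "red (add_mset (bd p6 m3) (add_mset (fl m3 m1 p4 p5) (add_mset (bd p1 m2) (add_mset (fl m2 p2 p3 m1) M))))
       (add_mset (fl p6 m1 p4 p5) (add_mset (bd p1 m2) (add_mset (fl m2 p2 p3 m1) M)))" by (rule red_absorb)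
    moreover have "red (add_mset (bd p1 m2) (add_mset (fl m2 p2 p3 m1) (add_mset (fl p6 m1 p4 p5) M)))
       (add_mset (fl p1 p2 p3 m1) (add_mset (fl p6 m1 p4 p5) M))" by (rule red_absorb)
    ultimately show ?thesis unfolding r1(1) using red_trans by (simp add: bd_commute add_mset_commute)
  qed
  have k2: "red (M + (?L' + ?K')) (M + {#fl p6 m1 p4 p5, fl p1 p2 p3 m1#})" for M
  proof -
    have "red (add_mset (bd p4 m2) (add_mset (fl m2 p5 p6 m1) (add_mset (bd p3 m3) (add_mset (fl m3 m1 p1 p2) M))))
       (add_mset (fl p4 p5 p6 m1) (add_mset (bd p3 m3) (add_mset (fl m3 m1 p1 p2) M)))" by (rule red_absorb)
    moreover have "red (add_mset (bd p3 m3) (add_mset (fl m3 m1 p1 p2) (add_mset (fl p4 p5 p6 m1) M)))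
       (add_mset (fl p3 m1 p1 p2) (add_mset (fl p4 p5 p6 m1) M))" by (rule red_absorb)
    ultimately show ?thesis unfolding r1(3,4) r2(3,4) using red_trans by (simp add: bd_commute add_mset_commute)
  qed
  have alpha: "veq (br (?M + ?G) e C l) (br (?M' + ?G') e' C l)" if "wfm (?M + ?G) e C" "wfm (?M' + ?G') e' C" for l
    by (rule P[OF that g1 g2])
  have beta: "veq (br (?M + ?K) e C l) (br (?M' + ?K') e' C l)" if "wfm (?M + ?K) e C" "wfm (?M' + ?K') e' C" for l
    by (rule P[OF that k1 k2])
  note wz = wfm_insert[OF C(1,2) w] and wz' = wfm_insert[OF C(1,3) w']
  show ?thesis
  proof (cases "even c")
    case True
    then have t: "smA e z = ?G" "smB e z = ?K" "smA e' z' = ?G'" "smB e' z' = ?K'"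
      using sm_row[OF row c] sm_row[OF row' c] by auto
    show ?thesis unfolding br_insert[OF C(1,2)] br_insert[OF C(1,3)]
      using wz wz' unfolding t by (intro veq_add alpha beta)
  next
    case False
    then have t: "smB e z = ?G" "smA e z = ?K" "smB e' z' = ?G'" "smA e' z' = ?K'"
      using sm_row[OF row c] sm_row[OF row' c] by auto
    show ?thesis unfolding br_insert[OF C(1,2)] br_insert[OF C(1,3)]
      using wz wz' unfolding t by (intro veq_add alpha beta)
  qed
qed

section \<open>Smoothing a knot diagram\<close>

lemma red_tri:
  assumes "distinct [p1, p2, p3, p4, p5, p6]"
  shows "red (add_mset (fl m3 m1 p4 p5) (add_mset (fl m1 m2 p2 p3) (add_mset (fl m2 m3 p6 p1) N)))
     (add_mset (fl p1 p2 m3 m1) (add_mset (fl p5 p6 m1 m2) (add_mset (fl p3 p4 m2 m3) N)))" (is "red ?M ?M'")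
  unfolding red_def
proof (intro impI conjI allI)
  assume w: "wfc ?M"
  show "veq (val ?M j) (val ?M' j)" for j using val_tri[OF w assms] .
  show "wfc ?M'"
  proof (rule wfc_mono[OF w, where k = "\<lambda>l. 0"])
    show "\<forall>X\<in>#?M'. node_shape X" using w by (simp add: wfc_def)
  qed (simp only: lb_simps lbv_vert mset.simps count_add_of_bool count_empty count_union; linarith)
qed

text \<open>Meant for the beads 2v and 2v+1 into which \<open>smooth\<close> splits a crossing
  v.\<close>

lemma code_pairs:
  assumes "finite C" "inj f" "inj g" "range f \<inter> range g = {}"
  shows "code D e (f ` C \<union> g ` C) = (\<Sum>c\<in>C. {#vert (vl D e (f c)), vert (vl D e (g c))#})"
  using assms(1)
proof (induction C rule: finite_induct)
  case empty then show ?case by (simp add: code_def)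
next
  case (insert c C)
  have ne: "f a \<noteq> g b" for a b using assms(4) by blast
  have "f c \<notin> f ` C \<union> g ` C" "g c \<notin> f ` C \<union> g ` C" "f c \<noteq> g c"
    using insert.hyps assms(2,3) ne by (auto simp: inj_def) metis+
  then show ?case using insert by simp
qed

context
  fixes D e C T
  assumes lab: "lab D e" and C: "C \<subseteq> {v \<in> nodes D. kind D v \<noteq> Bead}" and T: "T \<subseteq> C"
begin

text \<open>Smoothing merely regroups darts: \<open>sinv\<close> inverts \<open>smap\<close>, so
  edges and labels of the smoothed diagram are pulled back from the original one.\<close>

lemma smooth_darts:
  "d \<in> darts D \<Longrightarrow> smap C T d \<in> darts (smooth D C T) \<and> sinv C T (smap C T d) = d"
  "d \<in> darts (smooth D C T) \<Longrightarrow> sinv C T d \<in> darts D \<and> smap C T (sinv C T d) = d"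
proof -
  assume "d \<in> darts D"
  then obtain v s where d: "d = (v, s)" "v \<in> nodes D" "s < pdeg D v" by (cases d) (auto simp: darts_def)
  show "smap C T d \<in> darts (smooth D C T) \<and> sinv C T (smap C T d) = d"
  proof (cases "v \<in> C")
    case True
    then have "s = 0 \<or> s = 1 \<or> s = 2 \<or> s = 3" using d C by (auto simp: pdeg_def)
    then show ?thesis using d True by (auto simp: smap_def sinv_def darts_def smooth_def pdeg_def)
  next
    case False
    then show ?thesis using d by (auto simp: smap_def sinv_def darts_def smooth_def pdeg_def)
  qed
next
  assume "d \<in> darts (smooth D C T)"
  then obtain w s where d: "d = (w, s)" "w \<in> nodes (smooth D C T)" "s < pdeg (smooth D C T) w" by (cases d) (auto simp: darts_def)
  then consider (a) v where "w = 2 * v" "v \<in> nodes D" "v \<notin> C" | (b) v where "w = 2 * v" "v \<in> C" | (c) v where "w = 2 * v + 1" "v \<in> C"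
    by (auto simp: smooth_def)
  then show "sinv C T d \<in> darts D \<and> smap C T (sinv C T d) = d"
  proof cases
    case a
    then show ?thesis using d by (auto simp: smap_def sinv_def darts_def smooth_def pdeg_def split: if_splits)
  next
    case b
    have s: "s = 0 \<or> s = 1" using d b by (auto simp: smooth_def pdeg_def)
    have "v \<in> nodes D" "kind D v \<noteq> Bead" using b C by auto
    then show ?thesis using d(1) b s by (auto simp: smap_def sinv_def darts_def pdeg_def)
  next
    case c
    have s: "s = 0 \<or> s = 1" using d c by (auto simp: smooth_def pdeg_def)
    have v: "v \<in> nodes D" "kind D v \<noteq> Bead" using c C by auto
    have "w div 2 = v" "odd w" using c by simp_all
    then show ?thesis using d(1) c s v by (auto simp: smap_def sinv_def darts_def pdeg_def)
  qed
qed

text \<open>With labels carried over along \<open>sinv\<close> no edge is relabelled. Unsmoothed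
  nodes keep their words, and the two beads of a smoothed crossing spell the words of
  \<open>smA\<close> or \<open>smB\<close>.\<close>

lemma smooth_codes:
  "codes (smooth D C T) (state (code D e (nodes D - C)) e C T)"
proof -
  let ?D = "smooth D C T" and ?S = "smap C T" and ?I = "sinv C T"
  let ?e = "\<lambda>d. e (?I d)"
  note a = smooth_darts
  have wf: "pd_wf D" using lab by (simp add: lab_def)
  have fin: "finite (nodes D)" using wf by (simp add: pd_wf_def)
  have finC: "finite C" by (rule finite_subset[OF C]) (simp add: fin)
  have nb: "nb ?D d = ?S (nb D (?I d))" for d by (simp add: smooth_def)
  have wf': "pd_wf ?D"
    unfolding pd_wf_def
  proof (intro conjI ballI)
    show "finite (nodes ?D)" using fin finC by (simp add: smooth_def)
    fix d assume d: "d \<in> darts ?D"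
    have i: "?I d \<in> darts D" "?S (?I d) = d" using a(2)[OF d] by auto
    have n: "nb D (?I d) \<in> darts D" "nb D (nb D (?I d)) = ?I d" "nb D (?I d) \<noteq> ?I d" using wf_nb[OF wf i(1)] by auto
    have s: "?S (nb D (?I d)) \<in> darts ?D" "?I (?S (nb D (?I d))) = nb D (?I d)" using a(1)[OF n(1)] by auto
    show "nb ?D d \<in> darts ?D" unfolding nb by (rule s(1))
    show "nb ?D (nb ?D d) = d" unfolding nb s(2) n(2) by (rule i(2))
    show "nb ?D d \<noteq> d" unfolding nb using s(2) n(3) by force
  qed
  have lab': "lab ?D ?e"
    unfolding lab_def
  proof (intro conjI ballI impI)
    show "pd_wf ?D" by (rule wf')
    show "?e (nb ?D d) = ?e d" if d: "d \<in> darts ?D" for d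
    proof -
      have i: "?I d \<in> darts D" using a(2)[OF d] by auto
      have n: "nb D (?I d) \<in> darts D" "e (nb D (?I d)) = e (?I d)" using lab_nb[OF lab i] by auto
      have s: "?I (?S (nb D (?I d))) = nb D (?I d)" using a(1)[OF n(1)] by auto
      show ?thesis unfolding nb s n(2) ..
    qed
    show "d' = d \<or> d' = nb ?D d" if d: "d \<in> darts ?D" "d' \<in> darts ?D" "?e d = ?e d'" for d d'
    proof (cases "?I d' = ?I d")
      case True
      then show ?thesis using a(2)[OF d(1)] a(2)[OF d(2)] by metis
    next
      case False
      then have "?I d' = nb D (?I d)" using labD[OF lab _ _ d(3)] a(2)[OF d(1)] a(2)[OF d(2)] by blast
      then have "d' = ?S (nb D (?I d))" using a(2)[OF d(2)] by metis
      then show ?thesis unfolding nb ..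
    qed
  qed
  have kd: "kind ?D (2 * v) = (if v \<in> C then Bead else if kind D v = Real then Flat else kind D v)"
    "kind ?D (Suc (2 * v)) = (if v \<in> C then Bead else if kind D v = Real then Flat else kind D v)" for v
    by (simp_all add: smooth_def)
  have flat': "flatdiag ?D"
    unfolding flatdiag_def
  proof (intro conjI ballI wf')
    show "kind ?D w \<noteq> Real" for w by (simp add: smooth_def)
  qed
  have nodes: "nodes ?D = (\<lambda>v. 2 * v) ` (nodes D - C) \<union> ((\<lambda>v. 2 * v) ` C \<union> (\<lambda>v. Suc (2 * v)) ` C)"
    using C by (auto simp: smooth_def)
  have inj: "inj ((*) (2::nat))" "inj (\<lambda>v::nat. Suc (2 * v))" "range ((*) (2::nat)) \<inter> range (\<lambda>v. Suc (2 * v)) = {}"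
    by (auto simp: inj_def) presburger
  have disj: "(\<lambda>v. 2 * v) ` (nodes D - C) \<inter> ((\<lambda>v. 2 * v) ` C \<union> (\<lambda>v. Suc (2 * v)) ` C) = {}"
    by auto presburger
  have code_un: "code ?D ?e (A \<union> B) = code ?D ?e A + code ?D ?e B" if "finite A" "finite B" "A \<inter> B = {}" for A B
    unfolding code_def using that by (simp add: mset_set_Union)
  have "code ?D ?e ((\<lambda>v. 2 * v) ` (nodes D - C)) = code D e (nodes D - C)"
  proof -
    have "mset_set ((\<lambda>v. 2 * v) ` (nodes D - C)) = image_mset (\<lambda>v. 2 * v) (mset_set (nodes D - C))"
      by (rule image_mset_mset_set[symmetric]) (auto simp: inj_on_def)
    moreover have "vl ?D ?e (2 * v) = vl D e v" if "v \<in> nodes D - C" for v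
      using that by (auto simp: vl_def pdeg_def kd sinv_def)
    ultimately show ?thesis unfolding code_def by (auto simp: multiset.map_comp comp_def fin intro!: image_mset_cong)
  qed
  moreover have "code ?D ?e ((\<lambda>v. 2 * v) ` C \<union> (\<lambda>v. Suc (2 * v)) ` C) = (\<Sum>c\<in>T. smA e c) + (\<Sum>c\<in>C - T. smB e c)"
  proof -
    have "code ?D ?e ((\<lambda>v. 2 * v) ` C \<union> (\<lambda>v. Suc (2 * v)) ` C) = (\<Sum>c\<in>C. {#vert (vl ?D ?e (2 * c)), vert (vl ?D ?e (Suc (2 * c)))#})"
      using code_pairs[OF finC inj] .
    also have "\<dots> = (\<Sum>c\<in>C. if c \<in> T then smA e c else smB e c)"
    proof (rule sum.cong[OF refl])
      fix c assume c: "c \<in> C"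
      then have k: "kind ?D (2 * c) = Bead" "kind ?D (Suc (2 * c)) = Bead" by (simp_all add: kd)
      show "{#vert (vl ?D ?e (2 * c)), vert (vl ?D ?e (Suc (2 * c)))#} = (if c \<in> T then smA e c else smB e c)"
      proof -
        have h: "2 * c div 2 = c" "Suc (2 * c) div 2 = c" "even (2 * c)" "odd (Suc (2 * c))" by simp_all
        have i: "?I (2 * c, 0) = (if c \<in> T then (c, 0) else (c, 1))" "?I (2 * c, 1) = (if c \<in> T then (c, 1) else (c, 2))"
          "?I (Suc (2 * c), 0) = (if c \<in> T then (c, 2) else (c, 3))" "?I (Suc (2 * c), 1) = (if c \<in> T then (c, 3) else (c, 0))"
          using c h by (simp_all add: sinv_def)
        show ?thesis unfolding vl_bead[OF k(1)] vl_bead[OF k(2)] One_nat_def[symmetric] i by (simp add: smA_def smB_def)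
      qed
    qed
    also have "\<dots> = (\<Sum>c\<in>C - T. smB e c) + (\<Sum>c\<in>T. smA e c)"
    proof -
      have "(\<Sum>c\<in>C - T. if c \<in> T then smA e c else smB e c) = (\<Sum>c\<in>C - T. smB e c)"
        "(\<Sum>c\<in>T. if c \<in> T then smA e c else smB e c) = (\<Sum>c\<in>T. smA e c)" by (auto intro: sum.cong)
      then show ?thesis using sum.subset_diff[OF T finC, of "\<lambda>c. if c \<in> T then smA e c else smB e c"] by simp
    qed
    finally show ?thesis by (simp add: add.commute)
  qed
  moreover have "code ?D ?e (nodes ?D) = code ?D ?e ((\<lambda>v. 2 * v) ` (nodes D - C)) + code ?D ?e ((\<lambda>v. 2 * v) ` C \<union> (\<lambda>v. Suc (2 * v)) ` C)"
    unfolding nodes using disj fin finC by (intro code_un) auto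
  ultimately have "code ?D ?e (nodes ?D) = state (code D e (nodes D - C)) e C T"
    by (simp add: state_def ac_simps)
  then show ?thesis using codesI flat' lab' by blast
qed

end

lemma jones_br:
  assumes lab: "lab D e" and C: "Cn D ori n = C"
  shows "veq (graphical_jones n D ori)
    (\<lambda>x. (if even (writhe D ori) then 1 else - 1) * br (code D e (nodes D - C)) e C (3 * writhe D ori) x)"
proof -
  have CR: "C \<subseteq> {v \<in> nodes D. kind D v \<noteq> Bead}" unfolding C[symmetric] by (auto simp: Cn_def real_cr_def)
  let ?s = "if even (writhe D ori) then 1 else - 1 :: int" and ?w = "3 * writhe D ori"
  have "veq (\<lambda>x. \<Sum>T\<in>Pow C. delta (smooth D C T) (?w - int (card T) + int (card (C - T))) x) (br (code D e (nodes D - C)) e C ?w)"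
    unfolding br_def by (rule veq_sum) (intro val_codes smooth_codes[OF lab CR], simp)
  from veq_sign[OF this, of "even (writhe D ori)"] show ?thesis
    by (simp only: graphical_jones_def Let_def C sum_distrib_left)
qed

text \<open>Putting the words of the crossings of \<open>C\<close> back restores the code of the
  whole diagram.\<close>

lemma lab_wfm:
  assumes lab: "lab D e" and C: "C \<subseteq> {v \<in> nodes D. kind D v \<noteq> Bead}"
  shows "wfm (code D e (nodes D - C)) e C"
proof -
  have fin: "finite (nodes D)" using lab by (simp add: lab_def pd_wf_def)
  then have finC: "finite C" by (intro finite_subset[OF C]) simp
  have "(\<Sum>c\<in>C. {#vert (row e c 0)#}) = code D e C"
  proof -
    have "(\<Sum>c\<in>C. {#vert (row e c 0)#}) = (\<Sum>c\<in>C. {#vert (vl D e c)#})"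
    proof (rule sum.cong[OF refl])
      fix c assume "c \<in> C"
      then have "kind D c \<noteq> Bead" using C by auto
      then show "{#vert (row e c 0)#} = {#vert (vl D e c)#}" by (simp add: vert_row[of D c 0 e])
    qed
    also have "\<dots> = code D e C" using finC by (induction C rule: finite_induct) (simp_all add: code_def)
    finally show ?thesis .
  qed
  moreover have "code D e (nodes D - C) + code D e C = code D e (nodes D)"
  proof -
    have "nodes D = (nodes D - C) \<union> C" using C by auto
    then have "mset_set (nodes D) = mset_set (nodes D - C) + mset_set C"
      using mset_set_Union[of "nodes D - C" C] fin finC by auto
    then show ?thesis by (simp add: code_def)
  qed
  ultimately show ?thesis using lab_wfc[OF lab] by (simp add: wfm_def)
qed

text \<open>An edge is named by the smaller of the numbers that encode its two darts.\<close>

lemma lab_exists: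
  assumes wf: "pd_wf D"
  shows "\<exists>e. lab D e"
proof -
  let ?p = "prod_encode :: dart \<Rightarrow> nat"
  define e where "e d = min (?p d) (?p (nb D d))" for d
  have "lab D e"
    unfolding lab_def
  proof (intro conjI ballI impI wf)
    show "e (nb D d) = e d" if "d \<in> darts D" for d using wf_nb[OF wf that] by (simp add: e_def min.commute)
    show "d' = d \<or> d' = nb D d" if d: "d \<in> darts D" "d' \<in> darts D" "e d = e d'" for d d'
    proof -
      have "e d = ?p d \<or> e d = ?p (nb D d)" "e d' = ?p d' \<or> e d' = ?p (nb D d')" by (auto simp: e_def min_def)
      then have "d = d' \<or> d = nb D d' \<or> nb D d = d' \<or> nb D d = nb D d'" using d(3)
        by (metis inj_eq inj_prod_encode)
      then show ?thesis using wf_nb[OF wf d(1)] wf_nb[OF wf d(2)] by metis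
    qed
  qed
  then show ?thesis by blast
qed

section \<open>The index as a height difference\<close>

locale cyclic_perm =
  fixes I :: "'a set" and f :: "'a \<Rightarrow> 'a"
  assumes fin: "finite I" and closed: "\<And>a. a \<in> I \<Longrightarrow> f a \<in> I"
    and trans: "\<And>a b. a \<in> I \<Longrightarrow> b \<in> I \<Longrightarrow> \<exists>m. (f ^^ m) a = b"
begin

lemma funpow_closed: "a \<in> I \<Longrightarrow> (f ^^ k) a \<in> I"
  by (induction k) (auto intro: closed)

text \<open>Transitivity brings \<open>a\<close> back to itself. Up to the least period the iterates
  are distinct, and modulo it they reach all of \<open>I\<close>, so it equals
  \<open>card I\<close>.\<close>

lemma period: "a \<in> I \<Longrightarrow> (f ^^ card I) a = a \<and> bij_betw (\<lambda>k. (f ^^ k) a) {..<card I} I"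
proof -
  assume a: "a \<in> I"
  obtain m where "(f ^^ m) (f a) = a" using trans[OF closed[OF a] a] by blast
  then have ex: "\<exists>p>0. (f ^^ p) a = a" by (intro exI[of _ "Suc m"]) (simp add: funpow_swap1)
  define p where "p = (LEAST p. 0 < p \<and> (f ^^ p) a = a)"
  have p: "0 < p" "(f ^^ p) a = a" using LeastI_ex[OF ex] by (auto simp: p_def)
  have least: "\<not> (0 < q \<and> (f ^^ q) a = a)" if "q < p" for q using not_less_Least that unfolding p_def by blast
  have "inj_on (\<lambda>k. (f ^^ k) a) {..<p}"
  proof (rule linorder_inj_onI')
    fix i j assume ij: "i \<in> {..<p}" "j \<in> {..<p}" "i < j"
    show "(f ^^ i) a \<noteq> (f ^^ j) a"
    proof
      assume eq: "(f ^^ i) a = (f ^^ j) a"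
      have "(f ^^ (p - j + i)) a = (f ^^ (p - j)) ((f ^^ j) a)" by (simp add: funpow_add eq)
      also have "\<dots> = (f ^^ (p - j + j)) a" by (simp add: funpow_add)
      also have "\<dots> = a" using ij p by simp
      finally show False using least[of "p - j + i"] ij by simp
    qed
  qed
  moreover have "(\<lambda>k. (f ^^ k) a) ` {..<p} = I"
  proof
    show "(\<lambda>k. (f ^^ k) a) ` {..<p} \<subseteq> I" using funpow_closed[OF a] by auto
    show "I \<subseteq> (\<lambda>k. (f ^^ k) a) ` {..<p}"
    proof
      fix b assume "b \<in> I"
      then obtain m where "(f ^^ m) a = b" using trans[OF a] by blast
      then have "(f ^^ (m mod p)) a = b" using funpow_mod_eq[OF p(2)] by simp
      then show "b \<in> (\<lambda>k. (f ^^ k) a) ` {..<p}" using p(1) by force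
    qed
  qed
  ultimately have bij: "bij_betw (\<lambda>k. (f ^^ k) a) {..<p} I" by (simp add: bij_betw_def)
  then have "card I = p" using bij_betw_same_card by fastforce
  then show ?thesis using p bij by simp
qed

definition dst :: "'a \<Rightarrow> 'a \<Rightarrow> nat" where "dst a b = (LEAST m. (f ^^ m) a = b)"

lemma dst_funpow:
  assumes "a \<in> I" "k < card I"
  shows "dst a ((f ^^ k) a) = k"
  unfolding dst_def
proof (rule Least_equality)
  fix m assume m: "(f ^^ m) a = (f ^^ k) a"
  have "inj_on (\<lambda>k. (f ^^ k) a) {..<card I}" using period[OF assms(1)] by (simp add: bij_betw_def)
  then show "k \<le> m" using m assms(2) by (metis inj_onD leI lessThan_iff less_trans nat_less_le)
qed simp

lemma obtain_funpow:
  assumes "a \<in> I" "b \<in> I"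
  obtains k where "k < card I" "b = (f ^^ k) a" "dst a b = k"
proof -
  have "b \<in> (\<lambda>k. (f ^^ k) a) ` {..<card I}" using period[OF assms(1)] assms(2) by (simp add: bij_betw_def)
  then show ?thesis using that dst_funpow[OF assms(1)] by auto
qed

text \<open>A point other than the two ends lies on exactly one of the two arcs. Thereby the
  conditions of \<open>rgt\<close> and \<open>lft\<close>, which refer to both arcs, can be read on
  one of them.\<close>

lemma arc_complement:
  assumes I: "a \<in> I" "b \<in> I" "p \<in> I" and ne: "p \<noteq> a" "p \<noteq> b" "a \<noteq> b"
  shows "(0 < dst b p \<and> dst b p < dst b a) \<longleftrightarrow> \<not> (0 < dst a p \<and> dst a p < dst a b)"
proof -
  obtain k where k: "k < card I" "p = (f ^^ k) a" "dst a p = k" using obtain_funpow[OF I(1,3)] .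
  obtain g where g: "g < card I" "b = (f ^^ g) a" "dst a b = g" using obtain_funpow[OF I(1,2)] .
  have pos: "0 < k" "0 < g" "k \<noteq> g" using k g ne by (auto intro: Nat.gr0I)
  \<comment> \<open>From \<open>b\<close> the remaining steps of the full turn lead back to
    \<open>a\<close>.\<close>
  have "(f ^^ (card I - g)) b = (f ^^ (card I - g + g)) a" by (simp add: g(2) funpow_add)
  also have "\<dots> = a" using g period[OF I(1)] by simp
  finally have ba: "(f ^^ (card I - g)) b = a" .
  have d1: "dst b a = card I - g"
    using dst_funpow[OF I(2), of "card I - g"] ba pos g by simp
  show ?thesis
  proof (cases "k < g")
    case True
    have "(f ^^ (k + (card I - g))) b = p" by (simp add: funpow_add ba k(2))
    then have "dst b p = k + (card I - g)" using dst_funpow[OF I(2), of "k + (card I - g)"] True g by simp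
    then show ?thesis using d1 k g pos True by simp
  next
    case False
    then have "g < k" using pos by simp
    have "(f ^^ (k - g)) b = (f ^^ (k - g + g)) a" by (simp add: g(2) funpow_add)
    then have "(f ^^ (k - g)) b = p" using \<open>g < k\<close> k by simp
    then have "dst b p = k - g" using dst_funpow[OF I(2), of "k - g"] k by simp
    then show ?thesis using d1 k g pos \<open>g < k\<close> by simp
  qed
qed

text \<open>The sum telescopes. Both ends are excluded from the arc, so it begins with the value
  after the step at \<open>a\<close> and stops on arrival at \<open>b\<close>.\<close>

lemma sum_arc:
  fixes h :: "'a \<Rightarrow> int"
  assumes I: "a \<in> I" "b \<in> I" "a \<noteq> b" and h: "\<And>d. d \<in> I \<Longrightarrow> h (f d) = h d + \<phi> d"
  shows "(\<Sum>p\<in>{p \<in> I. 0 < dst a p \<and> dst a p < dst a b}. \<phi> p) = h b - h (f a)"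
proof -
  obtain g where g: "g < card I" "b = (f ^^ g) a" "dst a b = g" using obtain_funpow[OF I(1,2)] .
  have pos: "0 < g" using g I by (auto intro: Nat.gr0I)
  have inj: "inj_on (\<lambda>k. (f ^^ k) a) {..<card I}" using period[OF I(1)] by (simp add: bij_betw_def)
  have "{p \<in> I. 0 < dst a p \<and> dst a p < dst a b} = (\<lambda>k. (f ^^ k) a) ` {1..<g}"
  proof
    show "{p \<in> I. 0 < dst a p \<and> dst a p < dst a b} \<subseteq> (\<lambda>k. (f ^^ k) a) ` {1..<g}"
    proof
      fix p assume p: "p \<in> {p \<in> I. 0 < dst a p \<and> dst a p < dst a b}"
      then have "p \<in> I" by simp
      then obtain k where "p = (f ^^ k) a" "dst a p = k" using obtain_funpow[OF I(1)] by blast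
      then show "p \<in> (\<lambda>k. (f ^^ k) a) ` {1..<g}" using p g by auto
    qed
    show "(\<lambda>k. (f ^^ k) a) ` {1..<g} \<subseteq> {p \<in> I. 0 < dst a p \<and> dst a p < dst a b}"
      using g dst_funpow[OF I(1)] funpow_closed[OF I(1)] by auto
  qed
  moreover have "inj_on (\<lambda>k. (f ^^ k) a) {1..<g}" by (rule inj_on_subset[OF inj]) (use g in auto)
  ultimately have "(\<Sum>p\<in>{p \<in> I. 0 < dst a p \<and> dst a p < dst a b}. \<phi> p) = (\<Sum>k\<in>{1..<g}. \<phi> ((f ^^ k) a))"
    by (simp add: sum.reindex)
  also have "\<dots> = (\<Sum>k\<in>{1..<g}. h ((f ^^ Suc k) a) - h ((f ^^ k) a))"
    using h[OF funpow_closed[OF I(1)]] by simp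
  also have "\<dots> = h ((f ^^ g) a) - h ((f ^^ 1) a)"
    using sum_Suc_diff'[of 1 g "\<lambda>k. h ((f ^^ k) a)"] pos by simp
  finally show ?thesis by (simp add: g(2))
qed

text \<open>Partial sums from \<open>a\<close> on satisfy the equation at every step but the last;
  there, on the return to \<open>a\<close>, the total has to vanish.\<close>

lemma potential_exists:
  fixes \<phi> :: "'a \<Rightarrow> int"
  assumes a: "a \<in> I" and z: "(\<Sum>d\<in>I. \<phi> d) = 0"
  shows "\<exists>h. \<forall>d\<in>I. h (f d) = h d + \<phi> d"
proof (intro exI ballI)
  fix d assume d: "d \<in> I"
  obtain k where k: "k < card I" "d = (f ^^ k) a" "dst a d = k" using obtain_funpow[OF a d] .
  let ?h = "\<lambda>d. \<Sum>m<dst a d. \<phi> ((f ^^ m) a)"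
  show "?h (f d) = ?h d + \<phi> d"
  proof (cases "Suc k < card I")
    case True
    then have "dst a (f d) = Suc k" using dst_funpow[OF a True] k by simp
    then show ?thesis using k by simp
  next
    case False
    then have ck: "card I = Suc k" using k by simp
    then have "f d = a" using period[OF a] k by simp
    then have "dst a (f d) = 0" using dst_funpow[OF a, of 0] k by simp
    moreover have "(\<Sum>m<card I. \<phi> ((f ^^ m) a)) = (\<Sum>d\<in>I. \<phi> d)"
      using period[OF a] by (intro sum.reindex_bij_betw) simp
    ultimately show ?thesis using z ck k by simp
  qed
qed

end

lemma mod4:
  "(0 + 1) mod 4 = (1::nat)" "(1 + 1) mod 4 = (2::nat)" "(2 + 1) mod 4 = (3::nat)" "(3 + 1) mod 4 = (0::nat)"
  "(0 + 2) mod 4 = (2::nat)" "(1 + 2) mod 4 = (3::nat)" "(2 + 2) mod 4 = (0::nat)" "(3 + 2) mod 4 = (1::nat)"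
  by simp_all

definition sg :: "(dart \<Rightarrow> bool) \<Rightarrow> dart \<Rightarrow> int" where
  "sg ori d = (if ori d then 1 else - 1)"

text \<open>The slot \<open>s + 1\<close> belongs to the strand that is crossed.\<close>

definition height :: "pd \<Rightarrow> (dart \<Rightarrow> bool) \<Rightarrow> (dart \<Rightarrow> int) \<Rightarrow> bool" where
  "height D ori h \<longleftrightarrow> (\<forall>d\<in>darts D. h (nb D d) = h d) \<and>
     (\<forall>v\<in>nodes D. kind D v = Bead \<longrightarrow> h (v, 0) = h (v, 1)) \<and>
     (\<forall>v\<in>nodes D. kind D v = Real \<longrightarrow> (\<forall>s<4. h (v, (s + 2) mod 4) - h (v, s) = sg ori (v, (s + 1) mod 4)))"

text \<open>This is twice the index of the crossing.  A rotation of the slots by one only changes its sign,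
  so that it can be computed from any slot on.\<close>

definition gap :: "(dart \<Rightarrow> int) \<Rightarrow> nat \<Rightarrow> int" where
  "gap h v = h (v, 0) + h (v, 2) - h (v, 1) - h (v, 3)"

lemma real_height: "height D ori h \<Longrightarrow> v \<in> real_cr D \<Longrightarrow> s < 4 \<Longrightarrow> h (v, (s + 2) mod 4) = h (v, s) + sg ori (v, (s + 1) mod 4)"
  unfolding height_def real_cr_def by fastforce

section \<open>Heights on an oriented knot diagram\<close>

context
  fixes D ori
  assumes ok: "oknot D ori"
begin

text \<open>One incoming dart for each passage through a node: these are the points of the Gauss
  circle, beads included, and \<open>kstep\<close> is the successor map.\<close>

definition "inc = {d \<in> darts D. \<not> ori d}"

lemma ok_wf: "pd_wf D" and ok_ori: "d \<in> darts D \<Longrightarrow> ori (nb D d) \<noteq> ori d \<and> ori (opp D d) \<noteq> ori d"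
  and ok_kind: "v \<in> nodes D \<Longrightarrow> kind D v = Real \<or> kind D v = Bead"
  using ok by (auto simp: oknot_def orientation_def) (metis nkind.exhaust)

lemma ok_slots:
  assumes "v \<in> real_cr D"
  shows "ori (v, 2) = (\<not> ori (v, 0))" "ori (v, 3) = (\<not> ori (v, 1))" "(v, 0) \<in> darts D" "(v, 1) \<in> darts D" "(v, 2) \<in> darts D" "(v, 3) \<in> darts D"
    "opp D (v, 0) = (v, 2)" "opp D (v, 1) = (v, 3)" "opp D (v, 2) = (v, 0)" "opp D (v, 3) = (v, 1)"
proof -
  have v: "v \<in> nodes D" "kind D v = Real" using assms by (auto simp: real_cr_def)
  show d: "(v, 0) \<in> darts D" "(v, 1) \<in> darts D" "(v, 2) \<in> darts D" "(v, 3) \<in> darts D" using v by (auto simp: darts_def pdeg_def)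
  show o: "opp D (v, 0) = (v, 2)" "opp D (v, 1) = (v, 3)" "opp D (v, 2) = (v, 0)" "opp D (v, 3) = (v, 1)"
    using v by (simp_all add: opp_def pdeg_def)
  show "ori (v, 2) = (\<not> ori (v, 0))" "ori (v, 3) = (\<not> ori (v, 1))" using ok_ori[OF d(1)] ok_ori[OF d(2)] unfolding o by blast+
qed

lemma csign_sg: "v \<in> real_cr D \<Longrightarrow> csign ori v = - sg ori (v, 0) * sg ori (v, 1)"
  using ok_slots[of v] by (simp add: csign_def over_in_def under_in_def sg_def)

lemma opp_darts: "d \<in> darts D \<Longrightarrow> opp D d \<in> darts D \<and> opp D (opp D d) = d"
proof -
  assume "d \<in> darts D"
  then obtain v s where d: "d = (v, s)" "v \<in> nodes D" "s < pdeg D v" by (cases d) (auto simp: darts_def)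
  from ok_kind[OF d(2)] show ?thesis
  proof
    assume k: "kind D v = Real"
    then have "s = 0 \<or> s = 1 \<or> s = 2 \<or> s = 3" using d by (auto simp: pdeg_def)
    then show ?thesis using ok_slots[of v] d k by (auto simp: real_cr_def)
  next
    assume k: "kind D v = Bead"
    then have "s = 0 \<or> s = 1" using d by (auto simp: pdeg_def)
    then show ?thesis using d k by (auto simp: opp_def darts_def pdeg_def)
  qed
qed

lemma kstep_inc: "d \<in> inc \<Longrightarrow> kstep D d \<in> inc"
  using opp_darts[of d] ok_ori[of d] ok_ori[of "opp D d"] wf_nb[OF ok_wf, of "opp D d"]
  by (auto simp: inc_def kstep_def)

interpretation cyclic_perm inc "kstep D"
proof
  show "finite inc" using finite_darts[OF ok_wf] by (simp add: inc_def)
  show "kstep D a \<in> inc" if "a \<in> inc" for a using kstep_inc that .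
  show "\<exists>m. (kstep D ^^ m) a = b" if "a \<in> inc" "b \<in> inc" for a b using ok that by (auto simp: oknot_def inc_def)
qed

lemma inarc_dst: "inarc D p a b \<longleftrightarrow> 0 < dst a p \<and> dst a p < dst a b"
  by (simp add: inarc_def gdist_def dst_def)

text \<open>The increment that \<open>height\<close> prescribes for the passage entered at
  \<open>d\<close>.\<close>

definition "phi d = (if kind D (fst d) = Bead then 0 else sg ori (fst d, (snd d + 1) mod 4))"

text \<open>The last two claims are the essential ones: an under passage adds the sign of the
  crossing to the height, the over passage takes it away.\<close>

lemma io_inc:
  assumes "v \<in> real_cr D"
  shows "under_in ori v \<in> inc" "over_in ori v \<in> inc" "fst (under_in ori v) = v" "fst (over_in ori v) = v" "under_in ori v \<noteq> over_in ori v"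
    "phi (under_in ori v) = csign ori v" "phi (over_in ori v) = - csign ori v"
proof -
  note S = ok_slots(1-6)[OF assms]
  have k: "kind D v = Real" using assms by (simp add: real_cr_def)
  show "under_in ori v \<in> inc" "over_in ori v \<in> inc" "fst (under_in ori v) = v" "fst (over_in ori v) = v"
    by (simp_all add: under_in_def over_in_def inc_def S S(4)[simplified])
  show "under_in ori v \<noteq> over_in ori v" by (simp add: under_in_def over_in_def)
  have P: "phi (v, 0) = sg ori (v, 1)" "phi (v, 1) = sg ori (v, 2)" "phi (v, 2) = sg ori (v, 3)" "phi (v, 3) = sg ori (v, 0)"
    unfolding phi_def fst_conv snd_conv mod4 by (simp_all add: k)
  have c4: "(1 = (0 + 3) mod (4::nat)) = False" "(3 = (0 + 3) mod (4::nat)) = True" "(1 = (2 + 3) mod (4::nat)) = True" "(3 = (2 + 3) mod (4::nat)) = False"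
    "- (- 1) = (1::int)" by simp_all
  show "phi (under_in ori v) = csign ori v" "phi (over_in ori v) = - csign ori v"
    by (cases "ori (v, 0)"; cases "ori (v, 1)"; simp only: under_in_def over_in_def if_True if_False P c4 csign_def snd_conv sg_def S(1,2) simp_thms)+
qed

text \<open>A real crossing has exactly two incoming darts, one for each end of its chord, so a sum
  over the circle is a sum over chords.\<close>

lemma sum_inc:
  fixes psi :: "dart \<Rightarrow> int"
  assumes "\<And>d. d \<in> inc \<Longrightarrow> kind D (fst d) = Bead \<Longrightarrow> psi d = 0"
  shows "(\<Sum>d\<in>inc. psi d) = (\<Sum>v\<in>real_cr D. psi (under_in ori v) + psi (over_in ori v))"
proof -
  have finR: "finite (real_cr D)" using ok_wf by (simp add: real_cr_def pd_wf_def)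
  let ?U = "under_in ori ` real_cr D" and ?O = "over_in ori ` real_cr D"
  have sub: "?U \<union> ?O \<subseteq> inc" using io_inc by auto
  have "d \<in> ?U \<union> ?O" if d: "d \<in> inc" "kind D (fst d) \<noteq> Bead" for d
  proof -
    obtain v s where vs: "d = (v, s)" "v \<in> nodes D" "s < pdeg D v" using d by (cases d) (auto simp: inc_def darts_def)
    then have k: "v \<in> real_cr D" using ok_kind d by (auto simp: real_cr_def)
    then have "s = 0 \<or> s = 1 \<or> s = 2 \<or> s = 3" using vs by (auto simp: pdeg_def real_cr_def)
    then have "d = under_in ori v \<or> d = over_in ori v"
      using vs d ok_slots[OF k] by (auto simp: under_in_def over_in_def inc_def)
    then show ?thesis using k by blast
  qed
  then have "(\<Sum>d\<in>inc. psi d) = (\<Sum>d\<in>?U \<union> ?O. psi d)"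
    using sub assms fin by (intro sum.mono_neutral_right) blast+
  also have "\<dots> = (\<Sum>d\<in>?U. psi d) + (\<Sum>d\<in>?O. psi d)"
  proof (rule sum.union_disjoint)
    show "?U \<inter> ?O = {}" using io_inc by (auto) (metis)
  qed (use finR in auto)
  also have "(\<Sum>d\<in>?U. psi d) = (\<Sum>v\<in>real_cr D. psi (under_in ori v))"
    using io_inc(3) by (intro sum.reindex[unfolded comp_def] inj_onI) metis
  also have "(\<Sum>d\<in>?O. psi d) = (\<Sum>v\<in>real_cr D. psi (over_in ori v))"
    using io_inc(4) by (intro sum.reindex[unfolded comp_def] inj_onI) metis
  finally show ?thesis by (simp add: sum.distrib)
qed

lemma height_step:
  assumes h: "height D ori h" and d: "d \<in> inc"
  shows "h (kstep D d) = h d + phi d"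
proof -
  obtain v s where vs: "d = (v, s)" "v \<in> nodes D" "s < pdeg D v" "d \<in> darts D" using d by (cases d) (auto simp: inc_def darts_def)
  have "h (kstep D d) = h (opp D d)" using h opp_darts[OF vs(4)] by (simp add: kstep_def height_def)
  also have "\<dots> = h d + phi d"
    using ok_kind[OF vs(2)]
  proof
    assume k: "kind D v = Real"
    have "h (v, (s + 2) mod 4) - h (v, s) = sg ori (v, (s + 1) mod 4)"
      using h k vs unfolding height_def by (simp add: pdeg_def)
    then show ?thesis using k by (simp add: vs(1) phi_def opp_def pdeg_def)
  next
    assume k: "kind D v = Bead"
    then have "s = 0 \<or> s = 1" using vs by (auto simp: pdeg_def)
    moreover have "h (v, 0) = h (v, 1)" using h k vs unfolding height_def by blast
    ultimately show ?thesis using k by (auto simp: vs(1) phi_def opp_def pdeg_def)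
  qed
  finally show ?thesis .
qed

text \<open>The increments of the two passages of a crossing cancel, so the total around the knot is
  zero and incoming darts carry a potential. An outgoing dart takes the value from the other end of
  its edge.\<close>

lemma height_exists: "\<exists>h. height D ori h"
proof -
  have "(\<Sum>d\<in>inc. phi d) = 0"
    using sum_inc[of phi] io_inc by (simp add: phi_def)
  moreover obtain a where "a \<in> inc"
  proof -
    obtain v where v: "v \<in> nodes D" using ok by (auto simp: oknot_def)
    then have "(v, 0) \<in> darts D" by (simp add: darts_def pdeg_def)
    then show ?thesis using that[of "(v, 0)"] that[of "nb D (v, 0)"] ok_ori[of "(v, 0)"] wf_nb[OF ok_wf, of "(v, 0)"] by (cases "ori (v, 0)") (auto simp: inc_def)
  qed
  ultimately obtain H where H: "\<forall>d\<in>inc. H (kstep D d) = H d + phi d" using potential_exists by blast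
  define h where "h d = (if ori d then H (nb D d) else H d)" for d
  have hopp: "h (opp D d) = h d + phi d" if d: "d \<in> inc" for d
  proof -
    have "ori (opp D d)" using d ok_ori[of d] by (simp add: inc_def)
    then show ?thesis using bspec[OF H d] d by (simp add: h_def kstep_def inc_def)
  qed
  have "height D ori h"
    unfolding height_def
  proof (intro conjI ballI impI allI)
    show "h (nb D d) = h d" if "d \<in> darts D" for d
      using ok_ori[OF that] wf_nb[OF ok_wf that] by (simp add: h_def)
    fix v assume v: "v \<in> nodes D"
    show "h (v, 0) = h (v, 1)" if k: "kind D v = Bead"
    proof -
      have o: "opp D (v, 0) = (v, 1)" "opp D (v, 1) = (v, 0)" "(v, 0) \<in> darts D" "(v, 1) \<in> darts D" using k v by (simp_all add: opp_def pdeg_def darts_def)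
      have "phi (v, s) = 0" for s using k by (simp add: phi_def)
      then show ?thesis using hopp[of "(v, 0)"] hopp[of "(v, 1)"] o ok_ori[OF o(3)] by (auto simp: inc_def)
    qed
    fix s :: nat assume k: "kind D v = Real" and s: "s < 4"
    have r: "v \<in> real_cr D" using v k by (simp add: real_cr_def)
    note S = ok_slots[OF r]
    have P: "phi (v, t) = sg ori (v, (t + 1) mod 4)" for t using k by (simp add: phi_def)
    have s': "s = 0 \<or> s = 1 \<or> s = 2 \<or> s = 3" using s by auto
    have q: "h (opp D (v, t)) = h (v, t) + sg ori (v, (t + 1) mod 4)" if "\<not> ori (v, t)" "(v, t) \<in> darts D" for t
      using hopp[of "(v, t)"] that by (simp add: inc_def P)
    have n: "ori (v, 3) = (\<not> ori (v, 1))" "ori (v, 2) = (\<not> ori (v, 0))" using S(1,2) by auto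
    note q0 = q[of 0, unfolded S(7) mod4, OF _ S(3)] and q1 = q[of 1, unfolded S(8) mod4, OF _ S(4)]
      and q2 = q[of 2, unfolded S(9) mod4, OF _ S(5)] and q3 = q[of 3, unfolded S(10) mod4, OF _ S(6)]
    have sn: "sg ori (v, 3) = - sg ori (v, 1)" "sg ori (v, 2) = - sg ori (v, 0)" unfolding sg_def n by simp_all
    have t02: "h (v, 2) = h (v, 0) + sg ori (v, 1)"
      using q0 q2 n(2) sn by (cases "ori (v, 0)") simp_all
    have t13: "h (v, 3) = h (v, 1) - sg ori (v, 0)"
      using q1 q3 n(1) sn by (cases "ori (v, 1)") simp_all
    show "h (v, (s + 2) mod 4) - h (v, s) = sg ori (v, (s + 1) mod 4)"
      using s' by (elim disjE; hypsubst; simp only: mod4 t02 t13 sn; simp)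
  qed
  then show ?thesis by blast
qed

text \<open>The increments are summed over the open arc from the over to the under passage of
  \<open>c\<close>. A chord with both ends on it cancels; one with only its head there adds its sign
  (\<open>rgt\<close>), one with only its tail there subtracts it (\<open>lft\<close>). The sum
  telescopes to a height difference at \<open>c\<close>, of which \<open>gap\<close> is the double,
  written evenly in the four slots.\<close>

lemma chord_index_height:
  assumes h: "height D ori h" and c: "c \<in> real_cr D"
  shows "2 * chord_index D ori c = gap h c"
proof -
  define u where "u = under_in ori c"
  define v where "v = over_in ori c"
  have uv: "u \<in> inc" "v \<in> inc" "u \<noteq> v" using io_inc[OF c] by (auto simp: u_def v_def)
  have finR: "finite (real_cr D)" using ok_wf by (simp add: real_cr_def pd_wf_def)
  let ?A = "{p \<in> inc. 0 < dst v p \<and> dst v p < dst v u}"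
  define psi where "psi p = (if inarc D p v u then phi p else 0)" for p
  have "(\<Sum>p\<in>?A. phi p) = (\<Sum>p\<in>inc. psi p)"
    unfolding psi_def inarc_dst using fin by (simp add: sum.inter_filter)
  also have "\<dots> = (\<Sum>d\<in>real_cr D. psi (under_in ori d) + psi (over_in ori d))"
    by (rule sum_inc) (simp add: psi_def phi_def)
  also have "\<dots> = (\<Sum>d\<in>real_cr D. (if rgt D ori c d then csign ori d else 0) - (if lft D ori c d then csign ori d else 0))"
  proof (rule sum.cong[OF refl])
    fix d assume d: "d \<in> real_cr D"
    note io = io_inc[OF d]
    show "psi (under_in ori d) + psi (over_in ori d) = (if rgt D ori c d then csign ori d else 0) - (if lft D ori c d then csign ori d else 0)"
    proof (cases "d = c")
      \<comment> \<open>The passages of \<open>c\<close> itself are the excluded ends of the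
        arc.\<close>
      case True
      have "dst u u = 0" "dst v v = 0" using dst_funpow[OF uv(1), of 0] dst_funpow[OF uv(2), of 0] uv fin by (auto simp: card_gt_0_iff)
      then show ?thesis unfolding True psi_def rgt_def lft_def u_def[symmetric] v_def[symmetric] inarc_dst by simp
    next
      case False
      have ne: "p \<noteq> u" "p \<noteq> v" if "p = under_in ori d \<or> p = over_in ori d" for p
        using that False io io_inc[OF c] by (auto simp: u_def v_def)
      have cp: "inarc D p u v \<longleftrightarrow> \<not> inarc D p v u" if "p = under_in ori d \<or> p = over_in ori d" for p
        unfolding inarc_dst by (rule arc_complement) (use that io ne uv in auto)
      show ?thesis unfolding psi_def rgt_def lft_def u_def[symmetric] v_def[symmetric] io(6,7) using cp by auto
    qed
  qed
  also have "\<dots> = chord_index D ori c"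
    unfolding chord_index_def sum_subtractf using finR by (simp add: sum.inter_filter)
  finally have "chord_index D ori c = h u - h (kstep D v)"
    using sum_arc[of v u h phi] uv height_step[OF h] by simp
  also have "h (kstep D v) = h (opp D v)"
    using h opp_darts[of v] uv by (simp add: kstep_def height_def inc_def)
  finally have ci: "chord_index D ori c = h u - h (opp D v)" .
  note S = ok_slots(1,2)[OF c] and O = ok_slots(7-10)[OF c]
  have n2: "(0 + 2) mod 4 = (2::nat)" "(0 + 1) mod 4 = (1::nat)" "0 < (4::nat)" by simp_all
  have A: "h (c, 2) = h (c, 0) + sg ori (c, 1)" using real_height[OF h c n2(3)] unfolding n2(1,2) .
  have n3: "(1 + 2) mod 4 = (3::nat)" "(1 + 1) mod 4 = (2::nat)" "1 < (4::nat)" by simp_all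
  have B: "h (c, 3) = h (c, 1) + sg ori (c, 2)" using real_height[OF h c n3(3)] unfolding n3(1,2) .
  have "h u = (if ori (c, 0) then h (c, 2) else h (c, 0))" by (simp add: u_def under_in_def)
  moreover have "h (opp D v) = (if ori (c, 1) then h (c, 1) else h (c, 3))"
    unfolding v_def over_in_def by (simp only: O if_distrib[of "opp D"] if_distrib[of h] cong: if_cong)
  moreover have "sg ori (c, 1) = (if ori (c, 1) then 1 else - 1)" "sg ori (c, 2) = (if ori (c, 0) then - 1 else 1)"
    unfolding sg_def S by simp_all
  ultimately show ?thesis unfolding ci gap_def A B by (simp split: if_splits)
qed

text \<open>The factor 2 cancels in the divisibility. For \<open>n\<close> = 0 both conditions say
  that the index vanishes, so this case needs no separate treatment.\<close>

lemma Cn_height: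
  assumes h: "height D ori h"
  shows "Cn D ori n = {c \<in> real_cr D. 2 * int n dvd gap h c}"
proof -
  have "int n dvd chord_index D ori c \<longleftrightarrow> 2 * int n dvd gap h c" if "c \<in> real_cr D" for c
    by (simp flip: chord_index_height[OF h that])
  then show ?thesis by (auto simp: Cn_def)
qed

end

section \<open>Invariance\<close>

definition idx :: "nat \<Rightarrow> pd \<Rightarrow> (dart \<Rightarrow> int) \<Rightarrow> nat set" where
  "idx n D h = {c \<in> real_cr D. 2 * int n dvd gap h c}"

definition jbr :: "pd \<Rightarrow> (dart \<Rightarrow> bool) \<Rightarrow> (dart \<Rightarrow> nat) \<Rightarrow> nat set \<Rightarrow> pd \<times> int \<Rightarrow> int" where
  "jbr D ori e C = (\<lambda>x. (if even (writhe D ori) then 1 else - 1) * br (code D e (nodes D - C)) e C (3 * writhe D ori) x)"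

lemma jones_jbr:
  assumes "oknot D ori" "lab D e" "height D ori h"
  shows "veq (graphical_jones n D ori) (jbr D ori e (idx n D h))"
  unfolding jbr_def by (rule jones_br[OF assms(2)]) (simp add: idx_def Cn_height[OF assms(1,3)])

lemma idx_sub: "idx n D h \<subseteq> {v \<in> nodes D. kind D v \<noteq> Bead}" "idx n D h \<subseteq> real_cr D"
  by (auto simp: idx_def real_cr_def)

lemma finite_real: "pd_wf D \<Longrightarrow> finite (real_cr D)"
  by (simp add: pd_wf_def real_cr_def)

lemma finite_idx: "pd_wf D \<Longrightarrow> finite (idx n D h)"
  using finite_real finite_subset[OF idx_sub(2)] by blast

text \<open>Labelling and height are free to choose in each diagram, so at a move they can be chosen
  to agree away from the changed part.\<close>

lemma jones_transfer:
  assumes "oknot D ori" "lab D e" "height D ori h" "oknot D' ori'" "lab D' e'" "height D' ori' h'"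
    and "veq (jbr D ori e (idx n D h)) (jbr D' ori' e' (idx n D' h'))"
  shows "veq (graphical_jones n D ori) (graphical_jones n D' ori')"
  using jones_jbr[OF assms(1-3), of n] jones_jbr[OF assms(4-6), of n] assms(7) veq_trans veq_sym by metis

lemma jbr_same_writhe:
  assumes "writhe D' ori' = writhe D ori"
    and "veq (br (code D e (nodes D - C)) e C (3 * writhe D ori)) (br (code D' e' (nodes D' - C')) e' C' (3 * writhe D ori))"
  shows "veq (jbr D ori e C) (jbr D' ori' e' C')"
  unfolding jbr_def assms(1) by (rule veq_sign[OF assms(2)])

text \<open>An isomorphism turns a real crossing by 0 or 2 slots, and half a turn affects neither
  smoothings nor gap nor sign, as the next three lemmas record.\<close>

lemma row_even_shift:
  assumes "even r" "r < 4" "\<And>s. s < 4 \<Longrightarrow> g (v, s) = g' (w, (s + r) mod 4)"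
  shows "row g v 0 = row g' w 0 \<or> row g v 0 = row g' w 2"
proof -
  have "r = 0 \<or> r = 2" using assms(1,2) by (auto simp: less4)
  then show ?thesis using assms(3)[of 0] assms(3)[of 1] assms(3)[of 2] assms(3)[of 3]
    by (elim disjE) (simp_all add: row_simps flip: numeral_2_eq_2)
qed

lemma row_shift_inv:
  assumes "row e v 0 = row e' w 0 \<or> row e v 0 = row e' w 2"
  shows "smA e v = smA e' w" "smB e v = smB e' w"
  using assms by (auto simp: row_simps smA_def smB_def add_mset_commute)

lemma gap_shift_inv:
  assumes "row h v 0 = row h' w 0 \<or> row h v 0 = row h' w 2"
  shows "gap h v = gap h' w"
  using assms by (auto simp: row_simps gap_def)

lemma csign_cong:
  assumes "oknot D ori" "oknot D' ori'" "v \<in> real_cr D" "w \<in> real_cr D'" "row ori v 0 = row ori' w 0 \<or> row ori v 0 = row ori' w 2"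
  shows "csign ori v = csign ori' w"
  using assms(5) ok_slots(1,2)[OF assms(1,3)] ok_slots(1,2)[OF assms(2,4)]
  unfolding csign_sg[OF assms(1,3)] csign_sg[OF assms(2,4)]
  by (auto simp: row_simps sg_def)

lemma br_reindex:
  assumes f: "inj_on f C" and sm: "\<And>c. c \<in> C \<Longrightarrow> smA e c = smA e' (f c) \<and> smB e c = smB e' (f c)"
  shows "br N e C j = br N e' (f ` C) j"
proof
  fix x
  have inj: "inj_on (image f) (Pow C)" using f by (simp add: inj_on_image_Pow)
  have "br N e' (f ` C) j x = (\<Sum>T\<in>image f ` Pow C. val (state N e' (f ` C) T) (j - int (card T) + int (card (f ` C - T))) x)"
    by (simp add: br_def image_Pow_surj)
  also have "\<dots> = (\<Sum>T\<in>Pow C. val (state N e' (f ` C) (f ` T)) (j - int (card (f ` T)) + int (card (f ` C - f ` T))) x)"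
    using inj by (simp add: sum.reindex)
  also have "\<dots> = br N e C j x"
    unfolding br_def
  proof (rule sum.cong[OF refl])
    fix T assume "T \<in> Pow C"
    then have T: "T \<subseteq> C" by simp
    have i: "inj_on f T" "inj_on f (C - T)" using f T by (auto intro: inj_on_subset)
    have d: "f ` C - f ` T = f ` (C - T)" using f T by (simp add: inj_on_image_set_diff[of f C C T])
    have "(\<Sum>c\<in>T. smA e c) = (\<Sum>c\<in>T. smA e' (f c))" "(\<Sum>c\<in>C - T. smB e c) = (\<Sum>c\<in>C - T. smB e' (f c))"
      using sm T by (auto intro: sum.cong)
    then have "state N e' (f ` C) (f ` T) = state N e C T"
      unfolding state_def d using i by (simp add: sum.reindex)
    then show "val (state N e' (f ` C) (f ` T)) (j - int (card (f ` T)) + int (card (f ` C - f ` T))) x =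
      val (state N e C T) (j - int (card T) + int (card (C - T))) x"
      unfolding d using i by (simp add: card_image)
  qed
  finally show "br N e C j x = br N e' (f ` C) j x" ..
qed

text \<open>Labelling and height of the target are pulled back along \<open>imap\<close>; the two
  state sums then correspond term by term.\<close>

lemma jones_iso:
  assumes ok: "oknot D ori" "oknot D' ori'" and iso: "iso_by f r D D'"
    and ori: "\<forall>d\<in>darts D. ori' (imap f r D d) = ori d"
  shows "veq (graphical_jones n D ori) (graphical_jones n D' ori')"
proof -
  have wf: "pd_wf D" "pd_wf D'" using ok by (auto simp: ok_wf)
  have f: "bij_betw f (nodes D) (nodes D')" using iso by (simp add: iso_by_def)
  have kind: "kind D' (f v) = kind D v" "r v < pdeg D v" "kind D v = Real \<Longrightarrow> even (r v)" "f v \<in> nodes D'" "pdeg D' (f v) = pdeg D v"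
    if "v \<in> nodes D" for v using iso that f by (auto simp: iso_by_def pdeg_def bij_betw_def)
  have nb: "nb D' (imap f r D d) = imap f r D (nb D d)" if "d \<in> darts D" for d using iso that by (simp add: iso_by_def)
  have pos: "0 < pdeg D v" for v by (simp add: pdeg_def)
  have imd: "imap f r D d \<in> darts D'" if "d \<in> darts D" for d
    using that kind pos by (cases d) (auto simp: imap_def darts_def)
  have inj: "d = d'" if d0: "d \<in> darts D" "d' \<in> darts D" "imap f r D d = imap f r D d'" for d d'
  proof -
    obtain v s v' s' where d: "d = (v, s)" "v \<in> nodes D" "s < pdeg D v" "d' = (v', s')" "v' \<in> nodes D" "s' < pdeg D v'"
      using d0 by (cases d, cases d') (auto simp: darts_def)
    have vv: "v = v'" using f d0 d by (auto simp: imap_def bij_betw_def inj_on_def)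
    have "(s + r v) mod pdeg D v = (s' + r v) mod pdeg D v" using d0 d vv by (auto simp: imap_def)
    then show ?thesis using d vv mod_add_inj by blast
  qed
  obtain e' where e': "lab D' e'" using lab_exists wf by blast
  obtain h' where h': "height D' ori' h'" using height_exists ok by blast
  define e where "e d = e' (imap f r D d)" for d
  define h where "h d = h' (imap f r D d)" for d
  have lab: "lab D e"
    unfolding lab_def
  proof (intro conjI ballI impI wf)
    show "e (nb D d) = e d" if "d \<in> darts D" for d
      using lab_nb[OF e' imd[OF that]] nb[OF that] by (simp add: e_def)
    show "d' = d \<or> d' = nb D d" if "d \<in> darts D" "d' \<in> darts D" "e d = e d'" for d d'
      using labD[OF e' imd[OF that(1)] imd[OF that(2)]] that nb inj wf_nb[OF wf(1) that(1)] unfolding e_def by metis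
  qed
  have im4: "imap f r D (v, s) = (f v, (s + r v) mod 4)" if "kind D v = Real" for v s
    using that by (simp add: imap_def pdeg_def)
  have height: "height D ori h"
    unfolding height_def
  proof (intro conjI ballI impI allI)
    show "h (nb D d) = h d" if "d \<in> darts D" for d
      using h' imd[OF that] nb[OF that] unfolding height_def h_def by metis
    show "h (v, 0) = h (v, 1)" if v: "v \<in> nodes D" "kind D v = Bead" for v
    proof -
      have "r v = 0 \<or> r v = 1" using kind(2)[OF v(1)] v(2) by (auto simp: pdeg_def)
      moreover have "h' (f v, 0) = h' (f v, 1)" using h' kind(1,4)[OF v(1)] v(2) unfolding height_def by simp
      ultimately show ?thesis using v(2) by (auto simp: h_def imap_def pdeg_def)
    qed
    fix v s assume v: "v \<in> nodes D" "kind D v = Real" and s: "(s::nat) < 4"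
    have rv: "f v \<in> real_cr D'" using kind[OF v(1)] v(2) by (simp add: real_cr_def)
    have m: "((s + 2) mod 4 + r v) mod 4 = ((s + r v) mod 4 + 2) mod 4" "((s + r v) mod 4 + 1) mod 4 = ((s + 1) mod 4 + r v) mod 4"
      by (simp_all add: mod_simps ac_simps)
    have d: "(v, (s + 1) mod 4) \<in> darts D" using v by (simp add: darts_def pdeg_def)
    have "h' (f v, ((s + r v) mod 4 + 2) mod 4) = h' (f v, (s + r v) mod 4) + sg ori' (f v, ((s + r v) mod 4 + 1) mod 4)"
      by (rule real_height[OF h' rv]) simp
    moreover have "sg ori' (f v, ((s + 1) mod 4 + r v) mod 4) = sg ori (v, (s + 1) mod 4)"
      using bspec[OF ori d] by (simp add: sg_def im4[OF v(2)])
    ultimately show "h (v, (s + 2) mod 4) - h (v, s) = sg ori (v, (s + 1) mod 4)"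
      unfolding h_def im4[OF v(2)] m by simp
  qed
  have "nodes D' = f ` nodes D" using f by (simp add: bij_betw_def)
  then have real: "real_cr D' = f ` real_cr D"
    using kind(1) by (auto simp: real_cr_def)
  have rowsh: "row g v 0 = row g' (f v) 0 \<or> row g v 0 = row g' (f v) 2"
    if "v \<in> real_cr D" "\<And>d. d \<in> darts D \<Longrightarrow> g d = g' (imap f r D d)" for v and g g' :: "dart \<Rightarrow> 'x"
  proof (rule row_even_shift[of "r v"])
    have v: "v \<in> nodes D" "kind D v = Real" using that by (auto simp: real_cr_def)
    show "even (r v)" "r v < 4" using kind[OF v(1)] v by (auto simp: pdeg_def)
    show "g (v, s) = g' (f v, (s + r v) mod 4)" if "s < 4" for s
      using \<open>\<And>d. d \<in> darts D \<Longrightarrow> g d = g' (imap f r D d)\<close>[of "(v, s)"] that v im4 by (simp add: darts_def pdeg_def)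
  qed
  let ?C = "idx n D h" and ?C' = "idx n D' h'"
  have C': "?C' = f ` ?C"
    using gap_shift_inv[OF rowsh[of _ h h']] by (auto simp: idx_def real h_def)
  have injr: "inj_on f (nodes D)" using f by (simp add: bij_betw_def)
  have wr: "writhe D' ori' = writhe D ori"
  proof -
    have "inj_on f (real_cr D)" by (rule inj_on_subset[OF injr]) (auto simp: real_cr_def)
    then have "writhe D' ori' = (\<Sum>v\<in>real_cr D. csign ori' (f v))" by (simp add: writhe_def real sum.reindex)
    also have "\<dots> = writhe D ori" unfolding writhe_def
    proof (rule sum.cong[OF refl])
      fix v assume v: "v \<in> real_cr D"
      show "csign ori' (f v) = csign ori v"
        by (rule csign_cong[OF ok v, symmetric]) (use v real rowsh[OF v, of ori ori'] ori in auto)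
    qed
    finally show ?thesis .
  qed
  have "veq (jbr D ori e ?C) (jbr D' ori' e' ?C')"
  proof (rule jbr_same_writhe[OF wr])
    have 1: "nodes D' - ?C' = f ` (nodes D - ?C)"
      using f unfolding C' bij_betw_def using idx_sub(1)[of n D h] by (subst inj_on_image_set_diff[of f "nodes D"]) auto
    have "code D' e' (nodes D' - ?C') = code D e (nodes D - ?C)"
    proof -
      have "mset_set (f ` (nodes D - ?C)) = image_mset f (mset_set (nodes D - ?C))"
        by (rule image_mset_mset_set[symmetric]) (rule inj_on_subset[OF injr], auto)
      moreover have "vert (vl D' e' (f v)) = vert (vl D e v)" if v: "v \<in> nodes D" for v
      proof -
        have "vl D e v = rotate (r v) (vl D' e' (f v))"
        proof (rule nth_equalityI)
          show "length (vl D e v) = length (rotate (r v) (vl D' e' (f v)))" using kind(5)[OF v] by simp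
          fix s assume "s < length (vl D e v)"
          then have s: "s < pdeg D v" by simp
          have m: "(s + r v) mod pdeg D v < pdeg D v" using pos by simp
          have "rotate (r v) (vl D' e' (f v)) ! s = vl D' e' (f v) ! ((s + r v) mod pdeg D v)"
            using s kind(5)[OF v] by (simp add: nth_rotate add.commute)
          also have "\<dots> = e' (f v, (s + r v) mod pdeg D v)" using m kind(5)[OF v] by (simp add: vl_def)
          finally show "vl D e v ! s = rotate (r v) (vl D' e' (f v)) ! s" using s by (simp add: vl_def e_def imap_def)
        qed
        then show ?thesis by (simp add: vert_rotate)
      qed
      ultimately show ?thesis unfolding code_def 1 using wf(1)
        by (auto simp: multiset.map_comp comp_def pd_wf_def intro!: image_mset_cong)
    qed
    moreover have "br N e ?C j = br N e' ?C' j" for N j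
      unfolding C'
    proof (rule br_reindex)
      show "inj_on f ?C" by (rule inj_on_subset[OF injr]) (use idx_sub in blast)
      show "smA e c = smA e' (f c) \<and> smB e c = smB e' (f c)" if "c \<in> ?C" for c
        using row_shift_inv[OF rowsh[of c e e']] idx_sub(2) that by (auto simp: e_def)
    qed
    ultimately show "veq (br (code D e (nodes D - ?C)) e ?C (3 * writhe D ori)) (br (code D' e' (nodes D' - ?C')) e' ?C' (3 * writhe D ori))"
      by simp
  qed
  then show ?thesis using jones_transfer[OF ok(1) lab height ok(2) e' h'] by blast
qed

section \<open>Signs, heights and gaps read from an arbitrary slot on\<close>

lemma rot_slots:
  assumes "i < 4"
  shows "((i + 1) mod 4 + 2) mod 4 = (i + 3) mod (4::nat)" "((i + 1) mod 4 + 1) mod 4 = (i + 2) mod (4::nat)"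
    "((i + 2) mod 4 + 2) mod 4 = (i::nat)" "((i + 3) mod 4 + 2) mod 4 = (i + 1) mod (4::nat)"
  using assms by presburger+

lemma sg_opp:
  assumes "oknot D ori" "v \<in> real_cr D" "i < 4"
  shows "sg ori (v, (i + 2) mod 4) = - sg ori (v, i)" "sg ori (v, (i + 3) mod 4) = - sg ori (v, (i + 1) mod 4)"
proof -
  have *: "sg ori (v, (s + 2) mod 4) = - sg ori (v, s)" if "s < 4" for s
  proof -
    have k: "(v, s) \<in> darts D" "opp D (v, s) = (v, (s + 2) mod 4)"
      using assms(2) that by (auto simp: real_cr_def darts_def opp_def pdeg_def)
    show ?thesis using ok_ori[OF assms(1) k(1)] unfolding k(2) by (auto simp: sg_def)
  qed
  show "sg ori (v, (i + 2) mod 4) = - sg ori (v, i)" using * assms(3) .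
  have "(i + 1) mod 4 < 4" by simp
  from *[OF this] show "sg ori (v, (i + 3) mod 4) = - sg ori (v, (i + 1) mod 4)" unfolding rot_slots[OF assms(3)] .
qed

lemma height_rot:
  assumes "oknot D ori" "height D ori h" "v \<in> real_cr D" "i < 4"
  shows "h (v, (i + 2) mod 4) = h (v, i) + sg ori (v, (i + 1) mod 4)"
    "h (v, (i + 3) mod 4) = h (v, (i + 1) mod 4) - sg ori (v, i)"
proof -
  show "h (v, (i + 2) mod 4) = h (v, i) + sg ori (v, (i + 1) mod 4)" by (rule real_height[OF assms(2,3,4)])
  have "(i + 1) mod 4 < 4" by simp
  from real_height[OF assms(2,3) this]
  show "h (v, (i + 3) mod 4) = h (v, (i + 1) mod 4) - sg ori (v, i)"
    unfolding rot_slots[OF assms(4)] sg_opp[OF assms(1,3,4)] by simp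
qed

lemma gap_rot:
  assumes "i < 4"
  shows "gap h v = (if even i then 1 else - 1) * (h (v, i) + h (v, (i + 2) mod 4) - h (v, (i + 1) mod 4) - h (v, (i + 3) mod 4))"
proof -
  have "(0 + 3) mod 4 = (3::nat)" "(1 + 3) mod 4 = (0::nat)" "(2 + 3) mod 4 = (1::nat)" "(3 + 3) mod 4 = (2::nat)" by simp_all
  note m = mod4 this
  have "i = 0 \<or> i = 1 \<or> i = 2 \<or> i = 3" using assms by auto
  then show ?thesis by (elim disjE; hypsubst; simp only: m gap_def; simp)
qed

lemma csign_rot:
  assumes "oknot D ori" "v \<in> real_cr D" "i < 4"
  shows "csign ori v = (if even i then - 1 else 1) * sg ori (v, i) * sg ori (v, (i + 1) mod 4)"
proof -
  have "i = 0 \<or> i = 1 \<or> i = 2 \<or> i = 3" using assms by auto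
  moreover have "sg ori (v, 2) = - sg ori (v, 0)" "sg ori (v, 3) = - sg ori (v, 1)"
    using ok_slots(1,2)[OF assms(1,2)] by (auto simp: sg_def)
  ultimately show ?thesis unfolding csign_sg[OF assms(1,2)]
    by (elim disjE; hypsubst; simp only: mod4; simp)
qed

lemma sg_nb: "oknot D ori \<Longrightarrow> d \<in> darts D \<Longrightarrow> nb D d = d' \<Longrightarrow> sg ori d' = - sg ori d"
  using ok_ori[of D ori d] by (auto simp: sg_def)

text \<open>At common crossings the condition is inherited, as heights and directions agree there. A
  move only has to supply constancy along the old edges and at the old beads.\<close>

lemma height_restrict:
  assumes h': "height D' ori' h'" and nb: "\<And>d. d \<in> darts D \<Longrightarrow> h (nb D d) = h d"
    and bead: "\<And>v. v \<in> nodes D \<Longrightarrow> kind D v = Bead \<Longrightarrow> h (v, 0) = h (v, 1)"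
    and real: "\<And>v s. v \<in> real_cr D \<Longrightarrow> s < 4 \<Longrightarrow> v \<in> real_cr D' \<and> h (v, s) = h' (v, s) \<and> ori' (v, s) = ori (v, s)"
  shows "height D ori h"
  unfolding height_def
proof (intro conjI ballI impI allI)
  fix v s assume "v \<in> nodes D" "kind D v = Real" and s: "(s::nat) < 4"
  then have v: "v \<in> real_cr D" by (simp add: real_cr_def)
  have m: "(s + 2) mod 4 < 4" "(s + 1) mod 4 < 4" by simp_all
  show "h (v, (s + 2) mod 4) - h (v, s) = sg ori (v, (s + 1) mod 4)"
    using real[OF v s] real[OF v m(1)] real[OF v m(2)] real_height[OF h' _ s, of v] by (simp add: sg_def)
qed (use nb bead in auto)

lemma row_cong: "(\<And>s. s < 4 \<Longrightarrow> g (v, s) = g' (v, s)) \<Longrightarrow> row g v 0 = row g' v 0"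
  by (simp add: row_simps)

text \<open>The labels on the two sides of the new bead are merged to label the smaller diagram,
  which is \<open>br_bead\<close> read backwards. A height of the larger diagram serves for the
  smaller one as it stands.\<close>

lemma jones_bead:
  assumes ok: "oknot D ori" "oknot D' ori'" and mv: "bead_ins D D'"
    and ori: "\<And>v s. v \<in> nodes D \<inter> nodes D' \<Longrightarrow> s < pdeg D v \<Longrightarrow> ori' (v, s) = ori (v, s)"
  shows "veq (graphical_jones n D ori) (graphical_jones n D' ori')"
proof -
  have wf: "pd_wf D" "pd_wf D'" using ok by (auto simp: ok_wf)
  obtain d0 v where d0: "d0 \<in> darts D" and v: "v \<notin> nodes D" and D': "D' = \<lparr>nodes = insert v (nodes D), kind = (kind D)(v := Bead),
           nb = lnks [(d0,(v,0)), ((v,1), nb D d0)] (nb D)\<rparr>"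
    using mv unfolding bead_ins_def by blast
  define q0 where "q0 = nb D d0"
  have q0: "q0 \<in> darts D" "nb D q0 = d0" "q0 \<noteq> d0" using wf_nb[OF wf(1) d0] by (auto simp: q0_def)
  have N: "nodes D' = insert v (nodes D)" "kind D' = (kind D)(v := Bead)" by (simp_all add: D')
  have nv: "fst w \<noteq> v" if "w \<in> darts D" for w using that v in_darts_node by blast
  have nb: "nb D' d0 = (v, 0)" "nb D' (v, 0) = d0" "nb D' (v, 1) = q0" "nb D' q0 = (v, 1)"
    "\<And>w. w \<in> darts D \<Longrightarrow> w \<noteq> d0 \<Longrightarrow> w \<noteq> q0 \<Longrightarrow> nb D' w = nb D w"
  proof -
    have ne: "w \<noteq> (v, s)" "(v, s) \<noteq> w" if "w \<in> darts D" for w s using nv[OF that] by auto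
    show "nb D' d0 = (v, 0)" "nb D' (v, 0) = d0" "nb D' (v, 1) = q0" "nb D' q0 = (v, 1)"
      using ne[OF d0] ne[OF q0(1)] q0(3) by (simp_all add: D' lnks_def flip: q0_def)
    show "nb D' w = nb D w" if "w \<in> darts D" "w \<noteq> d0" "w \<noteq> q0" for w
      using ne[OF that(1)] that(2,3) by (simp add: D' lnks_def flip: q0_def)
  qed
  have dD: "w \<in> darts D'" if "w \<in> darts D" for w using that nv[OF that] by (auto simp: darts_def N pdeg_def)
  have dv: "(v, 0) \<in> darts D'" "(v, 1) \<in> darts D'" by (auto simp: darts_def N pdeg_def)
  obtain e' where e': "lab D' e'" using lab_exists wf by blast
  obtain h' where h': "height D' ori' h'" using height_exists ok by blast
  define a where "a = e' (v, 0)"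
  define b where "b = e' (v, 1)"
  have eab: "e' d0 = a" "e' q0 = b" using lab_nb[OF e' dv(1)] lab_nb[OF e' dv(2)] nb by (auto simp: a_def b_def)
  have ab: "a \<noteq> b"
  proof
    assume "a = b"
    then have "(v, 1) = nb D' (v, 0)" using labD[OF e' dv] by (simp add: a_def b_def)
    then show False using nb(2) nv[OF d0] by auto
  qed
  have isab: "w = d0 \<or> w = q0" if "w \<in> darts D" "e' w = a \<or> e' w = b" for w
  proof -
    have "w \<noteq> (v, 0)" "w \<noteq> (v, 1)" using nv[OF that(1)] by auto
    then show ?thesis using labD[OF e' dv(1) dD[OF that(1)]] labD[OF e' dv(2) dD[OF that(1)]] that(2)
      unfolding a_def b_def nb by metis
  qed
  let ?f = "id(b := a)"
  define e where "e d = ?f (e' d)" for d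
  have lab: "lab D e"
    unfolding lab_def
  proof (intro conjI ballI impI wf)
    show "e (nb D w) = e w" if w: "w \<in> darts D" for w
    proof (cases "w = d0 \<or> w = q0")
      case True
      then show ?thesis using eab q0 by (auto simp: e_def q0_def)
    next
      case False
      then show ?thesis using nb(5)[OF w] lab_nb[OF e' dD[OF w]] by (simp add: e_def)
    qed
    show "w' = w \<or> w' = nb D w" if w: "w \<in> darts D" "w' \<in> darts D" "e w = e w'" for w w'
    proof (cases "w = d0 \<or> w = q0")
      case True
      have "e d0 = a" "e q0 = a" using eab by (simp_all add: e_def)
      then have "e w' = a" using w(3) True by auto
      then have "e' w' = a \<or> e' w' = b" by (auto simp: e_def split: if_splits)
      then have "w' = d0 \<or> w' = q0" using isab w(2) by blast
      then show ?thesis using True q0(2) q0_def by auto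
    next
      case False
      then have n: "e' w \<noteq> a" "e' w \<noteq> b" using isab[OF w(1)] by auto
      then have "e' w' = e' w" using w(3) by (auto simp: e_def split: if_splits)
      then have "w' = w \<or> w' = nb D' w" using e' dD[OF w(1)] dD[OF w(2)] unfolding lab_def by metis
      then show ?thesis using nb(5)[OF w(1)] False by auto
    qed
  qed
  have real: "real_cr D' = real_cr D" using v by (auto simp: real_cr_def N)
  have o: "ori' (w, s) = ori (w, s)" if "w \<in> real_cr D" "s < 4" for w s
    using that by (intro ori) (auto simp: real_cr_def N pdeg_def)
  have height: "height D ori h'"
  proof (rule height_restrict[OF h'])
    show "h' (nb D w) = h' w" if w: "w \<in> darts D" for w
    proof (cases "w = d0 \<or> w = q0")
      case True
      have "h' d0 = h' (v, 0)" "h' q0 = h' (v, 1)" "h' (v, 0) = h' (v, 1)"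
        using h' dv nb unfolding height_def by (metis, metis, simp add: N)
      then show ?thesis using True q0 q0_def by auto
    next
      case False
      then show ?thesis using nb(5)[OF w] h' dD[OF w] by (auto simp: height_def)
    qed
    show "h' (w, 0) = h' (w, 1)" if "w \<in> nodes D" "kind D w = Bead" for w
    proof -
      have "w \<noteq> v" using that v by auto
      then show ?thesis using h' that unfolding height_def N by auto
    qed
    show "w \<in> real_cr D' \<and> h' (w, s) = h' (w, s) \<and> ori' (w, s) = ori (w, s)" if "w \<in> real_cr D" "s < 4" for w s
      using that real o by auto
  qed
  let ?C = "idx n D h'"
  have C: "idx n D' h' = ?C" by (simp add: idx_def real)
  have wr: "writhe D' ori' = writhe D ori"
    unfolding writhe_def real
  proof (rule sum.cong[OF refl])
    fix w assume w: "w \<in> real_cr D"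
    show "csign ori' w = csign ori w"
      by (rule csign_cong[OF ok(2,1)]) (use w real row_cong[of ori' w ori] o in auto)
  qed
  have fin: "finite (nodes D)" using wf by (simp add: pd_wf_def)
  have vC: "v \<notin> ?C" using v idx_sub(1)[of n D h'] by auto
  have cd: "code D' e' (nodes D' - ?C) = add_mset (bd a b) (code D e' (nodes D - ?C))"
  proof -
    have "nodes D' - ?C = insert v (nodes D - ?C)" using vC by (auto simp: N)
    moreover have "code D' e' (nodes D - ?C) = code D e' (nodes D - ?C)"
      by (rule code_cong) (use fin v in \<open>auto simp: N pdeg_def\<close>)
    moreover have "vl D' e' v = [a, b]" by (simp add: vl_bead N a_def b_def)
    ultimately show ?thesis using v fin by simp
  qed
  have "veq (jbr D ori e ?C) (jbr D' ori' e' ?C)"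
  proof (rule jbr_same_writhe[OF wr])
    have w: "wfm (add_mset (bd a b) (code D e' (nodes D - ?C))) e' ?C"
      using lab_wfm[OF e' idx_sub(1), of n h'] unfolding C cd .
    have finC: "finite ?C" using finite_idx wf by blast
    show "veq (br (code D e (nodes D - ?C)) e ?C (3 * writhe D ori)) (br (code D' e' (nodes D' - ?C)) e' ?C (3 * writhe D ori))"
      unfolding cd using veq_sym[OF br_bead[OF finC w ab]] unfolding ren_code e_def[abs_def] .
  qed
  then show ?thesis using jones_transfer[OF ok(1) lab height ok(2) e' h', of n] C by simp
qed

text \<open>The height is constant on the loop, which forces gap 0 at \<open>x\<close>: the new
  crossing is smoothed for every \<open>n\<close>, and its factor -A^3 or -A^(-3) is offset by the
  change of the writhe.\<close>

lemma jones_kink: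
  assumes ok: "oknot D ori" "oknot D' ori'" and mv: "kink_move Real D D' b x i p q"
    and ori: "\<And>v s. v \<in> nodes D \<inter> nodes D' \<Longrightarrow> s < pdeg D v \<Longrightarrow> ori' (v, s) = ori (v, s)"
  shows "veq (graphical_jones n D ori) (graphical_jones n D' ori')"
proof -
  have wf: "pd_wf D" "pd_wf D'" using ok by (auto simp: ok_wf)
  have k: "Real \<noteq> Bead" by simp
  note ctx = mv wf(1) k
  note B = kink_basic[OF ctx] and P = kink_darts[OF ctx] and L = kink_links[OF ctx]
  have fin: "finite (nodes D)" using wf by (simp add: pd_wf_def)
  obtain e where e: "lab D e" using lab_exists wf by blast
  obtain u where u: "u \<notin> e ` darts D"
    using ex_new_if_finite[OF infinite_UNIV_nat, of "e ` darts D"] finite_darts[OF wf(1)] by blast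
  let ?e = "kink_label x i p q e u"
  have e': "lab D' ?e" by (rule kink_lab[OF ctx e u])
  have row: "row ?e x i = [u, u, e p, e q]" and eold: "\<And>d. d \<in> darts D \<Longrightarrow> ?e d = e d"
    using kink_label_row[OF ctx, where e = e and u = u] by auto
  obtain h' where h': "height D' ori' h'" using height_exists ok by blast
  have xr: "x \<in> real_cr D'" by (simp add: real_cr_def B)
  have xd: "(x, s) \<in> darts D'" if "s < 4" for s using that by (simp add: darts_def B pdeg_def)
  have s1: "sg ori' (x, (i+1) mod 4) = - sg ori' (x, i)" using sg_nb[OF ok(2) xd[OF B(4)] L(1)] .
  have hl: "h' (x, (i+1) mod 4) = h' (x, i)" "h' p = h' (x, (i+2) mod 4)" "h' q = h' (x, (i+3) mod 4)"
    using h' xd[OF B(4)] xd[of "(i+2) mod 4"] xd[of "(i+3) mod 4"] L unfolding height_def by (metis, metis mod_less_divisor zero_less_numeral, metis mod_less_divisor zero_less_numeral)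
  note hr = height_rot[OF ok(2) h' xr B(4)]
  \<comment> \<open>The edges on both sides of the kink have the same height, which the deleted bead
    can take.\<close>
  have hpq: "h' q = h' p" unfolding hl(2,3) hr hl(1) s1 by simp
  have dx: "gap h' x = 0" unfolding gap_rot[OF B(4)] hr hl(1) s1 by simp
  have other: "nb D' w = nb D w \<and> fst (nb D w) \<noteq> b" if w: "w \<in> darts D" "fst w \<noteq> b" "w \<noteq> p" "w \<noteq> q" for w
  proof
    have "fst w \<noteq> x" using in_darts_node[OF w(1)] B(3) by auto
    then show "nb D' w = nb D w" unfolding B(10) using w by (intro lnks_notin) (auto simp: ends_def)
    show "fst (nb D w) \<noteq> b"
    proof
      assume "fst (nb D w) = b"
      then have "nb D w \<in> {(b,0),(b,1)}" using wf_nb[OF wf(1) w(1)] B(2) by (cases "nb D w") (auto simp: dart_bead)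
      then have "nb D w = nb D p \<or> nb D w = nb D q" unfolding P(4)[symmetric] by auto
      then show False using wf_nb[OF wf(1) w(1)] wf_nb[OF wf(1) P(1)] wf_nb[OF wf(1) P(2)] w by metis
    qed
  qed
  define h where "h d = (if fst d = b then h' p else h' d)" for d
  have dD: "w \<in> darts D'" if "w \<in> darts D" "fst w \<noteq> b" for w
    using that in_darts_node[OF that(1)] B(3) by (auto simp: darts_def B pdeg_def)
  have o: "ori' (w, s) = ori (w, s)" if "w \<in> real_cr D" "s < 4" for w s
    using that B(2) by (intro ori) (auto simp: real_cr_def B(8) pdeg_def)
  have real: "real_cr D' = insert x (real_cr D)" "x \<notin> real_cr D" using B(2,3) by (auto simp: real_cr_def B(8,9))
  have hb: "h (w, s) = h' (w, s)" if "w \<in> real_cr D" for w s using that B(2) by (auto simp: h_def real_cr_def)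
  have height: "height D ori h"
  proof (rule height_restrict[OF h'])
    show "h (nb D w) = h w" if w: "w \<in> darts D" for w
    proof (cases "fst w = b")
      case True
      then have "w \<in> {(b,0),(b,1)}" using w B(2) by (cases w) (auto simp: dart_bead)
      then have "w = nb D p \<or> w = nb D q" unfolding P(4)[symmetric] by auto
      then have "nb D w = p \<or> nb D w = q" using wf_nb[OF wf(1) P(1)] wf_nb[OF wf(1) P(2)] by auto
      then show ?thesis using True B(6,7) hpq by (auto simp: h_def)
    next
      case False
      show ?thesis
      proof (cases "w = p \<or> w = q")
        case True
        then have "nb D w \<in> {(b,0),(b,1)}" unfolding P(4)[symmetric] by auto
        then have "fst (nb D w) = b" by auto
        then show ?thesis using True False hpq by (auto simp: h_def)
      next
        case False
        then show ?thesis using other[OF w \<open>fst w \<noteq> b\<close>] \<open>fst w \<noteq> b\<close> h' dD[OF w] by (auto simp: h_def height_def)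
      qed
    qed
    show "h (w, 0) = h (w, 1)" if "w \<in> nodes D" "kind D w = Bead" for w
    proof (cases "w = b")
      case False
      have "w \<noteq> x" using that B(3) by auto
      then show ?thesis using h' that False unfolding height_def h_def by (auto simp: B(8,9))
    qed (simp add: h_def)
    show "w \<in> real_cr D' \<and> h (w, s) = h' (w, s) \<and> ori' (w, s) = ori (w, s)" if "w \<in> real_cr D" "s < 4" for w s
      using that real o hb by auto
  qed
  let ?C = "idx n D h"
  have C': "idx n D' h' = insert x ?C"
    using dx hb by (auto simp: idx_def real gap_def)
  have xC: "x \<notin> ?C" "b \<notin> ?C" using real(2) B(2) by (auto simp: idx_def real_cr_def)
  have finC: "finite ?C" using finite_idx wf by blast
  \<comment> \<open>The crossing is positive for even \<open>i\<close>, the parity that also selects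
    -A^3 in \<open>br_kink\<close>.\<close>
  have wr: "writhe D' ori' = writhe D ori + (if even i then 1 else - 1)"
  proof -
    have "csign ori' x = (if even i then 1 else - 1)"
      unfolding csign_rot[OF ok(2) xr B(4)] s1 by (simp add: sg_def)
    moreover have "(\<Sum>w\<in>real_cr D. csign ori' w) = (\<Sum>w\<in>real_cr D. csign ori w)"
    proof (rule sum.cong[OF refl])
      fix w assume w: "w \<in> real_cr D"
      show "csign ori' w = csign ori w"
        by (rule csign_cong[OF ok(2,1)]) (use w real row_cong[of ori' w ori] o in auto)
    qed
    ultimately show ?thesis using finite_real[OF wf(1)] real by (simp add: writhe_def)
  qed
  let ?N = "code D e (nodes D - {b} - ?C)"
  have c1: "code D' ?e (nodes D' - insert x ?C) = ?N"
  proof -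
    have "nodes D' - insert x ?C = nodes D - {b} - ?C" using B(3,8) by auto
    then show ?thesis using kink_code[OF ctx, of "nodes D - {b} - ?C" ?e e] eold by auto
  qed
  have c2: "code D e (nodes D - ?C) = add_mset (bd (e p) (e q)) ?N"
  proof -
    have "nodes D - ?C = insert b (nodes D - {b} - ?C)" using B(1) xC by auto
    then show ?thesis using code_insert[of "nodes D - {b} - ?C" b D e] fin kink_bead(1)[OF ctx e] by simp
  qed
  have w: "wfm ?N ?e (insert x ?C)" using lab_wfm[OF e' idx_sub(1), of n h'] unfolding C' c1 .
  have eC: "br M ?e ?C j = br M e ?C j" for M j
  proof (rule br_cong)
    show "row ?e c 0 = row e c 0" if "c \<in> ?C" for c
      using that idx_sub(1)[of n D h] by (intro row_cong eold) (auto simp: darts_def pdeg_def)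
  qed
  \<comment> \<open>The shift by 3 in \<open>br_kink\<close> cancels the change of 3w; its minus
    sign is left for the factor (-1)^w.\<close>
  have "veq (br ?N ?e (insert x ?C) (3 * writhe D' ori')) (\<lambda>t. - br (code D e (nodes D - ?C)) e ?C (3 * writhe D ori) t)"
    using br_kink[OF finC xC(1) B(4) row w, of "3 * writhe D' ori'"] unfolding eC c2 wr by (cases "even i") simp_all
  from veq_sign[OF this, of "even (writhe D' ori')"]
  have "veq (jbr D' ori' ?e (insert x ?C)) (jbr D ori e ?C)"
    unfolding jbr_def c1 by (rule veq_trans) (simp add: wr cong: if_cong)
  then show ?thesis using jones_transfer[OF ok(1) e height ok(2) e' h', of n] C' veq_sym by simp
qed

text \<open>The new crossings have opposite signs and, up to sign, the same gap. Hence they are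
  smoothed together, which is \<open>br_bigon_bead\<close>, or stay together, which is a flat second
  move in every state.\<close>

lemma jones_bigon:
  assumes ok: "oknot D ori" "oknot D' ori'" and mv: "bigon_move Real D D' b c x y i j p1 q1 p2 q2"
    and ori: "\<And>v s. v \<in> nodes D \<inter> nodes D' \<Longrightarrow> s < pdeg D v \<Longrightarrow> ori' (v, s) = ori (v, s)"
  shows "veq (graphical_jones n D ori) (graphical_jones n D' ori')"
proof -
  have wf: "pd_wf D" "pd_wf D'" using ok by (auto simp: ok_wf)
  have k: "Real \<noteq> Bead" by simp
  note ctx = mv wf(1) k
  note B = bigon_basic[OF ctx] and P = bigon_darts[OF ctx] and L = bigon_links[OF ctx]
  have "i mod 2 = (j + 1) mod 2" using mv unfolding bigon_move_def by (elim conjE) simp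
  then have ij: "odd (i + j)" by presburger
  have fin: "finite (nodes D)" using wf by (simp add: pd_wf_def)
  obtain e where e: "lab D e" using lab_exists wf by blast
  obtain u where u: "u \<notin> e ` darts D"
    using ex_new_if_finite[OF infinite_UNIV_nat, of "e ` darts D"] finite_darts[OF wf(1)] by blast
  obtain v where v: "v \<notin> insert u (e ` darts D)"
    using ex_new_if_finite[OF infinite_UNIV_nat, of "insert u (e ` darts D)"] finite_darts[OF wf(1)] by blast
  let ?e = "bigon_label x y i j p1 q1 p2 q2 e u v"
  have e': "lab D' ?e" by (rule bigon_lab[OF ctx e]) (use u v in auto)
  have row: "row ?e x i = [u, v, e p1, e p2]" "row ?e y j = [v, u, e q2, e q1]" and eold: "\<And>d. d \<in> darts D \<Longrightarrow> ?e d = e d"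
    using bigon_label_row[OF ctx, where e = e and u = u and v = v] by auto
  obtain h' where h': "height D' ori' h'" using height_exists ok by blast
  have kd: "kind D' x = Real" "kind D' y = Real" by (simp_all add: B(18))
  have xr: "x \<in> real_cr D'" "y \<in> real_cr D'" using kd by (simp_all add: real_cr_def B(17))
  have xd: "(x, s) \<in> darts D'" "(y, s) \<in> darts D'" if "s < 4" for s using that kd by (simp_all add: darts_def B(17) pdeg_def)
  have m4: "t mod 4 < 4" for t :: nat by simp
  note xi = xd(1)[OF B(9)] xd(1)[OF m4, of "i + 1"] xd(1)[OF m4, of "i + 2"] xd(1)[OF m4, of "i + 3"] 
    xd(2)[OF m4, of "j + 2"] xd(2)[OF m4, of "j + 3"]
  have sy: "sg ori' (y, (j+1) mod 4) = - sg ori' (x, i)" "sg ori' (y, j) = - sg ori' (x, (i+1) mod 4)"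
    using sg_nb[OF ok(2) xi(1) L(1)] sg_nb[OF ok(2) xi(2) L(2)] by auto
  have hnb: "h' d' = h' d" if "d \<in> darts D'" "nb D' d = d'" for d d' using h' that unfolding height_def by auto
  have hl: "h' (y, (j+1) mod 4) = h' (x, i)" "h' (y, j) = h' (x, (i+1) mod 4)"
    "h' p1 = h' (x, (i+2) mod 4)" "h' q1 = h' (y, (j+3) mod 4)" "h' p2 = h' (x, (i+3) mod 4)" "h' q2 = h' (y, (j+2) mod 4)"
    using hnb[OF xi(1) L(1)] hnb[OF xi(2) L(2)] hnb[OF xi(3) L(3)] hnb[OF xi(6) L(4)] hnb[OF xi(4) L(5)] hnb[OF xi(5) L(6)] by auto
  note hr = height_rot[OF ok(2) h' xr(1) B(9)] height_rot[OF ok(2) h' xr(2) B(10)]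
  \<comment> \<open>Each strand crosses the other one twice, from opposite sides, and so regains its
    height.\<close>
  have hpq: "h' q1 = h' p1" "h' q2 = h' p2" unfolding hl(3-6) hr hl(1,2) sy by simp_all
  have dxy: "gap h' y = gap h' x \<or> gap h' y = - gap h' x"
    unfolding gap_rot[OF B(9), of h' x] gap_rot[OF B(10), of h' y] hr hl(1,2) sy by (cases "even i"; cases "even j"; simp)
  then have dvdxy: "2 * int n dvd gap h' y \<longleftrightarrow> 2 * int n dvd gap h' x" by (metis dvd_minus_iff)
  have sxy: "csign ori' x + csign ori' y = 0"
    unfolding csign_rot[OF ok(2) xr(1) B(9)] csign_rot[OF ok(2) xr(2) B(10)] sy using ij by (cases "even i") simp_all
  have bc: "d \<in> {nb D p1, nb D q1} \<union> {nb D p2, nb D q2}" if "d \<in> darts D" "fst d \<in> {b, c}" for d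
    unfolding P(6,7) using that B(4,5) by (cases d) (auto simp: dart_bead)
  note nP = wf_nb[OF wf(1) P(1)] wf_nb[OF wf(1) P(2)] wf_nb[OF wf(1) P(3)] wf_nb[OF wf(1) P(4)]
  have bP: "fst (nb D p1) = b" "fst (nb D q1) = b" "fst (nb D p2) = c" "fst (nb D q2) = c"
    using P(6,7) by (metis fst_conv insertE insertI1 singletonD insertI2)+
  have other: "nb D' w = nb D w \<and> fst (nb D w) \<notin> {b, c}"
    if w: "w \<in> darts D" "fst w \<notin> {b, c}" "w \<noteq> p1" "w \<noteq> q1" "w \<noteq> p2" "w \<noteq> q2" for w
  proof
    have "fst w \<noteq> x" "fst w \<noteq> y" using in_darts_node[OF w(1)] B(6,7) by auto
    then show "nb D' w = nb D w" unfolding B(19) using w by (intro lnks_notin) (auto simp: ends_def)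
    show "fst (nb D w) \<notin> {b, c}"
    proof
      assume "fst (nb D w) \<in> {b, c}"
      then have "nb D w \<in> {nb D p1, nb D q1} \<union> {nb D p2, nb D q2}" using bc wf_nb[OF wf(1) w(1)] by blast
      then show False using wf_nb[OF wf(1) w(1)] nP w by (metis UnE insertE singletonD)
    qed
  qed
  define h where "h d = (if fst d = b then h' p1 else if fst d = c then h' p2 else h' d)" for d
  have dD: "w \<in> darts D'" if "w \<in> darts D" "fst w \<notin> {b, c}" for w
    using that in_darts_node[OF that(1)] B(6,7) by (auto simp: darts_def B pdeg_def)
  have o: "ori' (w, s) = ori (w, s)" if "w \<in> real_cr D" "s < 4" for w s
    using that B(4,5) by (intro ori) (auto simp: real_cr_def B(17) pdeg_def)
  have real: "real_cr D' = insert x (insert y (real_cr D))" "x \<notin> real_cr D" "y \<notin> real_cr D"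
    using B(4-7) by (auto simp: real_cr_def B(17,18))
  have hb: "h (w, s) = h' (w, s)" if "w \<in> real_cr D" for w s using that B(4,5) by (auto simp: h_def real_cr_def)
  have height: "height D ori h"
  proof (rule height_restrict[OF h'])
    show "h (nb D w) = h w" if w: "w \<in> darts D" for w
    proof (cases "fst w \<in> {b, c}")
      case True
      then have "w \<in> {nb D p1, nb D q1} \<union> {nb D p2, nb D q2}" using bc w by blast
      then consider "w = nb D p1" | "w = nb D q1" | "w = nb D p2" | "w = nb D q2" by blast
      then show ?thesis using nP bP B(3,13-16) hpq by cases (simp_all add: h_def)
    next
      case False
      show ?thesis
      proof (cases "w = p1 \<or> w = q1 \<or> w = p2 \<or> w = q2")
        case True
        then show ?thesis using False bP B(3) hpq by (auto simp: h_def)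
      next
        case n: False
        then show ?thesis using other[OF w False] False h' dD[OF w False] by (auto simp: h_def height_def)
      qed
    qed
    show "h (w, 0) = h (w, 1)" if "w \<in> nodes D" "kind D w = Bead" for w
    proof (cases "w = b \<or> w = c")
      case False
      have "w \<noteq> x" "w \<noteq> y" using that B(6,7) by auto
      then show ?thesis using h' that False unfolding height_def h_def by (auto simp: B(17,18))
    qed (auto simp: h_def)
    show "w \<in> real_cr D' \<and> h (w, s) = h' (w, s) \<and> ori' (w, s) = ori (w, s)" if "w \<in> real_cr D" "s < 4" for w s
      using that real o hb by auto
  qed
  let ?C = "idx n D h"
  have C': "idx n D' h' = (if 2 * int n dvd gap h' x then insert x (insert y ?C) else ?C)"
    using dvdxy hb by (auto simp: idx_def real gap_def)
  have xC: "x \<notin> ?C" "y \<notin> ?C" "b \<notin> ?C" "c \<notin> ?C" using real(2,3) B(4,5) by (auto simp: idx_def real_cr_def)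
  have finC: "finite ?C" using finite_idx wf by blast
  have wr: "writhe D' ori' = writhe D ori"
  proof -
    have "(\<Sum>w\<in>real_cr D. csign ori' w) = (\<Sum>w\<in>real_cr D. csign ori w)"
    proof (rule sum.cong[OF refl])
      fix w assume w: "w \<in> real_cr D"
      show "csign ori' w = csign ori w"
        by (rule csign_cong[OF ok(2,1)]) (use w real row_cong[of ori' w ori] o in auto)
    qed
    then show ?thesis using finite_real[OF wf(1)] real B(8) sxy by (simp add: writhe_def)
  qed
  let ?V = "nodes D - {b, c} - ?C"
  let ?N = "code D e ?V"
  have c0: "code D' ?e ?V = ?N" using bigon_code[OF ctx, of ?V ?e e] eold by auto
  have c2: "code D e (nodes D - ?C) = add_mset (bd (e p1) (e q1)) (add_mset (bd (e p2) (e q2)) ?N)"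
  proof -
    have n: "e (nb D (b,0)) = e (b,0)" "e (nb D (b,1)) = e (b,1)" "e (nb D (c,0)) = e (c,0)" "e (nb D (c,1)) = e (c,1)"
      using B(1,2,4,5) e by (simp_all add: lab_def dart_bead)
    have v: "vert (vl D e b) = bd (e p1) (e q1)" unfolding vl_bead[OF B(4)]
      using B(11) n by (elim disjE conjE) (simp_all add: bd_commute)
    have v': "vert (vl D e c) = bd (e p2) (e q2)" unfolding vl_bead[OF B(5)]
      using B(12) n by (elim disjE conjE) (simp_all add: bd_commute)
    have "nodes D - ?C = insert b (insert c ?V)" using B(1,2) xC by auto
    then show ?thesis using code_insert[of "insert c ?V" b D e] code_insert[of ?V c D e] fin v v' B(3) by simp
  qed
  have eC: "br M ?e ?C t = br M e ?C t" for M t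
  proof (rule br_cong)
    show "row ?e d 0 = row e d 0" if "d \<in> ?C" for d
      using that idx_sub(1)[of n D h] by (intro row_cong eold) (auto simp: darts_def pdeg_def)
  qed
  note w = lab_wfm[OF e' idx_sub(1), of n h']
  have "veq (jbr D ori e ?C) (jbr D' ori' ?e (idx n D' h'))"
  proof (rule jbr_same_writhe[OF wr], rule veq_sym, cases "2 * int n dvd gap h' x")
    case True
    have "nodes D' - insert x (insert y ?C) = ?V" using B(6,7,17) by auto
    then have c1: "code D' ?e (nodes D' - insert x (insert y ?C)) = ?N" using c0 by simp
    have w: "wfm ?N ?e (insert x (insert y ?C))" using w unfolding C' if_P[OF True] c1 .
    show "veq (br (code D' ?e (nodes D' - idx n D' h')) ?e (idx n D' h') (3 * writhe D ori)) (br (code D e (nodes D - ?C)) e ?C (3 * writhe D ori))"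
      unfolding C' if_P[OF True] c1 c2 using br_bigon_bead[OF finC xC(1,2) B(8-10) ij row w, of ?N] unfolding eC by simp
  next
    case False
    have "nodes D' - ?C = insert x (insert y ?V)" using xC B(17) by auto
    moreover have "vert (vl D' ?e x) = fl u v (e p1) (e p2)" "vert (vl D' ?e y) = fl v u (e q2) (e q1)"
      using vert_row[of D' x i ?e] vert_row[of D' y j ?e] row kd B(9,10) by simp_all
    ultimately have c1: "code D' ?e (nodes D' - ?C) = ?N + {#fl u v (e p1) (e p2), fl v u (e q2) (e q1)#}"
      using B(6-8) fin c0 by simp
    have w: "wfm (?N + {#fl u v (e p1) (e p2), fl v u (e q2) (e q1)#}) ?e ?C" using w unfolding C' if_not_P[OF False] c1 .
    \<comment> \<open>Each outer dart is joined in \<open>D\<close> to a bead and not to another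
      outer dart, so the four labels belong to different edges.\<close>
    have inj: "e s \<noteq> e t" if "s \<in> {p1, q1, p2, q2}" "t \<in> {p1, q1, p2, q2}" "s \<noteq> t" for s t
    proof
      assume "e s = e t"
      moreover have "s \<in> darts D" "t \<in> darts D" using that P by auto
      ultimately have "t = nb D s" using labD[OF e] that(3) by metis
      then have "fst t \<in> {b, c}" using bP that(1) by auto
      then show False using that(2) B(13-16) by auto
    qed
    have d: "distinct [e p1, e q1, e p2, e q2]" using P(5) inj by auto
    have "veq (br (?N + {#fl u v (e p1) (e p2), fl v u (e q2) (e q1)#}) ?e ?C (3 * writhe D ori))
      (br (?N + {#bd (e p1) (e q1), bd (e p2) (e q2)#}) ?e ?C (3 * writhe D ori))"
    proof (rule br_red[OF finC w])
      show "red (M + {#fl u v (e p1) (e p2), fl v u (e q2) (e q1)#}) (M + {#bd (e p1) (e q1), bd (e p2) (e q2)#})" for M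
        using red_bigon[OF d, of u v M] by (simp add: add_mset_commute)
    qed
    then show "veq (br (code D' ?e (nodes D' - idx n D' h')) ?e (idx n D' h') (3 * writhe D ori)) (br (code D e (nodes D - ?C)) e ?C (3 * writhe D ori))"
      unfolding C' if_not_P[OF False] c1 c2 eC by (simp add: add_mset_commute)
  qed
  then show ?thesis using jones_transfer[OF ok(1) e height ok(2) e' h', of n] by simp
qed

text \<open>Here a height of the old diagram is extended to the new one, and signs and gaps match
  crossing by crossing. What remains depends on how many of the three crossings are smoothed: none
  is a flat third move in every state, one is \<open>br_tri1\<close>, three is
  \<open>br_tri3\<close>.\<close>

lemma jones_tri:
  assumes ok: "oknot D ori" "oknot D' ori'" and mv: "tri_move Real D D' x y z a b c x' y' z'"
    and ori: "\<And>v s. v \<in> nodes D \<inter> nodes D' \<Longrightarrow> s < pdeg D v \<Longrightarrow> ori' (v, s) = ori (v, s)"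
  shows "veq (graphical_jones n D ori) (graphical_jones n D' ori')"
proof -
  have wf: "pd_wf D" "pd_wf D'" using ok by (auto simp: ok_wf)
  have k: "Real \<noteq> Bead" by simp
  note ctx = mv wf(1) k
  note B = tri_basic[OF ctx] and L = tri_links[OF ctx] and out = tri_outer[OF ctx] and dt = tri_darts[OF ctx]
  have fin: "finite (nodes D)" using wf by (simp add: pd_wf_def)
  have m4: "t mod 4 < 4" for t :: nat by simp
  have xyz: "x \<noteq> y" "x \<noteq> z" "y \<noteq> z" "x' \<noteq> y'" "x' \<noteq> z'" "y' \<noteq> z'" using B(4,14) by auto
  have kd: "kind D' x' = Real" "kind D' y' = Real" "kind D' z' = Real" by (simp_all add: B(19))
  have xr: "x \<in> real_cr D" "y \<in> real_cr D" "z \<in> real_cr D" "x' \<in> real_cr D'" "y' \<in> real_cr D'" "z' \<in> real_cr D'"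
    using B(1-3,5-7) kd by (simp_all add: real_cr_def B(18))
  have dt': "(x', s) \<in> darts D'" "(y', s) \<in> darts D'" "(z', s) \<in> darts D'" if "s < 4" for s
    using that kd by (simp_all add: darts_def B(18) pdeg_def)
  obtain e where e: "lab D e" using lab_exists wf by blast
  let ?e = "tri_label x y z a b c x' y' z' e"
  have e': "lab D' ?e" by (rule tri_lab[OF ctx e])
  note rold = tri_row_old[OF ctx e] and rnew = tri_label_row(1-3)[OF ctx, where e = e] and eold = tri_label_row(4)[OF ctx, where e = e]
  obtain h where h: "height D ori h" using height_exists ok by blast
  have outer: "sg ori' (nb D d) = - sg ori d" if d: "d \<in> darts D" "fst (nb D d) \<notin> {x, y, z}" for d
  proof -
    have n: "nb D d \<in> darts D" using wf_nb[OF wf(1) d(1)] by blast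
    then have "fst (nb D d) \<in> nodes D \<inter> nodes D'" using d(2) in_darts_node by (auto simp: B(18))
    moreover have "snd (nb D d) < pdeg D (fst (nb D d))" using n by (auto simp: darts_def)
    ultimately have "ori' (nb D d) = ori (nb D d)" using ori by (metis prod.collapse)
    then have "sg ori' (nb D d) = sg ori (nb D d)" by (simp add: sg_def)
    then show ?thesis using sg_nb[OF ok(1) d(1) refl] by simp
  qed
  have s1: "sg ori (y, b) = - sg ori (x, (a+1) mod 4)" "sg ori (z, c) = - sg ori (y, (b+1) mod 4)" "sg ori (x, a) = - sg ori (z, (c+1) mod 4)"
    using sg_nb[OF ok(1) dt(1)[OF m4] B(11)] sg_nb[OF ok(1) dt(2)[OF m4] B(12)] sg_nb[OF ok(1) dt(3)[OF m4] B(13)] by auto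
  note so = sg_opp[OF ok(1) xr(1) B(8)] sg_opp[OF ok(1) xr(2) B(9)] sg_opp[OF ok(1) xr(3) B(10)]
  note so' = sg_opp[OF ok(2) xr(4) B(8)] sg_opp[OF ok(2) xr(5) B(9)] sg_opp[OF ok(2) xr(6) B(10)]
  \<comment> \<open>The strands run through a new crossing by the same slots and in the same
    direction as through the old one.\<close>
  have s2: "sg ori' (x', a) = sg ori (x, a)" "sg ori' (x', (a+1) mod 4) = sg ori (x, (a+1) mod 4)"
    "sg ori' (z', c) = sg ori (z, c)" "sg ori' (z', (c+1) mod 4) = sg ori (z, (c+1) mod 4)"
    "sg ori' (y', b) = sg ori (y, b)" "sg ori' (y', (b+1) mod 4) = sg ori (y, (b+1) mod 4)"
    using sg_nb[OF ok(2) dt'(1)[OF B(8)] L(1)] outer[OF dt(3)[OF m4] out(1)]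
      sg_nb[OF ok(2) dt'(1)[OF m4] L(2)] outer[OF dt(2)[OF m4] out(2)]
      sg_nb[OF ok(2) dt'(3)[OF B(10)] L(5)] outer[OF dt(2)[OF m4] out(3)]
      sg_nb[OF ok(2) dt'(3)[OF m4] L(6)] outer[OF dt(1)[OF m4] out(4)]
      sg_nb[OF ok(2) dt'(2)[OF B(9)] L(8)] outer[OF dt(1)[OF m4] out(5)]
      sg_nb[OF ok(2) dt'(2)[OF m4] L(9)] outer[OF dt(3)[OF m4] out(6)]
    unfolding so s1 by linarith+
  have sgs: "sg ori' (x', s) = sg ori (x, s)" "sg ori' (y', s) = sg ori (y, s)" "sg ori' (z', s) = sg ori (z, s)" if "s < 4" for s
    using slot_cases[OF that B(8)] slot_cases[OF that B(9)] slot_cases[OF that B(10)] so so' s2 by metis+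
  have hnb: "h d' = h d" if "d \<in> darts D" "nb D d = d'" for d d' using h that unfolding height_def by auto
  have hl: "h (y, b) = h (x, (a+1) mod 4)" "h (z, c) = h (y, (b+1) mod 4)" "h (x, a) = h (z, (c+1) mod 4)"
    using hnb[OF dt(1)[OF m4] B(11)] hnb[OF dt(2)[OF m4] B(12)] hnb[OF dt(3)[OF m4] B(13)] by auto
  note hr = height_rot[OF ok(1) h xr(1) B(8)] height_rot[OF ok(1) h xr(2) B(9)] height_rot[OF ok(1) h xr(3) B(10)]
  \<comment> \<open>The strand that does not pass through a crossing is moved to its other side,
    which shifts the heights of all four edges there by the direction of that strand. For
    \<open>x\<close>, \<open>y\<close>, \<open>z\<close> this direction is read at
    \<open>(z, c)\<close>, \<open>(x, a)\<close>, \<open>(y, b)\<close>. A common shift does not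
    affect the gap.\<close>
  define h' where "h' d = (if fst d = x' then h (x, snd d) - sg ori (z, c) else if fst d = y' then h (y, snd d) - sg ori (x, a)
     else if fst d = z' then h (z, snd d) - sg ori (y, b) else h d)" for d
  have hx: "h' (x', s) = h (x, s) - sg ori (z, c)" "h' (y', s) = h (y, s) - sg ori (x, a)" "h' (z', s) = h (z, s) - sg ori (y, b)" for s
    using xyz by (simp_all add: h'_def)
  have hold: "h' d = h d" if "fst d \<in> nodes D" for d using that B(15-17) by (auto simp: h'_def)
  have hh: "h' (x',a) = h (z,(c+3) mod 4)" "h' (x',(a+1) mod 4) = h (y,(b+2) mod 4)"
      "h' (x',(a+2) mod 4) = h' (z',(c+3) mod 4)" "h' (x',(a+3) mod 4) = h' (y',(b+2) mod 4)"
      "h' (z',c) = h (y,(b+3) mod 4)" "h' (z',(c+1) mod 4) = h (x,(a+2) mod 4)"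
      "h' (z',(c+2) mod 4) = h' (y',(b+3) mod 4)" "h' (y',b) = h (x,(a+3) mod 4)" "h' (y',(b+1) mod 4) = h (z,(c+2) mod 4)"
    unfolding hx hr hl s1 by simp_all
  have hconst: "\<forall>d\<in>darts D'. h' (nb D' d) = h' d"
  proof (rule tri_const[OF ctx, of h])
    show "\<forall>d\<in>darts D. h (nb D d) = h d" using h by (simp add: height_def)
    show "h' d = h d" if "d \<in> darts D" for d using hold in_darts_node[OF that] .
  qed (fact hh)+
  have o: "ori' (w, s) = ori (w, s)" if "w \<in> real_cr D - {x, y, z}" "s < 4" for w s
    using that by (intro ori) (auto simp: real_cr_def B(18) pdeg_def)
  have real: "real_cr D' = {x', y', z'} \<union> (real_cr D - {x, y, z})"
    using B(15-17) by (auto simp: real_cr_def B(18,19))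
  have height: "height D' ori' h'"
    unfolding height_def
  proof (intro conjI hconst ballI impI allI)
    fix w assume w: "w \<in> nodes D'"
    show "h' (w, 0) = h' (w, 1)" if "kind D' w = Bead"
    proof -
      have "w \<noteq> x'" "w \<noteq> y'" "w \<noteq> z'" using that kd by auto
      then have "w \<in> nodes D" "kind D w = Bead" using w that by (auto simp: B(18,19))
      then show ?thesis using h hold unfolding height_def by auto
    qed
    fix s assume kw: "kind D' w = Real" and s: "(s::nat) < 4"
    then have "w \<in> {x', y', z'} \<union> (real_cr D - {x, y, z})" using w real by (auto simp: real_cr_def)
    then consider "w = x'" | "w = y'" | "w = z'" | "w \<in> real_cr D - {x, y, z}" by blast
    then show "h' (w, (s + 2) mod 4) - h' (w, s) = sg ori' (w, (s + 1) mod 4)"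
    proof cases
      case 1 then show ?thesis using real_height[OF h xr(1) s] sgs(1)[OF m4] by (simp add: hx)
    next
      case 2 then show ?thesis using real_height[OF h xr(2) s] sgs(2)[OF m4] by (simp add: hx)
    next
      case 3 then show ?thesis using real_height[OF h xr(3) s] sgs(3)[OF m4] by (simp add: hx)
    next
      case 4
      then have n: "fst (w, t) \<in> nodes D" for t :: nat by (auto simp: real_cr_def)
      have "sg ori' (w, (s + 1) mod 4) = sg ori (w, (s + 1) mod 4)" using o[OF 4 m4] by (simp add: sg_def)
      then show ?thesis using real_height[OF h _ s, of w] 4 hold[OF n] by simp
    qed
  qed
  define px where "px \<longleftrightarrow> 2 * int n dvd gap h x"
  define py where "py \<longleftrightarrow> 2 * int n dvd gap h y"
  define pz where "pz \<longleftrightarrow> 2 * int n dvd gap h z"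
  have dr: "gap h' x' = gap h x" "gap h' y' = gap h y" "gap h' z' = gap h z" by (simp_all add: gap_def hx)
  \<comment> \<open>\<open>K v i\<close> is the gap up to a sign, which divisibility ignores. Read
    from the slots of the triangle the three values add up to zero, so two divisible ones force the
    third.\<close>
  have two: "(px \<and> py \<longrightarrow> pz) \<and> (py \<and> pz \<longrightarrow> px) \<and> (px \<and> pz \<longrightarrow> py)"
  proof -
    define K where "K v i = h (v, i) + h (v, (i + 2) mod 4) - h (v, (i + 1) mod 4) - h (v, (i + 3) mod 4)" for v i
    have dK: "2 * int n dvd gap h v \<longleftrightarrow> 2 * int n dvd K v i" if "i < 4" for v i
      unfolding gap_rot[OF that] K_def by (cases "even i") (simp_all add: dvd_minus_iff del: minus_diff_eq)
    have p: "px = (2 * int n dvd K x a)" "py = (2 * int n dvd K y b)" "pz = (2 * int n dvd K z c)"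
      unfolding px_def py_def pz_def by (rule dK[OF B(8)] dK[OF B(9)] dK[OF B(10)])+
    have "K x a + K y b + K z c = 0" unfolding K_def hr hl s1 by simp
    then have "K z c = - (K x a + K y b)" "K x a = - (K y b + K z c)" "K y b = - (K x a + K z c)" by simp_all
    then show ?thesis unfolding p by (metis dvd_add dvd_minus_iff)
  qed
  let ?C = "idx n D h" and ?C' = "idx n D' h'"
  define C0 where "C0 = ?C - {x, y, z}"
  have finC: "finite C0" using finite_idx[OF wf(1)] by (simp add: C0_def)
  have C: "?C = {w \<in> {x, y, z}. 2 * int n dvd gap h w} \<union> C0"
    using xr(1-3) by (auto simp: C0_def idx_def)
  have xC: "x \<notin> C0" "y \<notin> C0" "z \<notin> C0" "x' \<notin> C0" "y' \<notin> C0" "z' \<notin> C0"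
    using B(15-17) by (auto simp: C0_def idx_def real_cr_def)
  have C': "?C' = {w \<in> {x', y', z'}. 2 * int n dvd gap h' w} \<union> C0"
  proof -
    have "gap h' w = gap h w" if "w \<in> real_cr D" for w using that hold by (auto simp: gap_def real_cr_def)
    then show ?thesis by (auto simp: C0_def idx_def real)
  qed
  have wr: "writhe D' ori' = writhe D ori"
  proof -
    have "csign ori' x' = csign ori x" "csign ori' y' = csign ori y" "csign ori' z' = csign ori z"
      unfolding csign_sg[OF ok(1) xr(1)] csign_sg[OF ok(1) xr(2)] csign_sg[OF ok(1) xr(3)]
        csign_sg[OF ok(2) xr(4)] csign_sg[OF ok(2) xr(5)] csign_sg[OF ok(2) xr(6)] by (simp_all add: sgs)
    moreover have "(\<Sum>w\<in>real_cr D - {x, y, z}. csign ori' w) = (\<Sum>w\<in>real_cr D - {x, y, z}. csign ori w)"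
    proof (rule sum.cong[OF refl])
      fix w assume w: "w \<in> real_cr D - {x, y, z}"
      show "csign ori' w = csign ori w"
        by (rule csign_cong[OF ok(2,1)]) (use w real row_cong[of ori' w ori] o in auto)
    qed
    moreover have "x' \<notin> real_cr D" "y' \<notin> real_cr D" "z' \<notin> real_cr D" using B(15-17) by (auto simp: real_cr_def)
    ultimately have "writhe D' ori' = (csign ori x + csign ori y + csign ori z) + (\<Sum>w\<in>real_cr D - {x, y, z}. csign ori w)"
      using xyz finite_real[OF wf(1)] by (simp add: writhe_def real)
    also have "csign ori x + csign ori y + csign ori z = (\<Sum>w\<in>{x, y, z}. csign ori w)" using xyz by simp
    also have "(\<Sum>w\<in>{x, y, z}. csign ori w) + (\<Sum>w\<in>real_cr D - {x, y, z}. csign ori w) = writhe D ori"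
      unfolding writhe_def using sum.subset_diff[of "{x, y, z}" "real_cr D" "csign ori"] xr finite_real[OF wf(1)] by simp
    finally show ?thesis .
  qed
  let ?V = "nodes D - {x, y, z} - C0"
  define N where "N = code D e ?V"
  have c0: "code D' ?e ?V = N" unfolding N_def using tri_code[OF ctx, of ?V ?e e] eold by auto
  have finV: "finite ?V" using fin by simp
  define m1 m2 m3 p1 p2 p3 p4 p5 p6 where m: "m1 = e (x,(a+1) mod 4)" "m2 = e (y,(b+1) mod 4)" "m3 = e (x,a)"
    "p1 = e (z,(c+3) mod 4)" "p2 = e (y,(b+2) mod 4)" "p3 = e (y,(b+3) mod 4)"
    "p4 = e (x,(a+2) mod 4)" "p5 = e (x,(a+3) mod 4)" "p6 = e (z,(c+2) mod 4)"
  have R: "row e x a = [m3, m1, p4, p5]" "row e y b = [m1, m2, p2, p3]" "row e z c = [m2, m3, p6, p1]"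
    "row ?e x' a = [p1, p2, m3, m1]" "row ?e y' b = [p5, p6, m1, m2]" "row ?e z' c = [p3, p4, m2, m3]"
    unfolding rold rnew m by (rule refl)+
  have vx: "vert (vl D e x) = fl m3 m1 p4 p5" "vert (vl D e y) = fl m1 m2 p2 p3" "vert (vl D e z) = fl m2 m3 p6 p1"
    "vert (vl D' ?e x') = fl p1 p2 m3 m1" "vert (vl D' ?e y') = fl p5 p6 m1 m2" "vert (vl D' ?e z') = fl p3 p4 m2 m3"
    using vert_row[of D x a e] vert_row[of D y b e] vert_row[of D z c e] vert_row[of D' x' a ?e] vert_row[of D' y' b ?e] vert_row[of D' z' c ?e]
      B(5-10) kd by (simp_all add: R)
  \<comment> \<open>An outer dart has its partner outside of the triangle, so no two of the six
    belong to the same edge.\<close>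
  have dist: "distinct [p1, p2, p3, p4, p5, p6]"
  proof -
    have inj: "e s \<noteq> e t" if "s \<in> darts D" "t \<in> darts D" "s \<noteq> t" "fst (nb D s) \<notin> {x, y, z}" "fst t \<in> {x, y, z}" for s t
      using labD[OF e that(1,2)] that by metis
    note I = inj[OF dt(3)[OF m4] _ _ out(1)] inj[OF dt(2)[OF m4] _ _ out(2)] inj[OF dt(2)[OF m4] _ _ out(3)]
      inj[OF dt(1)[OF m4] _ _ out(4)] inj[OF dt(1)[OF m4] _ _ out(5)]
    have n: "p1 \<noteq> p2" "p1 \<noteq> p3" "p1 \<noteq> p4" "p1 \<noteq> p5" "p1 \<noteq> p6" "p2 \<noteq> p3" "p2 \<noteq> p4" "p2 \<noteq> p5" "p2 \<noteq> p6"
      "p3 \<noteq> p4" "p3 \<noteq> p5" "p3 \<noteq> p6" "p4 \<noteq> p5" "p4 \<noteq> p6" "p5 \<noteq> p6"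
      unfolding m by (rule I; simp only: dt m4 fst_conv insert_iff simp_thms prod.inject xyz xyz[symmetric] slot_neq[OF B(8)] slot_neq[OF B(9)] slot_neq[OF B(10)] slot_neq[OF B(10), symmetric])+
    then show ?thesis by simp
  qed
  have ee: "row e w 0 = row ?e w 0" if "w \<in> C0" for w
    using that idx_sub(1)[of n D h] by (intro row_cong eold[symmetric]) (auto simp: C0_def darts_def pdeg_def)
  have eC: "br M e C0 t = br M ?e C0 t" for M t by (rule br_cong) (rule ee)
  note w = lab_wfm[OF e idx_sub(1), of n h] and w' = lab_wfm[OF e' idx_sub(1), of n h']
  have goal: "veq (br (code D e (nodes D - ?C)) e ?C j) (br (code D' ?e (nodes D' - ?C')) ?e ?C' j)" for j
  proof -
    consider (none) "\<not> px" "\<not> py" "\<not> pz" | (X) "px" "\<not> py" "\<not> pz" | (Y) "\<not> px" "py" "\<not> pz" | (Z) "\<not> px" "\<not> py" "pz"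
      | (all) px py pz using two by blast
    then show ?thesis
    proof cases
      case none
      then have c: "?C = C0" "?C' = C0" unfolding C C' using dr by (auto simp: px_def py_def pz_def)
      have "nodes D - C0 = insert x (insert y (insert z ?V))" "nodes D' - C0 = insert x' (insert y' (insert z' ?V))"
        using B(1-3,18) xC by auto
      then have k: "code D e (nodes D - C0) = N + {#fl m3 m1 p4 p5, fl m1 m2 p2 p3, fl m2 m3 p6 p1#}"
        "code D' ?e (nodes D' - C0) = N + {#fl p1 p2 m3 m1, fl p5 p6 m1 m2, fl p3 p4 m2 m3#}"
        using xyz finV c0 B(15-17) by (simp_all add: vx N_def[symmetric])
      have "veq (br (N + {#fl m3 m1 p4 p5, fl m1 m2 p2 p3, fl m2 m3 p6 p1#}) e C0 j) (br (N + {#fl p1 p2 m3 m1, fl p5 p6 m1 m2, fl p3 p4 m2 m3#}) e C0 j)"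
      proof (rule br_red[OF finC])
        show "wfm (N + {#fl m3 m1 p4 p5, fl m1 m2 p2 p3, fl m2 m3 p6 p1#}) e C0" using w unfolding c k .
        show "red (M + {#fl m3 m1 p4 p5, fl m1 m2 p2 p3, fl m2 m3 p6 p1#}) (M + {#fl p1 p2 m3 m1, fl p5 p6 m1 m2, fl p3 p4 m2 m3#})" for M
          using red_tri[OF dist, of m3 m1 m2 M] by (simp add: add_mset_commute)
      qed
      then show ?thesis unfolding c k eC .
    next
      case X
      then have c: "?C = insert x C0" "?C' = insert x' C0" unfolding C C' using dr by (auto simp: px_def py_def pz_def)
      have "nodes D - insert x C0 = insert y (insert z ?V)" "nodes D' - insert x' C0 = insert y' (insert z' ?V)"
        using B(1-3,15-18) xC xyz by auto
      then have k: "code D e (nodes D - insert x C0) = add_mset (fl m1 m2 p2 p3) (add_mset (fl m2 m3 p6 p1) N)"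
        "code D' ?e (nodes D' - insert x' C0) = add_mset (fl p5 p6 m1 m2) (add_mset (fl p3 p4 m2 m3) N)"
        using xyz finV c0 B(15-17) by (simp_all add: vx N_def[symmetric])
      \<comment> \<open>\<open>br_tri1\<close> resolves its third crossing. Turning the triangle
        brings \<open>x\<close> into that place and shifts the outer labels cyclically.\<close>
      have d: "distinct [p5, p6, p1, p2, p3, p4]" using dist by auto
      show ?thesis unfolding c k
        by (rule br_tri1[OF finC xC(1,4) B(8) d R(1,4) ee]) (use w w' in \<open>simp_all only: c k\<close>)
    next
      case Y
      then have c: "?C = insert y C0" "?C' = insert y' C0" unfolding C C' using dr by (auto simp: px_def py_def pz_def)
      have "nodes D - insert y C0 = insert z (insert x ?V)" "nodes D' - insert y' C0 = insert z' (insert x' ?V)"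
        using B(1-3,15-18) xC xyz by auto
      then have k: "code D e (nodes D - insert y C0) = add_mset (fl m2 m3 p6 p1) (add_mset (fl m3 m1 p4 p5) N)"
        "code D' ?e (nodes D' - insert y' C0) = add_mset (fl p3 p4 m2 m3) (add_mset (fl p1 p2 m3 m1) N)"
        using xyz finV c0 B(15-17) by (simp_all add: vx N_def[symmetric])
      have d: "distinct [p3, p4, p5, p6, p1, p2]" using dist by auto
      show ?thesis unfolding c k
        by (rule br_tri1[OF finC xC(2,5) B(9) d R(2,5) ee]) (use w w' in \<open>simp_all only: c k\<close>)
    next
      case Z
      then have c: "?C = insert z C0" "?C' = insert z' C0" unfolding C C' using dr by (auto simp: px_def py_def pz_def)
      have "nodes D - insert z C0 = insert x (insert y ?V)" "nodes D' - insert z' C0 = insert x' (insert y' ?V)"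
        using B(1-3,15-18) xC xyz by auto
      then have k: "code D e (nodes D - insert z C0) = add_mset (fl m3 m1 p4 p5) (add_mset (fl m1 m2 p2 p3) N)"
        "code D' ?e (nodes D' - insert z' C0) = add_mset (fl p1 p2 m3 m1) (add_mset (fl p5 p6 m1 m2) N)"
        using xyz finV c0 B(15-17) by (simp_all add: vx N_def[symmetric])
      show ?thesis unfolding c k
        by (rule br_tri1[OF finC xC(3,6) B(10) dist R(3,6) ee]) (use w w' in \<open>simp_all only: c k\<close>)
    next
      case all
      then have c: "?C = {x, y, z} \<union> C0" "?C' = {x', y', z'} \<union> C0" unfolding C C' using dr by (auto simp: px_def py_def pz_def)
      have "nodes D - ({x, y, z} \<union> C0) = ?V" "nodes D' - ({x', y', z'} \<union> C0) = ?V"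
        using B(15-18) by auto
      then have k: "code D e (nodes D - ({x, y, z} \<union> C0)) = N" "code D' ?e (nodes D' - ({x', y', z'} \<union> C0)) = N"
        using c0 by (simp_all add: N_def)
      have ww: "wfm N e ({x, y, z} \<union> C0)" "wfm N ?e ({x', y', z'} \<union> C0)" using w w' by (simp_all only: c k)
      have perm: "insert z (insert x (insert y C0)) = {x, y, z} \<union> C0" "insert x (insert y (insert z C0)) = {x, y, z} \<union> C0"
        "insert y (insert z (insert x C0)) = {x, y, z} \<union> C0" "insert z' (insert x' (insert y' C0)) = {x', y', z'} \<union> C0"
        "insert x' (insert y' (insert z' C0)) = {x', y', z'} \<union> C0" "insert y' (insert z' (insert x' C0)) = {x', y', z'} \<union> C0"
        by auto
      \<comment> \<open>By the condition in \<open>r3\<close>, some side of the triangle lies on a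
        strand that is over at both its ends. The sum of the starting slots of these two crossings
        is odd, and the third crossing is the one that \<open>br_tri3\<close> resolves.\<close>
      have "odd (a + b) \<or> odd (b + c) \<or> odd (c + a)" using B(21) by auto
      then show ?thesis unfolding c k
      proof (elim disjE)
        assume o: "odd (a + b)"
        show "veq (br N e ({x, y, z} \<union> C0) j) (br N ?e ({x', y', z'} \<union> C0) j)"
          by (rule br_tri3[OF finC _ _ _ _ B(8,9,10) o R ee, unfolded perm]) (use xyz xC ww in auto)
      next
        assume o: "odd (b + c)"
        show "veq (br N e ({x, y, z} \<union> C0) j) (br N ?e ({x', y', z'} \<union> C0) j)"
          by (rule br_tri3[OF finC _ _ _ _ B(9,10,8) o R(2,3,1) R(5,6,4) ee, unfolded perm]) (use xyz xC ww in auto)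
      next
        assume o: "odd (c + a)"
        show "veq (br N e ({x, y, z} \<union> C0) j) (br N ?e ({x', y', z'} \<union> C0) j)"
          by (rule br_tri3[OF finC _ _ _ _ B(10,8,9) o R(3,1,2) R(6,4,5) ee, unfolded perm]) (use xyz xC ww in auto)
      qed
    qed
  qed
  have "veq (jbr D ori e ?C) (jbr D' ori' ?e ?C')"
    by (rule jbr_same_writhe[OF wr goal])
  then show ?thesis using jones_transfer[OF ok(1) e h ok(2) e' height, of n] by simp
qed

lemma jones_ostep:
  assumes "ostep K K'"
  shows "veq (graphical_jones n (fst K) (snd K)) (graphical_jones n (fst K') (snd K'))"
proof -
  have ok: "oknot (fst K) (snd K)" "oknot (fst K') (snd K')" using assms by (auto simp: ostep_def)
  from assms consider (iso) f r where "iso_by f r (fst K) (fst K')" "\<forall>d\<in>darts (fst K). snd K' (imap f r (fst K) d) = snd K d"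
    | (move) "rmove Real (fst K) (fst K')" "\<forall>v\<in>nodes (fst K) \<inter> nodes (fst K'). \<forall>s<pdeg (fst K) v. snd K' (v,s) = snd K (v,s)"
    unfolding ostep_def by blast
  then show ?thesis
  proof cases
    case iso
    then show ?thesis using jones_iso[OF ok] by blast
  next
    case move
    have o: "\<And>v s. v \<in> nodes (fst K) \<inter> nodes (fst K') \<Longrightarrow> s < pdeg (fst K) v \<Longrightarrow> snd K' (v,s) = snd K (v,s)"
      using move(2) by blast
    from move(1) consider "bead_ins (fst K) (fst K')" | "r1 Real (fst K) (fst K')" | "r2 Real (fst K) (fst K')" | "r3 Real (fst K) (fst K')"
      unfolding rmove_def by blast
    then show ?thesis
    proof cases
      case 1
      show ?thesis by (rule jones_bead[OF ok 1 o])
    next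
      case 2
      then obtain b x i p q where "kink_move Real (fst K) (fst K') b x i p q" unfolding r1_iff by (elim exE)
      from jones_kink[OF ok this o] show ?thesis .
    next
      case 3
      then obtain b c x y i j p1 q1 p2 q2 where "bigon_move Real (fst K) (fst K') b c x y i j p1 q1 p2 q2"
        unfolding r2_iff by (elim exE)
      from jones_bigon[OF ok this o] show ?thesis .
    next
      case 4
      then obtain x y z a b c x' y' z' where "tri_move Real (fst K) (fst K') x y z a b c x' y' z'"
        unfolding r3_iff by (elim exE)
      from jones_tri[OF ok this o] show ?thesis .
    qed
  qed
qed

theorem theorem4p4:
  fixes n :: nat and D D' :: pd and ori ori' :: "dart \<Rightarrow> bool"
  assumes "oknot D ori"
    and "vk_equiv (D, ori) (D', ori')"
  shows "veq (graphical_jones n D ori) (graphical_jones n D' ori')"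
proof -
  have "veq (graphical_jones n D ori) (graphical_jones n (fst K) (snd K))" if "equivclp ostep (D, ori) K" for K
    using that
  proof (induction rule: equivclp_induct)
    case base
    then show ?case by simp
  next
    case (step K K')
    then show ?case using jones_ostep[of K K' n] jones_ostep[of K' K n] veq_trans veq_sym by metis
  qed
  from this[of "(D', ori')"] show ?thesis using assms(2) by (simp add: vk_equiv_def)
qed

end
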